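(* Let $\ell\ge 2$ be an integer, $c\in D(\ell,1)$, and let $F=F_{\ell,c}:Q\to Q$ be the map induced on $Q=\mathbb{C}/2\pi i\mathbb{Z}$ by $f_{\ell,c}(z)=c-(\ell-1)\log c+\ell z-e^z$. For every $t>1$, the probability measure $m_t$ is the unique $(t,e^{P(t)})$-conformal probability measure for $F$ on $\mathcal{J}(F)$. Moreover, $m_t$ is ergodic with respect to each iterate $F^j$, $j\ge 1$, of $F$.
   Context: $D(\ell,1)=\{c\in\mathbb{C}:|c-\ell|<1\}$ and $\log$ is the principal branch. Since $f_{\ell,c}(z+2\pi i k)=f_{\ell,c}(z)+2\pi i\ell k$ for $k\in\mathbb{Z}$, $f=f_{\ell,c}$ induces a unique holomorphic map $F:Q\to Q$ with $F\circ\Pi=\Pi\circ f$, where $\Pi:\mathbb{C}\to Q$ is the quotient map. $|F'|$ is defined by $|F'(\Pi(z))|=|f'(z)|=|\ell-e^z|$, and similarly for iterates. The Julia set $\mathcal{J}(f)$ is the complement in $\mathbb{C}$ of the set where the iterates of $f$ form a normal family, and $\mathcal{J}(F)=\Pi(\mathcal{J}(f))\subset Q$. Pressure: for $t>1$ and $z\in\mathcal{J}(F)$, $P(t)=\lim_{n\to\infty}\frac1n\log\sum_{x\in F^{-n}(z)}|(F^n)'(x)|^{-t}$; for $t>1$ this limit exists, is finite, and does not depend on $z\in\mathcal{J}(F)$. For $t,\alpha\in\mathbb{R}$, a Borel measure $\nu$ on $\mathcal{J}(F)$ is $(t,\alpha)$-conformal for $F$ if for every Borel set $A\subset\mathcal{J}(F)$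 such that $F|_A$ is injective, $\nu(F(A))=\int_A\alpha|F'|^t\,d\nu$. For $t>1$, $m_t$ denotes a $(t,e^{P(t)})$-conformal Borel probability measure on $\mathcal{J}(F)$ (such a measure exists). A (not necessarily invariant) probability measure $\nu$ is ergodic with respect to $F^j$ if every Borel set $G\subset\mathcal{J}(F)$ with $F^{-j}(G)=G$ satisfies $\nu(G)\in\{0,1\}$. *)

theory Defs
  imports "HOL-Probability.Probability" "HOL-Complex_Analysis.Complex_Analysis"
begin

section \<open>The cylinder \<open>Q = \<complex> / 2\<pi>i\<int>\<close>\<close>

definition cyl_rel :: "complex \<Rightarrow> complex \<Rightarrow> bool" where
  "cyl_rel z w \<longleftrightarrow> (\<exists>k::int. w = z + 2 * of_real pi * \<i> * of_int k)"

lemma equivp_cyl_rel: "equivp cyl_rel"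
proof (rule equivpI)
  show "reflp cyl_rel"
    unfolding reflp_def cyl_rel_def by (auto intro: exI[of _ 0])
  show "symp cyl_rel"
    unfolding symp_def cyl_rel_def
  proof (intro allI impI, elim exE)
    fix z w :: complex and k :: int
    assume "w = z + 2 * of_real pi * \<i> * of_int k"
    then show "\<exists>k. z = w + 2 * of_real pi * \<i> * of_int k"
      by (intro exI[of _ "- k"]) simp
  qed
  show "transp cyl_rel"
    unfolding transp_def cyl_rel_def
  proof (intro allI impI, elim exE)
    fix x y z :: complex and k k' :: int
    assume "y = x + 2 * of_real pi * \<i> * of_int k" "z = y + 2 * of_real pi * \<i> * of_int k'"
    then show "\<exists>k. z = x + 2 * of_real pi * \<i> * of_int k"
      by (intro exI[of _ "k + k'"]) (simp add: algebra_simps)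
  qed
qed

quotient_type cyl = complex / cyl_rel
  by (rule equivp_cyl_rel)

lift_definition cyl_proj :: "complex \<Rightarrow> cyl" is "\<lambda>z. z" .

text \<open>\<open>Q\<close> carries the quotient topology, so \<open>borel :: cyl measure\<close> is its Borel \<open>\<sigma>\<close>-algebra.\<close>

instantiation cyl :: topological_space
begin

definition open_cyl :: "cyl set \<Rightarrow> bool" where
  "open_cyl U \<longleftrightarrow> open (cyl_proj -` U)"

instance
proof
  show "open (UNIV :: cyl set)"
    by (simp add: open_cyl_def)
  show "open (S \<inter> T)" if "open S" "open T" for S T :: "cyl set"
    using that by (simp add: open_cyl_def vimage_Int open_Int)
  show "open (\<Union>K)" if "\<forall>S\<in>K. open S" for K :: "cyl set set"
    using that by (auto simp: open_cyl_def vimage_Union)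
qed

end

section \<open>The maps \<open>f\<close> and \<open>F\<close>\<close>

definition fmap_lc :: "nat \<Rightarrow> complex \<Rightarrow> complex \<Rightarrow> complex" where
  "fmap_lc l c z = c - (of_nat l - 1) * Ln c + of_nat l * z - exp z"

lemma exp_add_period: "exp (z + 2 * of_real pi * \<i> * of_int k) = exp (z :: complex)"
  using exp_integer_2pi[of "of_int k"] by (simp add: exp_add algebra_simps)

lemma fmap_lc_add_period:
  "fmap_lc l c (z + 2 * of_real pi * \<i> * of_int k) =
   fmap_lc l c z + 2 * of_real pi * \<i> * of_int (int l * k)"
  unfolding fmap_lc_def exp_add_period by (simp add: algebra_simps)

lemma fmap_lc_funpow_add_period:
  "(fmap_lc l c ^^ n) (z + 2 * of_real pi * \<i> * of_int k) =
   (fmap_lc l c ^^ n) z + 2 * of_real pi * \<i> * of_int (int l ^ n * k)"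
proof (induction n)
  case (Suc n)
  show ?case
    unfolding funpow.simps comp_apply Suc.IH fmap_lc_add_period by (simp add: algebra_simps)
qed simp

lift_definition F_lc :: "nat \<Rightarrow> complex \<Rightarrow> cyl \<Rightarrow> cyl" is fmap_lc
  unfolding cyl_rel_def using fmap_lc_add_period by blast

lemma F_lc_proj: "F_lc l c (cyl_proj z) = cyl_proj (fmap_lc l c z)"
  by transfer (auto simp: equivp_reflp[OF equivp_cyl_rel])

lemma deriv_fmap_lc: "deriv (fmap_lc l c) z = of_nat l - exp z"
  unfolding fmap_lc_def by (rule DERIV_imp_deriv) (auto intro!: derivative_eq_intros)

lemma fmap_lc_funpow_holomorphic: "(fmap_lc l c ^^ n) holomorphic_on UNIV"
proof (induction n)
  case (Suc n)
  have "fmap_lc l c holomorphic_on UNIV"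
    unfolding fmap_lc_def by (intro holomorphic_intros)
  then have "(fmap_lc l c \<circ> (fmap_lc l c ^^ n)) holomorphic_on UNIV"
    by (intro holomorphic_on_compose_gen[OF Suc.IH]) auto
  then show ?case by (simp add: o_def)
qed (simp add: id_def)

lemma deriv_fmap_lc_funpow_add_period:
  "deriv (fmap_lc l c ^^ n) (z + 2 * of_real pi * \<i> * of_int k) = deriv (fmap_lc l c ^^ n) z"
proof -
  let ?g = "fmap_lc l c ^^ n" and ?a = "2 * of_real pi * \<i> * of_int k :: complex"
  let ?b = "2 * of_real pi * \<i> * of_int (int l ^ n * k) :: complex"
  have d: "(?g has_field_derivative deriv ?g w) (at w)" for w
    using fmap_lc_funpow_holomorphic holomorphic_derivI by blast
  have "((\<lambda>w. ?g (w + ?a)) has_field_derivative deriv ?g (z + ?a)) (at z)"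
    using d[of "z + ?a"] DERIV_shift[of ?g _ z ?a] by blast
  moreover have "((\<lambda>w. ?g w + ?b) has_field_derivative deriv ?g z) (at z)"
    using d[of z] by (auto intro!: derivative_eq_intros)
  ultimately show ?thesis
    unfolding fmap_lc_funpow_add_period by (rule DERIV_unique)
qed

text \<open>\<open>F_abs_deriv l c n\<close> is \<open>|(F\<^sup>n)'|\<close>.\<close>

lift_definition F_abs_deriv :: "nat \<Rightarrow> complex \<Rightarrow> nat \<Rightarrow> cyl \<Rightarrow> real"
  is "\<lambda>l c n z. cmod (deriv (fmap_lc l c ^^ n) z)"
  unfolding cyl_rel_def using deriv_fmap_lc_funpow_add_period by metis

lemma F_abs_deriv_proj: "F_abs_deriv l c n (cyl_proj z) = cmod (deriv (fmap_lc l c ^^ n) z)"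
  by transfer simp

lemma F_abs_deriv_1_proj: "F_abs_deriv l c 1 (cyl_proj z) = cmod (of_nat l - exp z)"
  by (simp add: F_abs_deriv_proj deriv_fmap_lc)

section \<open>Julia sets\<close>

text \<open>Normality is meant in the Riemann sphere: besides a holomorphic limit, locally uniform
  convergence to \<open>\<infinity>\<close> is allowed.\<close>

definition normal_on :: "complex set \<Rightarrow> (complex \<Rightarrow> complex) set \<Rightarrow> bool" where
  "normal_on U \<F> \<longleftrightarrow>
     (\<forall>g :: nat \<Rightarrow> complex \<Rightarrow> complex. range g \<subseteq> \<F> \<longrightarrow>
       (\<exists>r :: nat \<Rightarrow> nat. strict_mono r \<and>
         ((\<exists>h. h holomorphic_on U \<and>
            (\<forall>K. compact K \<and> K \<subseteq> U \<longrightarrow> uniform_limit K (\<lambda>n. g (r n)) h sequentially)) \<or>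
          (\<forall>K. compact K \<and> K \<subseteq> U \<longrightarrow>
            (\<forall>B::real. \<forall>\<^sub>F n in sequentially. \<forall>z\<in>K. B < cmod (g (r n) z))))))"

definition Julia_set :: "(complex \<Rightarrow> complex) \<Rightarrow> complex set" where
  "Julia_set f = - {z. \<exists>U. open U \<and> z \<in> U \<and> normal_on U (range (\<lambda>n. f ^^ n))}"

definition Julia_F :: "nat \<Rightarrow> complex \<Rightarrow> cyl set" where
  "Julia_F l c = cyl_proj ` Julia_set (fmap_lc l c)"

section \<open>Pressure, conformal measures, ergodicity\<close>

text \<open>Since \<open>infsum\<close> is \<open>0\<close> for divergent series, the summability clause is what makes
  this the (finite) limit of the extended-real-valued sequence.\<close>

definition is_pressure :: "nat \<Rightarrow> complex \<Rightarrow> real \<Rightarrow> real \<Rightarrow> bool" where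
  "is_pressure l c t P \<longleftrightarrow>
     (\<forall>z\<in>Julia_F l c.
        (\<forall>\<^sub>F n in sequentially.
           (\<lambda>x. F_abs_deriv l c n x powr (- t)) summable_on ((F_lc l c ^^ n) -` {z})) \<and>
        (\<lambda>n. 1 / real n *
           ln (\<Sum>\<^sub>\<infinity>x\<in>(F_lc l c ^^ n) -` {z}. F_abs_deriv l c n x powr (- t)))
          \<longlonglongrightarrow> P)"

definition pressure :: "nat \<Rightarrow> complex \<Rightarrow> real \<Rightarrow> real" where
  "pressure l c t = (THE P. is_pressure l c t P)"

definition conformal :: "nat \<Rightarrow> complex \<Rightarrow> real \<Rightarrow> real \<Rightarrow> cyl measure \<Rightarrow> bool" where
  "conformal l c t \<alpha> \<nu> \<longleftrightarrow>
     space \<nu> = Julia_F l c \<and> sets \<nu> = sets (restrict_space borel (Julia_F l c)) \<and>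
     (\<forall>A\<in>sets \<nu>. inj_on (F_lc l c) A \<longrightarrow>
        emeasure \<nu> (F_lc l c ` A) = (\<integral>\<^sup>+x\<in>A. ennreal (\<alpha> * F_abs_deriv l c 1 x powr t) \<partial>\<nu>))"

definition ergodic_wrt :: "cyl measure \<Rightarrow> (cyl \<Rightarrow> cyl) \<Rightarrow> bool" where
  "ergodic_wrt \<nu> T \<longleftrightarrow> (\<forall>G\<in>sets \<nu>. T -` G = G \<longrightarrow> emeasure \<nu> G \<in> {0, 1})"

end

theory Submission
  imports Defs "HOL-Real_Asymp.Real_Asymp"
begin

text \<open>
  By Schottky's theorem the critical orbit of \<open>F\<close> is attracted by the fixed point \<open>\<Pi>(log c)\<close>, so there
  is a periodic set \<open>P\<close> that contains the critical values and whose \<open>d\<close>-neighbourhood is mapped into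
  \<open>P\<close>. Let \<open>X\<close> be the set of points whose orbits avoid \<open>P\<close>. Off its critical values \<open>f\<close> is a covering, so
  discs lift; a lifted disc avoiding \<open>P\<close> can be enlarged by \<open>d\<close>, while its derivative is bounded by
  Schottky's theorem. Hence \<open>\<Sum>n. 1 / |(f\<^sup>n)'|\<close> converges on \<open>X\<close>, which yields expansion, inverse
  branches of uniform size, the blow-up property and \<open>J(f) = X\<close>.

  In the coordinate \<open>w = exp z\<close> the number of preimages of modulus at most \<open>R\<close> grows linearly in
  \<open>R\<close>, and \<open>|F'| = |l - w|\<close>; since \<open>t > 1\<close>, almost no orbit escapes, for any conformal measure.
  Pulling back small discs along recurrent orbits, with bounded distortion, and a Vitali covering
  show that any two conformal measures \<open>\<mu>, \<nu>\<close> satisfy \<open>\<mu> \<le> L \<nu>\<close>. Uniqueness follows by applying this to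
  \<open>L \<nu> - \<mu>\<close> with the least \<open>L\<close>, ergodicity by applying it to the restriction of a conformal
  measure to an invariant set.
\<close>


section \<open>Consequences of Schottky's theorem\<close>

text \<open>The Julia set of \<open>F\<close> is not compact and \<open>F\<close> has infinite
  degree, so orbits can drift to infinity, where discs of a fixed size have no positive lower bound
  on their measure. Recurrence supplies times at which the image point lies in a bounded region;
  there compactness gives the disc around it a definite mass. One inverse branch then serves both
  measures, so \<open>\<alpha> ^ n\<close> and the derivatives cancel up to a factor
  \<open>4 powr t\<close>. Dynamics takes place in the plane, where discs lift through a covering;
  measure theory takes place in the punctured plane, where Vitali's covering lemma and outer
  regularity apply. The link is \<open>exp\<close>, which is injective on discs of radius at most 1;
  hence the bound \<open>d \<le> 1\<close>. The distortion estimates are weak substitutes for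
  Koebe's theorems, drawn from Schottky's theorem as well: existence of the constants matters, their
  size does not. An invariant set \<open>G\<close> is carried through the whole comparison because
  ergodicity needs a bound of a measure by its own restriction to \<open>G\<close>.\<close>

definition schottky_const :: "real \<Rightarrow> real" where
  "schottky_const R = exp (pi * exp (pi * (14 + 2 * R)))"

lemma schottky_const_pos: "schottky_const R > 0"
  by (simp add: schottky_const_def)

text \<open>The version on the unit disc asks for holomorphy on the closed disc, so it is applied on
  radius \<open>r/2\<close>; half of that radius gives \<open>r/4\<close>.\<close>

lemma Schottky_ball:
  assumes hol: "q holomorphic_on ball z r" and r: "r > 0"
    and omit: "\<And>u. u \<in> ball z r \<Longrightarrow> q u \<noteq> 0 \<and> q u \<noteq> 1"
    and R: "norm (q z) \<le> R" and u: "u \<in> cball z (r/4)"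
  shows "norm (q u) \<le> schottky_const R"
proof -
  define h where "h = (\<lambda>\<zeta>. q (z + of_real (r/2) * \<zeta>))"
  have sub: "z + of_real (r/2) * \<zeta> \<in> ball z r" if "\<zeta> \<in> cball 0 1" for \<zeta> :: complex
  proof -
    have "norm \<zeta> \<le> 1" using that by simp
    then have "r/2 * norm \<zeta> \<le> r/2 * 1" using r by (intro mult_left_mono) auto
    then show ?thesis using r by (simp add: dist_norm norm_mult)
  qed
  have hh: "h holomorphic_on cball 0 1"
    unfolding h_def
    by (rule holomorphic_on_compose_gen[OF _ hol, unfolded o_def]) (use sub in \<open>auto intro!: holomorphic_intros\<close>)
  define \<zeta> where "\<zeta> = (u - z) / of_real (r/2)"
  have "norm \<zeta> = norm (u - z) / (r/2)"
    using r unfolding \<zeta>_def norm_divide norm_of_real by simp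
  moreover have "norm (u - z) \<le> 1/2 * (r/2)"
    using u by (simp add: dist_norm norm_minus_commute)
  ultimately have "norm \<zeta> \<le> 1/2"
    using r by (simp only: pos_divide_le_eq half_gt_zero)
  \<comment> \<open>At radius 1/2 the term \<open>12 * t / (1 - t)\<close> of Schottky's bound is
    12, whence the \<open>14 + 2 * R\<close> in \<open>schottky_const\<close>.\<close>
  with hh have "norm (h \<zeta>) \<le> exp(pi * exp(pi * (2 + 2 * R + 12 * (1/2) / (1 - 1/2))))"
    by (intro Schottky) (use omit sub R in \<open>auto simp: h_def\<close>)
  moreover have "of_real (r/2) * \<zeta> = u - z"
  proof -
    have "(of_real (r/2) :: complex) \<noteq> 0" using r by simp
    then show ?thesis
      unfolding \<zeta>_def by (simp only: times_divide_eq_right nonzero_mult_div_cancel_left not_False_eq_True)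
  qed
  then have "h \<zeta> = q u" unfolding h_def by (metis add_diff_cancel_left' add.commute diff_add_cancel)
  ultimately show ?thesis
    by (simp add: schottky_const_def algebra_simps)
qed

text \<open>A form of Landau's theorem: Cauchy's inequality on the disc of radius
  \<open>r/4\<close>, where \<open>Schottky_ball\<close> bounds \<open>q\<close>.\<close>

lemma deriv_bound_omit_01:
  assumes hol: "q holomorphic_on ball z r" and r: "r > 0"
    and omit: "\<And>u. u \<in> ball z r \<Longrightarrow> q u \<noteq> 0 \<and> q u \<noteq> 1"
    and R: "norm (q z) \<le> R"
  shows "norm (deriv q z) \<le> 4 * schottky_const R / r"
proof -
  have "norm ((deriv ^^ 1) q z) \<le> fact 1 * schottky_const R / (r/4) ^ 1"
  proof (rule Cauchy_inequality)
    show "q holomorphic_on ball z (r/4)" "continuous_on (cball z (r/4)) q"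
      using r by (auto intro!: holomorphic_on_imp_continuous_on holomorphic_on_subset[OF hol])
    show "norm (q x) \<le> schottky_const R" if "norm (z - x) = r/4" for x
      using that by (intro Schottky_ball[OF hol r omit R]) (auto simp: dist_norm)
  qed (use r in auto)
  then show ?thesis by (simp add: field_simps)
qed

lemma deriv_bound_omit_two:
  assumes hol: "q holomorphic_on ball z r" and r: "r > 0" and ab: "a \<noteq> b"
    and omit: "\<And>u. u \<in> ball z r \<Longrightarrow> q u \<noteq> a \<and> q u \<noteq> b"
    and R: "norm (q z - a) \<le> R * norm (b - a)"
  shows "norm (deriv q z) \<le> 4 * schottky_const R * norm (b - a) / r"
proof -
  define p where "p = (\<lambda>u. (q u - a) / (b - a))"
  have "norm (deriv p z) \<le> 4 * schottky_const R / r"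
  proof (rule deriv_bound_omit_01[OF _ r])
    show "p holomorphic_on ball z r"
      unfolding p_def by (intro holomorphic_intros hol) (use ab in auto)
    show "p u \<noteq> 0 \<and> p u \<noteq> 1" if "u \<in> ball z r" for u
      using omit[OF that] ab by (auto simp: p_def)
    show "norm (p z) \<le> R"
      using R ab by (simp add: p_def norm_divide field_simps)
  qed
  moreover have "(q has_field_derivative deriv q z) (at z)"
    using hol r by (intro holomorphic_derivI) auto
  then have "deriv p z = deriv q z / (b - a)"
    unfolding p_def using ab by (intro DERIV_imp_deriv) (auto intro!: derivative_eq_intros)
  ultimately show ?thesis
    using ab r by (simp add: norm_divide field_simps)
qed

text \<open>The factor 16 pi collects 4 from Cauchy's inequality on a quarter disc, 2 pi from the
  spacing of the omitted points and 2 from rounding their distance up to an integer number of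
  periods. The argument 2 bounds the normalised value at the centre.\<close>

definition landau_const :: real where "landau_const = 16 * pi * schottky_const 2"

lemma landau_const_pos: "landau_const > 0"
  by (simp add: landau_const_def schottky_const_pos)

text \<open>Only two of the omitted points are used, at a distance proportional to the right-hand side:
  this is what turns Schottky's doubly exponential bound into a linear one.\<close>

lemma deriv_bound_omit_periodic:
  assumes hol: "q holomorphic_on ball z r" and r: "r > 0"
    and omit: "\<And>u k. u \<in> ball z r \<Longrightarrow> q u \<noteq> a + 2 * of_real pi * \<i> * of_int k"
  shows "norm (deriv q z) \<le> landau_const * (1 + \<bar>Re (q z) - Re a\<bar>) / r"
proof -
  define N where "N = \<lceil>1 + \<bar>Re (q z) - Re a\<bar>\<rceil>"
  define k where "k = \<lfloor>(Im (q z) - Im a) / (2 * pi)\<rfloor>"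
  define a' where "a' = a + 2 * of_real pi * \<i> * of_int k"
  define b' where "b' = a + 2 * of_real pi * \<i> * of_int (k + N)"
  have N: "real_of_int N \<ge> 1 + \<bar>Re (q z) - Re a\<bar>" "real_of_int N \<le> 2 + \<bar>Re (q z) - Re a\<bar>"
    unfolding N_def by linarith+
    then have N': "real_of_int N \<le> 2 * (1 + \<bar>Re (q z) - Re a\<bar>)" using abs_ge_zero[of "Re (q z) - Re a"] by argo
  have ba: "b' - a' = 2 * of_real pi * \<i> * of_int N"
    by (simp add: a'_def b'_def algebra_simps)
  have nba: "norm (b' - a') = 2 * pi * N"
    unfolding ba using N by (simp add: norm_mult)
  have "norm (q z - a') \<le> \<bar>Re (q z - a')\<bar> + \<bar>Im (q z - a')\<bar>"
    by (rule cmod_le)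
  also have "\<bar>Re (q z - a')\<bar> = \<bar>Re (q z) - Re a\<bar>" by (simp add: a'_def)
  also have "\<bar>Im (q z - a')\<bar> \<le> 2 * pi"
  proof -
    have "k \<le> (Im (q z) - Im a) / (2 * pi)" "(Im (q z) - Im a) / (2 * pi) \<le> k + 1"
      unfolding k_def by linarith+
    then have "2 * pi * k \<le> Im (q z) - Im a" "Im (q z) - Im a \<le> 2 * pi * k + 2 * pi"
      by (simp_all add: field_simps)
    then show ?thesis by (simp add: a'_def)
  qed
  also have "\<bar>Re (q z) - Re a\<bar> + 2 * pi \<le> 2 * norm (b' - a')"
  proof -
    have "1 * real_of_int N \<le> 2 * pi * real_of_int N" using N pi_ge_two by (intro mult_right_mono) auto
    moreover have "2 * pi * 1 \<le> 2 * pi * real_of_int N" using N by (intro mult_left_mono) auto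
    ultimately show ?thesis unfolding nba using N by linarith
  qed
  finally have "norm (q z - a') \<le> 2 * norm (b' - a')" by simp
  then have "norm (deriv q z) \<le> 4 * schottky_const 2 * norm (b' - a') / r"
    using N nba omit by (intro deriv_bound_omit_two[OF hol r]) (auto simp only: a'_def b'_def, auto)
  also have "\<dots> \<le> 4 * schottky_const 2 * (2 * pi * (2 * (1 + \<bar>Re (q z) - Re a\<bar>))) / r"
    unfolding nba using N r schottky_const_pos[of 2]
    by (intro divide_right_mono mult_left_mono N') auto
  finally show ?thesis by (simp add: landau_const_def algebra_simps)
qed

text \<open>Since \<open>\<phi>\<close> omits \<open>a\<close>, the function \<open>h\<close> has no
  zero and hence a square root \<open>p\<close>. Normalised by \<open>p y = -1\<close>, this root
  omits 0, and by injectivity of \<open>\<phi>\<close> it omits 1 too, so Schottky's theorem applies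
  to it.\<close>

lemma univalent_omitted_value:
  assumes hol: "\<phi> holomorphic_on ball y \<rho>" and \<rho>: "\<rho> > 0" and inj: "inj_on \<phi> (ball y \<rho>)"
    and a: "a \<notin> \<phi> ` ball y \<rho>"
  shows "norm (deriv \<phi> y) * \<rho> \<le> 8 * schottky_const 1 * norm (a - \<phi> y)"
    and "u \<in> cball y (\<rho>/4) \<Longrightarrow> norm (\<phi> u - \<phi> y) \<le> norm (a - \<phi> y) * (1 + schottky_const 1 ^ 2)"
proof -
  have yb: "y \<in> ball y \<rho>" using \<rho> by simp
  have ne: "a - \<phi> y \<noteq> 0" using a yb by auto
  define h where "h = (\<lambda>u. (a - \<phi> u) / (a - \<phi> y))"
  have hh: "h holomorphic_on ball y \<rho>"
    unfolding h_def by (intro holomorphic_intros hol) (use ne in auto)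
  have hne: "h u \<noteq> 0" if "u \<in> ball y \<rho>" for u
    using a that ne by (auto simp: h_def)
  obtain q where q: "q holomorphic_on ball y \<rho>" "\<And>u. u \<in> ball y \<rho> \<Longrightarrow> h u = q u ^ 2"
    using contractible_imp_holomorphic_sqrt[OF hh _ hne] convex_imp_contractible[OF convex_ball] by blast
  \<comment> \<open>The sign matters: \<open>p u = 1\<close> forces \<open>h u = 1\<close> and
    therefore \<open>u = y\<close>, but at \<open>y\<close> the chosen root is -1.\<close>
  define p where "p = (\<lambda>u. - (q u / q y))"
  have qy: "q y ^ 2 = 1" "q y \<noteq> 0" using q(2)[OF yb] ne by (auto simp: h_def)
  have hp: "p holomorphic_on ball y \<rho>"
    unfolding p_def by (intro holomorphic_intros q) (use qy in auto)
  have p2: "p u ^ 2 = h u" if "u \<in> ball y \<rho>" for u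
    using q(2)[OF that] qy by (simp add: p_def power_divide)
  have py: "p y = -1" using qy by (simp add: p_def)
  have omit: "p u \<noteq> 0 \<and> p u \<noteq> 1" if u: "u \<in> ball y \<rho>" for u
  proof
    show "p u \<noteq> 0" using p2[OF u] hne[OF u] by auto
    show "p u \<noteq> 1"
    proof
      assume 1: "p u = 1"
      then have "h u = 1" using p2[OF u] by simp
      then have "\<phi> u = \<phi> y" using ne by (simp add: h_def)
      then have "u = y" using inj u yb by (auto dest: inj_onD)
      then show False using py 1 by simp
    qed
  qed
  have d: "norm (deriv p y) \<le> 4 * schottky_const 1 / \<rho>"
    by (rule deriv_bound_omit_01[OF hp \<rho> omit]) (auto simp: py)
  have dp: "(p has_field_derivative deriv p y) (at y)"
    using hp \<rho> by (intro holomorphic_derivI) auto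
  have d\<phi>: "(\<phi> has_field_derivative deriv \<phi> y) (at y)"
    using hol \<rho> by (intro holomorphic_derivI) auto
  have "((\<lambda>u. p u ^ 2) has_field_derivative 2 * p y * deriv p y) (at y)"
    by (rule derivative_eq_intros dp refl | simp)+
  moreover have "(h has_field_derivative - deriv \<phi> y / (a - \<phi> y)) (at y)"
    unfolding h_def using ne by (auto intro!: derivative_eq_intros d\<phi>)
  then have "((\<lambda>u. p u ^ 2) has_field_derivative - deriv \<phi> y / (a - \<phi> y)) (at y)"
    by (rule has_field_derivative_transform_within_open[where S = "ball y \<rho>"]) (use p2 \<rho> in auto)
  ultimately have "2 * p y * deriv p y = - deriv \<phi> y / (a - \<phi> y)"
    by (rule DERIV_unique)
  then have eq: "deriv \<phi> y = 2 * deriv p y * (a - \<phi> y)" using ne py by (simp add: field_simps)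
  have "norm (deriv \<phi> y) * \<rho> = 2 * norm (deriv p y) * norm (a - \<phi> y) * \<rho>"
    unfolding eq by (simp add: norm_mult)
  also have "\<dots> \<le> 2 * (4 * schottky_const 1 / \<rho>) * norm (a - \<phi> y) * \<rho>"
    using d \<rho> by (intro mult_right_mono mult_left_mono) auto
  finally show "norm (deriv \<phi> y) * \<rho> \<le> 8 * schottky_const 1 * norm (a - \<phi> y)" using \<rho> by simp
  assume u: "u \<in> cball y (\<rho>/4)"
  then have ub: "u \<in> ball y \<rho>" using \<rho> by auto
  have "norm (p u) \<le> schottky_const 1"
    by (rule Schottky_ball[OF hp \<rho> omit _ u]) (auto simp: py)
  then have "norm (h u) \<le> schottky_const 1 ^ 2"
    unfolding p2[OF ub, symmetric] by (simp add: norm_power power_mono)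
  moreover have "\<phi> u - \<phi> y = (a - \<phi> y) * (1 - h u)"
    using ne by (simp add: h_def field_simps)
  ultimately show "norm (\<phi> u - \<phi> y) \<le> norm (a - \<phi> y) * (1 + schottky_const 1 ^ 2)"
    using norm_triangle_ineq4[of 1 "h u"] by (simp add: norm_mult mult_left_mono)
qed

text \<open>One constant below three thresholds: \<open>1 / (8 * K)\<close> for the covered disc,
  1/8 to stay where the second derivative is bounded, and \<open>1 / (512 * (1 + K ^ 2))\<close> to
  let the derivative vary by at most one half, where \<open>K\<close> is
  \<open>schottky_const 1\<close>.\<close>

definition koebe_const :: real where "koebe_const = 1 / (512 * schottky_const 1 * (1 + schottky_const 1 ^ 2))"

lemma schottky_const_ge_1: "R \<ge> 0 \<Longrightarrow> schottky_const R \<ge> 1"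
  unfolding schottky_const_def by simp

lemma koebe_const: "0 < koebe_const" "koebe_const \<le> 1 / (8 * schottky_const 1)"
  "koebe_const \<le> 1/8" "koebe_const \<le> 1 / (512 * (1 + schottky_const 1 ^ 2))"
proof -
  let ?K = "schottky_const 1"
  have K: "?K \<ge> 1" "?K\<^sup>2 \<ge> 0" by (auto intro: schottky_const_ge_1)
  have D: "512 * ?K * (1 + ?K ^ 2) \<ge> 8 * ?K" "512 * ?K * (1 + ?K\<^sup>2) \<ge> 512 * (1 + ?K\<^sup>2)" 
    using K mult_right_mono[of 1 ?K "512 * (1+?K^2)"] by (simp_all add: algebra_simps)
  show "0 < koebe_const" unfolding koebe_const_def using K by (simp add: add_pos_nonneg)
  show "koebe_const \<le> 1 / (8 * ?K)" unfolding koebe_const_def using D K by (intro divide_left_mono) (auto simp: add_pos_nonneg)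
  also have "\<dots> \<le> 1 / 8" using K by simp
  finally show "koebe_const \<le> 1/8" .
  show "koebe_const \<le> 1 / (512 * (1 + ?K ^ 2))" unfolding koebe_const_def using D K by (intro divide_left_mono) (auto simp: add_pos_nonneg)
qed

lemma weak_koebe_quarter:
  assumes hol: "\<phi> holomorphic_on ball y \<rho>" and \<rho>: "\<rho> > 0" and inj: "inj_on \<phi> (ball y \<rho>)"
  shows "ball (\<phi> y) (koebe_const * \<rho> * norm (deriv \<phi> y)) \<subseteq> \<phi> ` ball y \<rho>"
proof (rule ccontr)
  assume "\<not> ?thesis"
  then obtain a where a: "norm (a - \<phi> y) < koebe_const * \<rho> * norm (deriv \<phi> y)" "a \<notin> \<phi> ` ball y \<rho>"
    unfolding subset_iff by (auto simp only: mem_ball dist_norm norm_minus_commute)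
  have K: "schottky_const 1 > 0" by (rule schottky_const_pos)
  have "norm (deriv \<phi> y) * \<rho> \<le> 8 * schottky_const 1 * norm (a - \<phi> y)"
    by (rule univalent_omitted_value[OF hol \<rho> inj a(2)])
  also have "\<dots> < 8 * schottky_const 1 * (koebe_const * \<rho> * norm (deriv \<phi> y))"
    using a(1) K by simp
  also have "\<dots> \<le> 8 * schottky_const 1 * (1 / (8 * schottky_const 1) * (\<rho> * norm (deriv \<phi> y)))"
    using koebe_const K \<rho> by (simp only: mult.assoc) (intro mult_left_mono mult_right_mono, auto)
  finally show False using K by (simp add: mult.commute)
qed

text \<open>Some value at distance at most \<open>2 * \<rho> * D\<close> from
  \<open>\<phi> y\<close> is omitted, so \<open>univalent_omitted_value\<close> bounds
  \<open>\<phi>\<close> on a quarter disc. Cauchy's inequality bounds the second derivative, and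
  \<open>koebe_const\<close> is small enough for the first derivative to move by at most
  \<open>D / 2\<close>.\<close>

lemma weak_koebe_distortion:
  assumes hol: "\<phi> holomorphic_on ball y \<rho>" and \<rho>: "\<rho> > 0" and inj: "inj_on \<phi> (ball y \<rho>)"
    and b: "b \<in> ball y (koebe_const * \<rho>)"
  shows "norm (deriv \<phi> b) \<le> 2 * norm (deriv \<phi> y)" "norm (deriv \<phi> y) \<le> 2 * norm (deriv \<phi> b)"
proof -
  let ?K = "schottky_const 1"
  define D where "D = norm (deriv \<phi> y)"
  have yb: "y \<in> ball y \<rho>" using \<rho> by simp
  have D0: "D > 0" unfolding D_def using holomorphic_injective_imp_regular[OF hol _ inj yb] by simp
  \<comment> \<open>Otherwise the inverse maps a disc of radius \<open>2 * \<rho> * D\<close> into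
    one of radius \<open>\<rho>\<close>, and Cauchy's inequality bounds its derivative by
    \<open>1 / (2 * D)\<close>, whereas it equals \<open>1 / D\<close> in modulus.\<close>
  have "\<exists>a. a \<notin> \<phi> ` ball y \<rho> \<and> norm (a - \<phi> y) \<le> 2 * \<rho> * D"
  proof (rule ccontr)
    assume "\<not> ?thesis"
    then have sub: "cball (\<phi> y) (2 * \<rho> * D) \<subseteq> \<phi> ` ball y \<rho>" by (auto simp: dist_norm norm_minus_commute)
    obtain \<xi> where \<xi>: "\<xi> holomorphic_on (\<phi> ` ball y \<rho>)"
       "\<And>z. z \<in> ball y \<rho> \<Longrightarrow> deriv \<phi> z * deriv \<xi> (\<phi> z) = 1" "\<And>z. z \<in> ball y \<rho> \<Longrightarrow> \<xi> (\<phi> z) = z"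
      using holomorphic_has_inverse[OF hol _ inj] by auto
    have "norm ((deriv ^^ 1) (\<lambda>u. \<xi> u - y) (\<phi> y)) \<le> fact 1 * \<rho> / (2 * \<rho> * D) ^ 1"
    proof (rule Cauchy_inequality)
      show "(\<lambda>u. \<xi> u - y) holomorphic_on ball (\<phi> y) (2 * \<rho> * D)"
        "continuous_on (cball (\<phi> y) (2 * \<rho> * D)) (\<lambda>u. \<xi> u - y)"
        using sub by (auto intro!: holomorphic_intros holomorphic_on_imp_continuous_on holomorphic_on_subset[OF \<xi>(1)])
      show "norm (\<xi> x - y) \<le> \<rho>" if "norm (\<phi> y - x) = 2 * \<rho> * D" for x
      proof -
        have "x \<in> \<phi> ` ball y \<rho>" using sub that by (auto simp: dist_norm)
        then show ?thesis using \<xi>(3) by (auto simp: dist_norm norm_minus_commute)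
      qed
    qed (use \<rho> D0 in auto)
    moreover have "deriv (\<lambda>u. \<xi> u - y) (\<phi> y) = deriv \<xi> (\<phi> y)"
    proof (rule DERIV_imp_deriv)
      have "open (\<phi> ` ball y \<rho>)" by (rule open_mapping_thm3[OF hol _ inj]) auto
      then have "(\<xi> has_field_derivative deriv \<xi> (\<phi> y)) (at (\<phi> y))"
        using yb by (intro holomorphic_derivI[OF \<xi>(1)]) auto
      then show "((\<lambda>u. \<xi> u - y) has_field_derivative deriv \<xi> (\<phi> y)) (at (\<phi> y))"
        by (auto intro!: derivative_eq_intros)
    qed
    ultimately have "norm (deriv \<xi> (\<phi> y)) \<le> 1 / (2 * D)" using \<rho> by (simp add: field_simps)
    then have "norm (deriv \<xi> (\<phi> y)) * D \<le> 1/2" using D0 by (simp add: field_simps)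
    moreover have "D * norm (deriv \<xi> (\<phi> y)) = 1"
      using arg_cong[OF \<xi>(2)[OF yb], of norm] by (simp add: D_def norm_mult)
    ultimately show False by (simp add: mult.commute)
  qed
  then obtain a where a: "a \<notin> \<phi> ` ball y \<rho>" "norm (a - \<phi> y) \<le> 2 * \<rho> * D" by blast
  define M where "M = 2 * \<rho> * D * (1 + ?K ^ 2)"
  have bnd: "norm (\<phi> u - \<phi> y) \<le> M" if "u \<in> cball y (\<rho>/4)" for u
    unfolding M_def
    by (rule order.trans[OF univalent_omitted_value(2)[OF hol \<rho> inj a(1) that]])
       (use a in \<open>auto intro!: mult_right_mono\<close>)
  have hol': "deriv \<phi> holomorphic_on ball y \<rho>" by (intro holomorphic_deriv hol) auto
  have d2: "norm (deriv (deriv \<phi>) u) \<le> 128 * M / \<rho> ^ 2" if u: "u \<in> ball y (\<rho>/8)" for u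
  proof -
    have sub: "cball u (\<rho>/8) \<subseteq> cball y (\<rho>/4)"
    proof
      fix x assume "x \<in> cball u (\<rho>/8)"
      then show "x \<in> cball y (\<rho>/4)" using u dist_triangle[of y x u] by auto
    qed
    have "cball y (\<rho>/4) \<subseteq> ball y \<rho>" using \<rho> by auto
    then have sub': "cball u (\<rho>/8) \<subseteq> ball y \<rho>" using sub by blast
    have ub: "u \<in> ball y \<rho>" using u \<rho> by auto
    have "norm ((deriv ^^ 2) (\<lambda>u. \<phi> u - \<phi> y) u) \<le> fact 2 * M / (\<rho>/8) ^ 2"
    proof (rule Cauchy_inequality)
      have "ball u (\<rho>/8) \<subseteq> ball y \<rho>" using sub' by (meson ball_subset_cball order.trans)
      then show "(\<lambda>u. \<phi> u - \<phi> y) holomorphic_on ball u (\<rho>/8)"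
        by (auto intro!: holomorphic_intros intro: holomorphic_on_subset[OF hol])
      show "continuous_on (cball u (\<rho>/8)) (\<lambda>u. \<phi> u - \<phi> y)"
        using sub' by (intro continuous_intros holomorphic_on_imp_continuous_on holomorphic_on_subset[OF hol])
      show "norm (\<phi> x - \<phi> y) \<le> M" if "norm (u - x) = \<rho>/8" for x
        using that sub by (intro bnd) (auto simp: dist_norm)
    qed (use \<rho> in auto)
    also have "(deriv ^^ 2) (\<lambda>u. \<phi> u - \<phi> y) u = deriv (deriv \<phi>) u"
    proof -
      have eq: "deriv (\<lambda>u. \<phi> u - \<phi> y) x = deriv \<phi> x" if "x \<in> ball y \<rho>" for x
        by (rule DERIV_imp_deriv) (use holomorphic_derivI[OF hol open_ball that] in \<open>auto intro!: derivative_eq_intros\<close>)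
      have "(deriv \<phi> has_field_derivative deriv (deriv \<phi>) u) (at u)"
        by (rule holomorphic_derivI[OF hol' open_ball ub])
      then have "(deriv (\<lambda>u. \<phi> u - \<phi> y) has_field_derivative deriv (deriv \<phi>) u) (at u)"
        by (rule has_field_derivative_transform_within_open[OF _ open_ball ub]) (use eq in auto)
      then show ?thesis by (simp add: numeral_2_eq_2 DERIV_imp_deriv)
    qed
    finally show ?thesis by (simp add: power_divide)
  qed
  have "norm (deriv \<phi> b - deriv \<phi> y) \<le> 128 * M / \<rho> ^ 2 * norm (b - y)"
  proof (rule field_differentiable_bound[where S = "ball y (\<rho>/8)"])
    show "(deriv \<phi> has_field_derivative deriv (deriv \<phi>) z) (at z within ball y (\<rho>/8))" if "z \<in> ball y (\<rho>/8)" for z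
      using that \<rho> by (intro DERIV_subset[OF holomorphic_derivI[OF hol' open_ball]]) auto
    have "koebe_const * \<rho> \<le> 1/8 * \<rho>" using koebe_const \<rho> by (intro mult_right_mono) auto
    then show "b \<in> ball y (\<rho>/8)" using b by auto
  qed (use d2 \<rho> in auto)
  also have "\<dots> \<le> 128 * M / \<rho> ^ 2 * (koebe_const * \<rho>)"
    using b \<rho> D0 by (intro mult_left_mono) (auto simp: dist_norm norm_minus_commute M_def)
  also have "\<dots> = 256 * (1 + ?K ^ 2) * koebe_const * D"
    using \<rho> by (simp add: M_def power2_eq_square field_simps)
  also have "\<dots> \<le> 256 * (1 + ?K ^ 2) * (1 / (512 * (1 + ?K ^ 2))) * D"
    using koebe_const D0 by (intro mult_right_mono mult_left_mono) auto
  also have "\<dots> = D / 2"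
  proof -
    have "1 + ?K ^ 2 \<noteq> 0" by (smt (verit) zero_le_power2)
    then show ?thesis by (simp add: field_simps)
  qed
  finally have *: "norm (deriv \<phi> b - deriv \<phi> y) \<le> D / 2" .
  then show "norm (deriv \<phi> b) \<le> 2 * norm (deriv \<phi> y)"
    using norm_triangle_sub[of "deriv \<phi> b" "deriv \<phi> y"] D0 unfolding D_def by linarith
  show "norm (deriv \<phi> y) \<le> 2 * norm (deriv \<phi> b)"
    using norm_triangle_sub[of "deriv \<phi> y" "deriv \<phi> b"] * by (simp add: D_def norm_minus_commute)
qed


section \<open>The map in the plane is a covering off its critical values\<close>

definition per :: "int \<Rightarrow> complex" where "per k = 2 * of_real pi * \<i> * of_int k"

lemma per_add: "per (j + k) = per j + per k"
  by (simp add: per_def algebra_simps)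

lemma per_minus: "per (- k) = - per k"
  by (simp add: per_def)

lemma per_0 [simp]: "per 0 = 0"
  by (simp add: per_def)

lemma Re_per [simp]: "Re (per k) = 0" and Im_per [simp]: "Im (per k) = 2 * pi * k"
  by (simp_all add: per_def)

lemma norm_per: "norm (per k) = 2 * pi * \<bar>real_of_int k\<bar>"
  by (simp add: per_def norm_mult)

lemma exp_eq_per: "exp z = exp w \<longleftrightarrow> (\<exists>k. z = w + per k)"
  unfolding exp_eq per_def by (auto simp: algebra_simps)

lemma exp_per [simp]: "exp (z + per k) = exp z"
  using exp_eq_per by blast

locale lc_map =
  fixes l :: nat and c :: complex
  assumes l2: "l \<ge> 2" and c_ball: "c \<in> ball (of_nat l) 1"
begin

definition a0 :: complex where "a0 = c - (of_nat l - 1) * Ln c"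

abbreviation f :: "complex \<Rightarrow> complex" where "f \<equiv> fmap_lc l c"

lemma f_eq: "f z = a0 + of_nat l * z - exp z"
  by (simp add: fmap_lc_def a0_def)

lemma f_per: "f (z + per k) = f z + per (int l * k)"
  unfolding per_def by (rule fmap_lc_add_period)

lemma fn_per: "(f ^^ n) (z + per k) = (f ^^ n) z + per (int l ^ n * k)"
  unfolding per_def by (rule fmap_lc_funpow_add_period)

lemma DERIV_f: "(f has_field_derivative (of_nat l - exp z)) (at z within A)"
  unfolding fmap_lc_def by (auto intro!: derivative_eq_intros)

lemma hol_f: "f holomorphic_on A"
  unfolding fmap_lc_def by (intro holomorphic_intros)

lemma hol_fn: "(f ^^ n) holomorphic_on A"
  using fmap_lc_funpow_holomorphic holomorphic_on_subset by blast

lemma DERIV_fn: "((f ^^ n) has_field_derivative deriv (f ^^ n) z) (at z within A)"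
  by (rule DERIV_subset[OF holomorphic_derivI[OF hol_fn open_UNIV]]) auto

lemma deriv_fn_Suc: "deriv (f ^^ Suc n) z = deriv (f ^^ n) (f z) * (of_nat l - exp z)"
proof -
  have "((\<lambda>z. (f ^^ n) (f z)) has_field_derivative deriv (f ^^ n) (f z) * (of_nat l - exp z)) (at z)"
    by (rule DERIV_chain2[OF DERIV_fn DERIV_f])
  then show ?thesis
    by (simp add: DERIV_imp_deriv funpow_Suc_right o_def del: funpow.simps)
qed

lemma deriv_fn_Suc': "deriv (f ^^ Suc n) z = (of_nat l - exp ((f ^^ n) z)) * deriv (f ^^ n) z"
proof -
  have "((\<lambda>z. f ((f ^^ n) z)) has_field_derivative (of_nat l - exp ((f ^^ n) z)) * deriv (f ^^ n) z) (at z)"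
    by (rule DERIV_chain2[OF DERIV_f DERIV_fn])
  then show ?thesis
    by (simp add: DERIV_imp_deriv o_def)
qed

definition v :: complex where "v = f (Ln (of_nat l))"

text \<open>The critical values of \<open>f\<close> are the points
  \<open>v + per (int l * k)\<close>. All translates of \<open>v\<close> are taken, so that the set
  is periodic: it is the preimage of one point of the cylinder.\<close>

definition CV :: "complex set" where "CV = {p. exp p = exp v}"

text \<open>In the coordinate \<open>exp z\<close> all critical points collapse to the single point
  \<open>l\<close>. Continuity of \<open>f \<circ> Ln\<close> there gives an \<open>\<eta>\<close>
  that is independent of \<open>z\<close>.\<close>

lemma deriv_f_lower:
  assumes d: "d > 0"
  obtains \<eta> where "\<eta> > 0" "\<And>z. (\<And>p. p \<in> CV \<Longrightarrow> d \<le> dist (f z) p) \<Longrightarrow> \<eta> \<le> norm (of_nat l - exp z)"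
proof -
  have "of_nat l \<notin> \<real>\<^sub>\<le>\<^sub>0"
    using l2 complex_nonpos_Reals_iff[of "of_nat l"] by auto
  then have "isCont (\<lambda>w. f (Ln w)) (of_nat l)"
    unfolding fmap_lc_def by (intro continuous_intros) auto
  then obtain \<eta> where \<eta>: "\<eta> > 0" "\<And>w. dist w (of_nat l) < \<eta> \<Longrightarrow> dist (f (Ln w)) v < d"
    using d unfolding continuous_at_eps_delta v_def by blast
  show ?thesis
  proof (rule that[OF \<eta>(1)])
    fix z assume z: "\<And>p. p \<in> CV \<Longrightarrow> d \<le> dist (f z) p"
    show "\<eta> \<le> norm (of_nat l - exp z)"
    proof (rule ccontr)
      assume "\<not> ?thesis"
      then have "dist (f (Ln (exp z))) v < d"
        by (intro \<eta>(2)) (simp add: dist_norm norm_minus_commute)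
      moreover obtain k where "Ln (exp z) = z + per k"
        using exp_eq_per[of "Ln (exp z)" z] by auto
      ultimately have "dist (f z) (v - per (int l * k)) < d"
        by (simp add: f_per dist_norm algebra_simps)
      moreover have "v - per (int l * k) \<in> CV"
        unfolding CV_def mem_Collect_eq by (metis diff_add_cancel exp_per)
      ultimately show False using z by fastforce
    qed
  qed
qed

text \<open>An inverse function theorem with a uniform radius. The relative change of the derivative
  on a ball depends only on the size of \<open>exp z\<close> compared with
  \<open>of_nat l - exp z\<close>, and this ratio is bounded once the derivative is at least
  \<open>\<eta>\<close>.\<close>

lemma f_local:
  assumes \<eta>: "\<eta> > 0"
  obtains r where "r > 0"
    "\<And>z. \<eta> \<le> norm (of_nat l - exp z) \<Longrightarrow> inj_on f (ball z (4 * r))"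
    "\<And>z. \<eta> \<le> norm (of_nat l - exp z) \<Longrightarrow> ball (f z) (r * norm (of_nat l - exp z) / 2) \<subseteq> f ` ball z r"
proof -
  \<comment> \<open>Bounds the ratio: \<open>norm (exp z)\<close> is at most the modulus of the
    derivative plus \<open>l\<close>, hence at most \<open>M\<close> times that modulus.\<close>
  define M where "M = 1 + l / \<eta>"
  have M: "M \<ge> 1" using \<eta> by (simp add: M_def)
  have "isCont (exp :: complex \<Rightarrow> complex) 0" by (intro continuous_intros)
  then obtain e where e: "e > 0" "\<And>u::complex. dist u 0 < e \<Longrightarrow> dist (exp u) (exp 0) < 1 / (2 * M)"
    using M unfolding continuous_at_eps_delta by (metis zero_less_divide_1_iff zero_less_mult_iff zero_less_numeral less_le_trans zero_less_one)
  define r where "r = e / 4"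
  have r: "r > 0" "4 * r = e" using e by (auto simp: r_def)
  have bil: "norm (f u - f u') \<ge> norm (of_nat l - exp z) / 2 * norm (u - u')"
    if z: "\<eta> \<le> norm (of_nat l - exp z)" and u: "u \<in> ball z (4*r)" "u' \<in> ball z (4*r)" for z u u'
  proof -
    let ?D = "of_nat l - exp z"
    have "norm ((f u - ?D * u) - (f u' - ?D * u')) \<le> norm ?D / 2 * norm (u - u')"
    proof (rule field_differentiable_bound[where S = "ball z (4*r)"])
      show "((\<lambda>u. f u - ?D * u) has_field_derivative (of_nat l - exp x) - ?D) (at x within ball z (4*r))" for x
        by (auto intro!: derivative_eq_intros DERIV_f)
      show "norm (of_nat l - exp x - ?D) \<le> norm ?D / 2" if "x \<in> ball z (4*r)" for x
      proof -
        have "of_nat l - exp x - ?D = - exp z * (exp (x - z) - 1)"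
          by (simp add: exp_diff field_simps)
        moreover have "norm (exp (x - z) - 1) \<le> 1 / (2 * M)"
          using e(2)[of "x - z"] that r by (simp add: dist_norm norm_minus_commute)
        moreover have "norm (exp z) \<le> norm ?D * M"
        proof -
          have "norm (exp z) \<le> norm ?D + l" using norm_triangle_sub[of "exp z" "of_nat l"] by (simp add: norm_minus_commute)
          also have "real l = l / \<eta> * \<eta>" using \<eta> by simp
          also have "\<dots> \<le> l / \<eta> * norm ?D" using z \<eta> by (intro mult_left_mono) auto
          finally show ?thesis by (simp add: M_def algebra_simps)
        qed
        ultimately have "norm (of_nat l - exp x - ?D) \<le> (norm ?D * M) * (1 / (2 * M))"
          using M by (simp only: norm_mult norm_minus_cancel) (intro mult_mono, auto)
        then show ?thesis using M by simp
      qed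
    qed (use u in auto)
    moreover have "norm (?D * (u - u')) \<le> norm (f u - f u') + norm ((f u - ?D * u) - (f u' - ?D * u'))"
      using norm_triangle_ineq4[of "f u - f u'" "(f u - ?D * u) - (f u' - ?D * u')"] by (simp add: algebra_simps)
    ultimately show ?thesis by (simp add: norm_mult)
  qed
  show ?thesis
  proof (rule that[OF r(1)])
    fix z :: complex assume z: "\<eta> \<le> norm (of_nat l - exp z)"
    let ?D = "of_nat l - exp z"
    show inj: "inj_on f (ball z (4 * r))"
    proof (rule inj_onI)
      fix u u' assume "u \<in> ball z (4*r)" "u' \<in> ball z (4*r)" "f u = f u'"
      then have "norm ?D / 2 * norm (u - u') \<le> 0" using bil[OF z, of u u'] by simp
      moreover have "norm ?D > 0" using z \<eta> by linarith
      ultimately show "u = u'" by (simp add: mult_le_0_iff)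
    qed
    have sub: "ball z r \<subseteq> ball z (4*r)" "cball z r \<subseteq> ball z (4*r)" using r(1) by auto
    show "ball (f z) (r * norm ?D / 2) \<subseteq> f ` ball z r"
    proof (rule ball_subset_open_map_image)
      show "continuous_on (closure (ball z r)) f" by (intro holomorphic_on_imp_continuous_on hol_f)
      show "open (f ` interior (ball z r))"
        using inj_on_subset[OF inj sub(1)] by (auto intro!: open_mapping_thm3 hol_f)
      show "r * norm ?D / 2 \<le> norm (f u - f z)" if "u \<in> frontier (ball z r)" for u
      proof -
        have "norm (u - z) = r" using that r by (auto simp: frontier_ball dist_norm norm_minus_commute)
        then show ?thesis using bil[OF z, of u z] r by (simp add: dist_norm norm_minus_commute mult.commute)
      qed
      have "0 < norm ?D" using z \<eta> by linarith
      then show "0 < r * norm ?D / 2" using r(1) by simp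
    qed (use r in auto)
  qed
qed

section \<open>Even covering off the critical values, and lifting of discs\<close>

lemma closed_CV: "closed CV"
  unfolding CV_def by (intro closed_Collect_eq continuous_intros)

lemma countable_CV: "countable CV"
proof -
  have "CV \<subseteq> range (\<lambda>k. v + per k)" by (auto simp: CV_def exp_eq_per)
  then show ?thesis by (rule countable_subset) auto
qed

text \<open>The radii \<open>r\<close> and \<open>s\<close> serve all of the infinitely many
  preimages at once; this uniformity gives both surjectivity and even covering.\<close>

lemma f_uniform_local:
  assumes y: "y \<notin> CV"
  obtains r s where "r > 0" "s > 0" "ball y s \<subseteq> - CV"
    "\<And>x. f x \<in> ball y s \<Longrightarrow> inj_on f (ball x (4 * r))"
    "\<And>x. f x \<in> ball y s \<Longrightarrow> ball (f x) s \<subseteq> f ` ball x r"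
proof -
  obtain d where d: "d > 0" "ball y (2 * d) \<subseteq> - CV"
  proof -
    have "open (- CV)" using closed_CV by auto
    then obtain e where "e > 0" "ball y e \<subseteq> - CV" using y open_contains_ball by blast
    then show ?thesis using that[of "e/2"] by simp
  qed
  obtain \<eta> where \<eta>: "\<eta> > 0" "\<And>z. (\<And>p. p \<in> CV \<Longrightarrow> d \<le> dist (f z) p) \<Longrightarrow> \<eta> \<le> norm (of_nat l - exp z)"
    using deriv_f_lower[OF d(1)] by blast
  obtain r where r: "r > 0"
    "\<And>z. \<eta> \<le> norm (of_nat l - exp z) \<Longrightarrow> inj_on f (ball z (4 * r))"
    "\<And>z. \<eta> \<le> norm (of_nat l - exp z) \<Longrightarrow> ball (f z) (r * norm (of_nat l - exp z) / 2) \<subseteq> f ` ball z r"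
    using f_local[OF \<eta>(1)] by blast
  define s where "s = min d (r * \<eta> / 2)"
  have s: "s > 0" "s \<le> d" "s \<le> r * \<eta> / 2" using d r \<eta> by (auto simp: s_def)
  have low: "\<eta> \<le> norm (of_nat l - exp x)" if "f x \<in> ball y s" for x
  proof (rule \<eta>(2))
    fix p assume p: "p \<in> CV"
    then have "2 * d \<le> dist y p" using d(2) by (meson ComplD mem_ball not_le subsetD)
    then show "d \<le> dist (f x) p" using that s dist_triangle[of y p "f x"] by auto
  qed
  show ?thesis
  proof (rule that[OF r(1) s(1)])
    show "ball y s \<subseteq> - CV" using s d by (intro order.trans[OF subset_ball d(2)]) auto
    fix x assume x: "f x \<in> ball y s"
    show "inj_on f (ball x (4 * r))" by (rule r(2)[OF low[OF x]])
    have "r * \<eta> \<le> r * norm (of_nat l - exp x)" using low[OF x] r by (intro mult_left_mono) auto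
    then show "ball (f x) s \<subseteq> f ` ball x r"
      using r(3)[OF low[OF x]] s by (meson order.trans subset_ball divide_right_mono zero_le_numeral)
  qed
qed

text \<open>The uniform radius \<open>s\<close> makes both the range and its complement open in the
  complement of \<open>CV\<close>, which is connected because \<open>CV\<close> is
  countable.\<close>

lemma f_surj_off_CV: "- CV \<subseteq> range f"
proof -
  let ?A = "- CV \<inter> range f" and ?B = "- CV - range f"
  have loc: "\<exists>s>0. ball y s \<subseteq> (if y \<in> range f then ?A else ?B)" if y: "y \<notin> CV" for y
  proof -
    obtain r s where rs: "r > 0" "s > 0" "ball y s \<subseteq> - CV" "\<And>x. f x \<in> ball y s \<Longrightarrow> ball (f x) s \<subseteq> f ` ball x r"
      using f_uniform_local[OF y] by metis
    show ?thesis
    proof (cases "y \<in> range f")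
      case True
      then obtain x where "y = f x" by auto
      then show ?thesis using rs(4)[of x] rs(2,3) by (intro exI[of _ s]) auto
    next
      case False
      have "x \<notin> ball y s" if "x \<in> range f" for x
        using rs(4) that False by (force simp: dist_commute)
      then show ?thesis using rs False by (intro exI[of _ s]) auto
    qed
  qed
  have "open ?A"
    unfolding open_contains_ball
  proof
    fix y assume "y \<in> ?A"
    then show "\<exists>e>0. ball y e \<subseteq> ?A" using loc[of y] by (auto split: if_splits)
  qed
  moreover have "open ?B"
    unfolding open_contains_ball
  proof
    fix y assume "y \<in> ?B"
    then show "\<exists>e>0. ball y e \<subseteq> ?B" using loc[of y] by (auto split: if_splits)
  qed
  moreover have "connected (- CV)"
    using path_connected_complement_countable[OF _ countable_CV] path_connected_imp_connected by (simp add: DIM_complex)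
  \<comment> \<open>Since \<open>f\<close> takes two different values, its connected range is
    uncountable and does not fit into \<open>CV\<close>.\<close>
  moreover have "?A \<noteq> {}"
  proof -
    have "f 0 \<noteq> f (0 + per 1)"
      unfolding f_per using l2 by (simp add: per_def)
    moreover have "connected (range f)"
      by (intro connected_continuous_image holomorphic_on_imp_continuous_on hol_f) auto
    ultimately have "uncountable (range f)"
      using connected_uncountable[of "range f" "f 0" "f (0 + per 1)"] by blast
    then have "\<not> range f \<subseteq> CV" using countable_CV countable_subset by blast
    then show ?thesis by auto
  qed
  ultimately have "?B = {}"
    using connectedD[of "- CV" ?A ?B] by blast
  then show ?thesis by auto
qed

lemma covering_f: "covering_space {z. f z \<notin> CV} f (- CV)"
  unfolding covering_space_def
proof (intro conjI ballI)
  show "continuous_on {z. f z \<notin> CV} f" by (intro holomorphic_on_imp_continuous_on hol_f)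
  show "f ` {z. f z \<notin> CV} = - CV" using f_surj_off_CV by auto
  fix y assume "y \<in> - CV"
  then have y: "y \<notin> CV" by simp
  obtain r s where rs: "r > 0" "s > 0" "ball y s \<subseteq> - CV"
    "\<And>x. f x \<in> ball y s \<Longrightarrow> inj_on f (ball x (4 * r))"
    "\<And>x. f x \<in> ball y s \<Longrightarrow> ball (f x) s \<subseteq> f ` ball x r"
    using f_uniform_local[OF y] by blast
  have contf: "continuous_on A f" for A by (intro holomorphic_on_imp_continuous_on hol_f)
  define U where "U = (\<lambda>z. ball z r \<inter> f -` ball y s)"
  have opU: "open (U z)" for z
    unfolding U_def by (intro open_Int open_ball open_vimage contf)
  show "\<exists>T. y \<in> T \<and> openin (top_of_set (- CV)) T \<and>
             (\<exists>v. \<Union> v = {z. f z \<notin> CV} \<inter> f -` T \<and> (\<forall>u\<in>v. openin (top_of_set {z. f z \<notin> CV}) u) \<and>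
                  pairwise disjnt v \<and> (\<forall>u\<in>v. \<exists>q. homeomorphism u T f q))"
  proof (intro exI[of _ "ball y s"] conjI exI[of _ "U ` {z. f z = y}"] ballI)
    show "y \<in> ball y s" using rs by simp
    show "openin (top_of_set (- CV)) (ball y s)"
      using rs by (intro openin_subset_trans[where S = "ball y s" and T = UNIV, simplified] open_subset) auto
    show "\<Union> (U ` {z. f z = y}) = {z. f z \<notin> CV} \<inter> f -` ball y s"
    proof (intro set_eqI iffI)
      fix x assume x: "x \<in> {z. f z \<notin> CV} \<inter> f -` ball y s"
      then have "y \<in> ball (f x) s" by (simp add: dist_commute)
      then obtain z where "z \<in> ball x r" "f z = y" using rs(5)[of x] x by auto
      then show "x \<in> \<Union> (U ` {z. f z = y})" using x by (auto simp: U_def dist_commute)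
    qed (use rs in \<open>auto simp: U_def\<close>)
    show "pairwise disjnt (U ` {z. f z = y})"
    proof (rule pairwiseI)
      fix A B assume "A \<in> U ` {z. f z = y}" "B \<in> U ` {z. f z = y}" "A \<noteq> B"
      then obtain z z' where z: "f z = y" "f z' = y" "U z \<noteq> U z'" "A = U z" "B = U z'" by auto
      have "disjnt (U z) (U z')"
      proof (rule ccontr)
        assume "\<not> disjnt (U z) (U z')"
        then obtain x where "x \<in> ball z r" "x \<in> ball z' r" by (auto simp: disjnt_iff U_def)
        \<comment> \<open>This is why injectivity is kept on a ball of four times the radius: two
          overlapping sheets have both centres in it, and the centres have the same image.\<close>
        then have "dist z z' < 4 * r"
          using dist_triangle[of z z' x] rs by (simp add: dist_commute)
        then have "z = z'" using rs(4)[of z] z rs(1,2) by (metis centre_in_ball inj_onD mem_ball mult_pos_pos zero_less_numeral)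
        then show False using z by simp
      qed
      then show "disjnt A B" using z by simp
    qed
    fix u assume "u \<in> U ` {z. f z = y}"
    then obtain z where z: "f z = y" "u = U z" by auto
    show "openin (top_of_set {z. f z \<notin> CV}) u"
      unfolding z(2) using rs by (intro open_subset opU) (auto simp: U_def)
    have inj: "inj_on f (U z)"
      by (rule inj_on_subset[OF rs(4)[of z]]) (use z rs(1,2) in \<open>auto simp: U_def\<close>)
    have img: "f ` U z = ball y s" using rs(5)[of z] z rs(2) by (auto simp: U_def)
    obtain q where q: "q holomorphic_on f ` U z" "\<And>x. x \<in> U z \<Longrightarrow> q (f x) = x"
      using holomorphic_has_inverse[OF hol_f opU inj] by metis
    have "homeomorphism u (ball y s) f q"
      unfolding z(2) homeomorphism_def using q img
      by (auto intro: contf holomorphic_on_imp_continuous_on simp: image_iff) (metis imageI img mem_ball image_iff)+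
    then show "\<exists>q. homeomorphism u (ball y s) f q" by blast
  qed
qed

lemma f_surj_per: "\<exists>b k. f b = a + per k"
proof (cases "a \<in> CV")
  case True
  then have "exp v = exp a" unfolding CV_def by simp
  then obtain k where k: "v = a + per k" unfolding exp_eq_per by blast
  show ?thesis by (rule exI[of _ "Ln (of_nat l)"]) (use k v_def in auto)
next
  case False
  then obtain b where "a = f b" using f_surj_off_CV by blast
  then show ?thesis by (intro exI[of _ b] exI[of _ 0]) simp
qed

lemma fn_surj_per: "\<exists>b k. (f ^^ n) b = a + per k"
proof (induction n)
  case 0
  then show ?case by (intro exI[of _ a] exI[of _ 0]) simp
next
  case (Suc n)
  then obtain b k where b: "(f ^^ n) b = a + per k" by blast
  obtain b' k' where b': "f b' = b + per k'" using f_surj_per by blast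
  have "(f ^^ Suc n) b' = a + per (k + int l ^ n * k')"
    by (simp only: funpow_Suc_right o_apply b' fn_per b per_add add.assoc)
  then show ?case by blast
qed

lemma f_lift:
  assumes hol: "\<phi> holomorphic_on ball b \<rho>" and \<rho>: "\<rho> > 0"
    and omit: "\<And>u. u \<in> ball b \<rho> \<Longrightarrow> \<phi> u \<notin> CV" and a: "f a = \<phi> b"
  obtains \<psi> where "\<psi> holomorphic_on ball b \<rho>" "\<psi> b = a" "\<And>u. u \<in> ball b \<rho> \<Longrightarrow> f (\<psi> u) = \<phi> u"
proof -
  have bb: "b \<in> ball b \<rho>" using \<rho> by simp
  obtain g where g: "continuous_on (ball b \<rho>) g" "g \<in> ball b \<rho> \<rightarrow> {z. f z \<notin> CV}" "g b = a"
    "\<And>y. y \<in> ball b \<rho> \<Longrightarrow> f (g y) = \<phi> y"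
  proof (rule covering_space_lift_strong[OF covering_f _ bb _ _ holomorphic_on_imp_continuous_on[OF hol]])
    show "a \<in> {z. f z \<notin> CV}" using a omit[OF bb] by simp
    show "simply_connected (ball b \<rho>)" by (simp add: convex_imp_simply_connected)
    show "locally path_connected (ball b \<rho>)" by (simp add: open_imp_locally_path_connected)
    show "\<phi> \<in> ball b \<rho> \<rightarrow> - CV" using omit by auto
  qed (use a in auto)
  have "open {z. f z \<notin> CV}"
  proof -
    have "open (f -` (- CV))"
      using closed_CV by (intro open_vimage holomorphic_on_imp_continuous_on hol_f) auto
    then show ?thesis by (simp add: vimage_def)
  qed
  then have "g holomorphic_on ball b \<rho>"
    using covering_space_lift_is_holomorphic[OF covering_f _ hol_f hol _ g(2,1,4)] omit by auto
  then show ?thesis using that g by blast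
qed

end


section \<open>A trap containing the critical values\<close>

context lc_map
begin

lemma c_nz: "c \<noteq> 0"
proof
  assume "c = 0"
  then have "real l < 1" using c_ball by simp
  then show False using l2 by simp
qed

lemma norm_lc: "norm (of_nat l - c) < 1"
  using c_ball by (simp add: dist_norm)

definition p :: complex where "p = Ln c"

lemma exp_p: "exp p = c"
  using c_nz by (simp add: p_def)

lemma f_p: "f p = p"
  using c_nz by (simp add: p_def fmap_lc_def algebra_simps)

lemma fn_p: "(f ^^ n) p = p"
  by (induction n) (auto simp: f_p)

lemma deriv_fn_p: "deriv (f ^^ n) p = (of_nat l - c) ^ n"
proof (induction n)
  case 0
  then show ?case by simp
next
  case (Suc n)
  then show ?case by (simp only: deriv_fn_Suc f_p exp_p power_Suc2)
qed

text \<open>Far to the left \<open>exp u\<close> is at most 1 in modulus and the linear term, with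
  \<open>l \<ge> 2\<close>, pushes the orbit further left.\<close>

lemma left_half_plane:
  assumes "Re u \<le> - norm a0 - 2"
  shows "Re (f u) \<le> Re u - 1"
proof -
  have "Re (f u) = Re a0 + l * Re u - Re (exp u)" by (simp add: f_eq)
  also have "\<dots> \<le> norm a0 + l * Re u + exp (Re u)"
    using complex_Re_le_cmod[of a0] abs_Re_le_cmod[of "exp u"] by simp
  also have "exp (Re u) \<le> 1" using assms norm_ge_zero[of a0] by (simp del: norm_ge_zero)
  also have "l * Re u \<le> 2 * Re u" using l2 assms norm_ge_zero[of a0] by (intro mult_right_mono_neg) (auto simp del: norm_ge_zero)
  finally show ?thesis using assms by simp
qed

text \<open>The margin \<open>d\<close> is part of the notion: the contraction holds on the disc
  enlarged by \<open>d\<close>, and \<open>\<mu> * (\<epsilon> + d) \<le> \<epsilon>\<close> sends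
  the enlarged disc back into the one of radius \<open>\<epsilon>\<close>.\<close>

definition basin :: "real \<Rightarrow> real \<Rightarrow> real \<Rightarrow> bool" where
  "basin \<epsilon> \<mu> d \<longleftrightarrow> 0 < \<epsilon> \<and> \<epsilon> \<le> 1 \<and> 0 < \<mu> \<and> \<mu> < 1 \<and> 0 < d \<and> d \<le> 1 \<and> \<mu> * (\<epsilon> + d) \<le> \<epsilon> \<and>
     (\<forall>u. dist p u < \<epsilon> + d \<longrightarrow> dist p (f u) \<le> \<mu> * dist p u)"

lemma basin_exists: "\<exists>\<epsilon> \<mu> d. basin \<epsilon> \<mu> d"
proof -
  define \<mu> where "\<mu> = (1 + norm (of_nat l - c)) / 2"
  have \<mu>: "0 < \<mu>" "\<mu> < 1" "norm (of_nat l - c) < \<mu>"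
    using norm_lc by (simp_all add: \<mu>_def add_pos_nonneg field_simps)
  have "isCont (\<lambda>u. norm (of_nat l - exp u)) p" by (intro continuous_intros)
  then obtain e where e: "e > 0" "\<And>u. dist u p < e \<Longrightarrow> dist (norm (of_nat l - exp u)) (norm (of_nat l - c)) < \<mu> - norm (of_nat l - c)"
  proof -
    have "\<mu> - norm (of_nat l - c) > 0" using \<mu> by simp
    with \<open>isCont _ p\<close> show ?thesis
      unfolding continuous_at_eps_delta exp_p using that by blast
  qed
  define e1 where "e1 = min e 1"
  have e1: "0 < e1" "e1 \<le> 1" "e1 \<le> e" using e by (auto simp: e1_def)
  have "basin (\<mu> * e1) \<mu> ((1 - \<mu>) * e1)"
    unfolding basin_def
  proof (intro conjI allI impI)
    have sum: "\<mu> * e1 + (1 - \<mu>) * e1 = e1" by (simp add: algebra_simps)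
    show "\<mu> * (\<mu> * e1 + (1 - \<mu>) * e1) \<le> \<mu> * e1" by (simp add: sum)
    show "\<mu> * e1 \<le> 1" "(1 - \<mu>) * e1 \<le> 1" using \<mu> e1 by (auto intro!: mult_le_one)
    fix u assume "dist p u < \<mu> * e1 + (1 - \<mu>) * e1"
    then have u: "u \<in> ball p e1" using sum by simp
    have "norm (f u - f p) \<le> \<mu> * norm (u - p)"
    proof (rule field_differentiable_bound[where S = "ball p e1"])
      show "norm (of_nat l - exp x) \<le> \<mu>" if "x \<in> ball p e1" for x
        using e(2)[of x] that e1 by (auto simp: dist_commute dist_real_def)
    qed (use u e1 DERIV_f in auto)
    then show "dist p (f u) \<le> \<mu> * dist p u" by (simp add: f_p dist_norm norm_minus_commute)
  qed (use \<mu> e1 in auto)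
  then show ?thesis by blast
qed

lemma basin_per:
  assumes "basin \<epsilon> \<mu> d" "dist (p + per k) u < \<epsilon> + d"
  shows "dist (p + per (int l * k)) (f u) \<le> \<mu> * dist (p + per k) u"
proof -
  define u' where "u' = u + per (- k)"
  have u: "u = u' + per k" by (simp add: u'_def per_minus)
  have "dist (p + per k) u = dist p u'" by (simp add: u)
  moreover have "dist (p + per (int l * k)) (f u) = dist p (f u')" unfolding u f_per by simp
  ultimately show ?thesis using assms by (auto simp: basin_def)
qed

text \<open>Fatou's argument. If the critical orbit missed all these discs, every iterate would have
  an inverse branch on \<open>ball p \<epsilon>\<close> fixing \<open>p\<close>. These branches omit
  two common values, so their derivatives at \<open>p\<close> are bounded; but they are the inverses
  of \<open>(of_nat l - c) ^ n\<close>, which tends to 0.\<close>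

lemma critical_orbit_attracted:
  assumes b: "basin \<epsilon> \<mu> d"
  shows "\<exists>n k. dist (p + per k) ((f ^^ n) v) < \<epsilon>"
proof (rule ccontr)
  assume neg: "\<not> ?thesis"
  have \<epsilon>: "\<epsilon> > 0" "\<epsilon> \<le> 1" using b by (auto simp: basin_def)
  have br: "\<exists>\<psi>. \<psi> holomorphic_on ball p \<epsilon> \<and> \<psi> p = p \<and> (\<forall>u\<in>ball p \<epsilon>. (f ^^ n) (\<psi> u) = u)" for n
  proof (induction n)
    case 0
    show ?case by (intro exI[of _ "\<lambda>u. u"]) auto
  next
    case (Suc n)
    then obtain \<psi> where \<psi>: "\<psi> holomorphic_on ball p \<epsilon>" "\<psi> p = p" "\<forall>u\<in>ball p \<epsilon>. (f ^^ n) (\<psi> u) = u" by blast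
    have "\<psi> u \<notin> CV" if u: "u \<in> ball p \<epsilon>" for u
    proof
      assume "\<psi> u \<in> CV"
      then obtain k where "\<psi> u = v + per k" by (auto simp: CV_def exp_eq_per)
      then have "u = (f ^^ n) v + per (int l ^ n * k)" using \<psi>(3) u fn_per by metis
      then have "dist (p + per (- (int l ^ n * k))) ((f ^^ n) v) < \<epsilon>"
        using u unfolding per_minus by (simp add: dist_norm algebra_simps)
      then show False using neg by blast
    qed
    then obtain \<psi>' where \<psi>': "\<psi>' holomorphic_on ball p \<epsilon>" "\<psi>' p = p" "\<And>u. u \<in> ball p \<epsilon> \<Longrightarrow> f (\<psi>' u) = \<psi> u"
      using f_lift[OF \<psi>(1) \<epsilon>(1), of p] \<psi>(2) f_p by metis
    then show ?case using \<psi> by (intro exI[of _ \<psi>']) (auto simp: funpow_Suc_right simp del: funpow.simps)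
  qed
  define B where "B = 4 * schottky_const 1 * (4 * pi) / \<epsilon>"
  have B: "B > 0" unfolding B_def using \<epsilon> by (simp add: schottky_const_pos)
  have ge: "1 / B \<le> norm (of_nat l - c) ^ n" for n
  proof -
    obtain \<psi> where \<psi>: "\<psi> holomorphic_on ball p \<epsilon>" "\<psi> p = p" "\<forall>u\<in>ball p \<epsilon>. (f ^^ n) (\<psi> u) = u" using br by blast
    \<comment> \<open>Another translate of \<open>p\<close> is carried to
      \<open>p + per (int l ^ n * k)\<close>, at distance at least 2 pi from \<open>p\<close>, hence
      outside the disc.\<close>
    have omit: "\<psi> u \<noteq> p + per k" if u: "u \<in> ball p \<epsilon>" and k: "k \<noteq> 0" for u k
    proof
      assume "\<psi> u = p + per k"
      then have "u = p + per (int l ^ n * k)" using \<psi>(3) u fn_per fn_p by metis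
      then have "norm (per (int l ^ n * k)) < \<epsilon>" using u by (simp add: dist_norm)
      moreover have "int l ^ n * k \<noteq> 0" using k l2 by auto
      then have "1 \<le> \<bar>real_of_int (int l ^ n * k)\<bar>" by linarith
      then have "2 * pi \<le> norm (per (int l ^ n * k))" unfolding norm_per by simp
      ultimately show False using \<epsilon> pi_ge_two by linarith
    qed
    have "norm (deriv \<psi> p) \<le> 4 * schottky_const 1 * norm ((p + per (-1)) - (p + per 1)) / \<epsilon>"
    proof (rule deriv_bound_omit_two[OF \<psi>(1) \<epsilon>(1)])
      show "p + per 1 \<noteq> p + per (-1)" by (simp add: per_def)
      show "\<psi> u \<noteq> p + per 1 \<and> \<psi> u \<noteq> p + per (-1)" if "u \<in> ball p \<epsilon>" for u
        using omit[OF that] by simp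
      show "norm (\<psi> p - (p + per 1)) \<le> 1 * norm (p + per (- 1) - (p + per 1))"
        by (simp add: \<psi>(2) per_def norm_mult)
    qed
    also have "norm ((p + per (-1)) - (p + per 1)) = 4 * pi" by (simp add: per_def norm_mult)
    finally have le: "norm (deriv \<psi> p) \<le> B" by (simp add: B_def)
    have "((\<lambda>u. (f ^^ n) (\<psi> u)) has_field_derivative deriv (f ^^ n) (\<psi> p) * deriv \<psi> p) (at p)"
      using \<psi>(1) \<epsilon> by (intro DERIV_chain2[OF DERIV_fn] holomorphic_derivI) auto
    then have "((\<lambda>u. u) has_field_derivative deriv (f ^^ n) (\<psi> p) * deriv \<psi> p) (at p)"
      by (rule has_field_derivative_transform_within_open[where S = "ball p \<epsilon>"]) (use \<psi> \<epsilon> in auto)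
    then have "deriv (f ^^ n) p * deriv \<psi> p = 1"
      using DERIV_unique[OF _ DERIV_ident] \<psi>(2) by metis
    then have "norm (of_nat l - c) ^ n * norm (deriv \<psi> p) = 1"
      unfolding deriv_fn_p by (metis norm_mult norm_one norm_power)
    moreover have "norm (of_nat l - c) ^ n * norm (deriv \<psi> p) \<le> norm (of_nat l - c) ^ n * B"
      using le by (intro mult_left_mono) auto
    ultimately show ?thesis using B by (simp add: field_simps)
  qed
  have "(\<lambda>n. norm (of_nat l - c) ^ n) \<longlonglongrightarrow> 0"
    using norm_lc by (intro LIMSEQ_power_zero) auto
  then have "\<forall>\<^sub>F n in sequentially. norm (of_nat l - c) ^ n < 1 / B"
    using B by (intro order_tendstoD) auto
  then obtain n where "norm (of_nat l - c) ^ n < 1 / B"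
    using eventually_happens by fastforce
  then show False using ge[of n] by simp
qed

definition trap :: "real \<Rightarrow> complex set \<Rightarrow> bool" where
  "trap d P \<longleftrightarrow> d > 0 \<and> (\<forall>z\<in>P. \<forall>k. z + per k \<in> P) \<and> (\<forall>z\<in>P. \<forall>u. dist z u < d \<longrightarrow> f u \<in> P)"

text \<open>The half plane belongs to the trap so that the complement has real part bounded below;
  compactness arguments on \<open>X\<close> rest on this.\<close>

definition P0 :: "real \<Rightarrow> complex set" where
  "P0 \<epsilon> = {z. Re z \<le> - norm a0 - 4} \<union> {z. \<exists>k. dist (p + per k) z \<le> \<epsilon>}"

lemma trap_P0:
  assumes "basin \<epsilon> \<mu> d"
  shows "trap d (P0 \<epsilon>)"
  unfolding trap_def
proof (intro conjI ballI allI impI)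
  have b: "\<epsilon> > 0" "0 < \<mu>" "\<mu> * (\<epsilon> + d) \<le> \<epsilon>" and d: "d > 0" "d \<le> 1" using assms by (auto simp: basin_def)
  show "d > 0" by fact
  show "z + per k \<in> P0 \<epsilon>" if "z \<in> P0 \<epsilon>" for z k
  proof -
    have "dist (p + per (j + k)) (z + per k) = dist (p + per j) z" for j
      by (simp add: per_add add.assoc[symmetric])
    then have "dist (p + per j) z \<le> \<epsilon> \<Longrightarrow> \<exists>i. dist (p + per i) (z + per k) \<le> \<epsilon>" for j
      by metis
    then show ?thesis using that by (auto simp: P0_def)
  qed
  fix z u assume z: "z \<in> P0 \<epsilon>" and u: "dist z u < d"
  show "f u \<in> P0 \<epsilon>"
  proof (cases "Re z \<le> - norm a0 - 4")
    case True
    have "\<bar>Re (z - u)\<bar> < d" using u abs_Re_le_cmod[of "z - u"] by (simp add: dist_norm)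
    then have "Re u \<le> - norm a0 - 3" using True d by simp
    then have "Re (f u) \<le> - norm a0 - 4" using left_half_plane[of u] by simp
    then show ?thesis by (simp add: P0_def)
  next
    case False
    then obtain k where k: "dist (p + per k) z \<le> \<epsilon>" using z by (auto simp: P0_def)
    then have lt: "dist (p + per k) u < \<epsilon> + d" using u dist_triangle[of "p + per k" u z] by simp
    then have "dist (p + per (int l * k)) (f u) \<le> \<mu> * dist (p + per k) u" by (rule basin_per[OF assms])
    also have "\<dots> \<le> \<mu> * (\<epsilon> + d)" using lt b by (intro mult_left_mono) auto
    also have "\<dots> \<le> \<epsilon>" by fact
    finally show ?thesis by (auto simp: P0_def)
  qed
qed

lemma trap_forward: "trap d P \<Longrightarrow> z \<in> P \<Longrightarrow> f z \<in> P"
  unfolding trap_def by (metis dist_self)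

lemma trap_forward_n: "trap d P \<Longrightarrow> z \<in> P \<Longrightarrow> (f ^^ n) z \<in> P"
  by (induction n) (auto intro: trap_forward)

text \<open>The trap is pulled back one preimage at a time. Each step adds the translates of a disc
  of half the radius on which \<open>f\<close> lands in the old trap; the other half becomes the
  margin of the new trap.\<close>

lemma trap_extend:
  assumes "trap d P" "e > 0" "ball ((f ^^ n) x) e \<subseteq> P"
  shows "\<exists>P' d' e'. trap d' P' \<and> P \<subseteq> P' \<and> e' > 0 \<and> ball x e' \<subseteq> P' \<and> (\<forall>z\<in>P'. \<exists>n. (f ^^ n) z \<in> P)"
  using assms(3)
proof (induction n arbitrary: x)
  case 0
  have "\<forall>z\<in>P. \<exists>n. (f ^^ n) z \<in> P" by (intro ballI exI[of _ 0]) auto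
  then show ?case using 0 assms by auto
next
  case (Suc n)
  then obtain P1 d1 e1 where P1: "trap d1 P1" "P \<subseteq> P1" "e1 > 0" "ball (f x) e1 \<subseteq> P1" "\<forall>z\<in>P1. \<exists>n. (f ^^ n) z \<in> P"
    by (auto simp: funpow_Suc_right simp del: funpow.simps) blast
  have "isCont f x" using DERIV_f DERIV_isCont by blast
  then obtain e2 where e2: "e2 > 0" "\<And>u. dist u x < e2 \<Longrightarrow> dist (f u) (f x) < e1"
    using P1(3) unfolding continuous_at_eps_delta by blast
  have near: "f u \<in> P1" if "dist (x + per k) u < e2" for u k
  proof -
    have "dist (f (u + per (- k))) (f x) < e1"
      using that by (intro e2) (simp add: per_minus dist_norm algebra_simps norm_minus_commute)
    then have "f (u + per (- k)) \<in> P1" using P1(4) by (auto simp: dist_commute)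
    then have "f (u + per (- k)) + per (int l * k) \<in> P1" using P1(1) by (auto simp: trap_def)
    then show ?thesis unfolding f_per[symmetric] by (simp add: per_minus)
  qed
  let ?N = "{u. \<exists>k. dist (x + per k) u < e2 / 2}"
  have "trap (min d1 (e2 / 2)) (P1 \<union> ?N)"
    unfolding trap_def
  proof (intro conjI ballI allI impI)
    show "0 < min d1 (e2 / 2)" using e2 P1(1) by (auto simp: trap_def)
    show "z + per k \<in> P1 \<union> ?N" if "z \<in> P1 \<union> ?N" for z k
    proof -
      have "dist (x + per (j + k)) (z + per k) = dist (x + per j) z" for j
        by (simp add: per_add add.assoc[symmetric])
      then have "z + per k \<in> ?N" if "z \<in> ?N" using that by auto metis
      moreover have "z + per k \<in> P1" if "z \<in> P1" using that P1(1) by (auto simp: trap_def)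
      ultimately show ?thesis using that by blast
    qed
    fix z u assume z: "z \<in> P1 \<union> ?N" and u: "dist z u < min d1 (e2 / 2)"
    show "f u \<in> P1 \<union> ?N"
    proof (cases "z \<in> P1")
      case True
      then show ?thesis using u P1(1) by (auto simp: trap_def)
    next
      case False
      then obtain k where "dist (x + per k) z < e2 / 2" using z by auto
      then have "dist (x + per k) u < e2" using u dist_triangle[of "x + per k" u z] by simp
      then show ?thesis using near by blast
    qed
  qed
  moreover have "ball x (e2 / 2) \<subseteq> P1 \<union> ?N" by (auto intro!: exI[of _ 0])
  moreover have "\<exists>n. (f ^^ n) z \<in> P" if zin: "z \<in> P1 \<union> ?N" for z
  proof (cases "z \<in> P1")
    case False
    then obtain k where "dist (x + per k) z < e2 / 2" using zin by auto
    then have "f z \<in> P1" using near[of k z] e2(1) by simp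
    then obtain m where "(f ^^ m) (f z) \<in> P" using P1(5) by blast
    then show ?thesis by (intro exI[of _ "Suc m"]) (simp add: funpow_Suc_right del: funpow.simps)
  qed (use P1 in auto)
  ultimately show ?case using P1(2) e2(1)
    by (intro exI[of _ "P1 \<union> ?N"] exI[of _ "min d1 (e2 / 2)"] exI[of _ "e2 / 2"]) auto
qed

lemma trap_mono: "trap d P \<Longrightarrow> 0 < d' \<Longrightarrow> d' \<le> d \<Longrightarrow> trap d' P"
  unfolding trap_def by force

lemma trap_exists:
  "\<exists>P d \<epsilon> \<mu> d0. basin \<epsilon> \<mu> d0 \<and> trap d P \<and> d \<le> 1 \<and> P0 \<epsilon> \<subseteq> P \<and> v \<in> P \<and> (\<forall>z\<in>P. \<exists>n. (f ^^ n) z \<in> P0 \<epsilon>)"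
proof -
  obtain \<epsilon> \<mu> d0 where b: "basin \<epsilon> \<mu> d0" using basin_exists by blast
  obtain n k where nk: "dist (p + per k) ((f ^^ n) v) < \<epsilon>" using critical_orbit_attracted[OF b] by blast
  define e where "e = \<epsilon> - dist (p + per k) ((f ^^ n) v)"
  have "ball ((f ^^ n) v) e \<subseteq> P0 \<epsilon>"
  proof
    fix x assume "x \<in> ball ((f ^^ n) v) e"
    then have "dist (p + per k) x \<le> \<epsilon>"
      using dist_triangle[of "p + per k" x "(f ^^ n) v"] by (simp add: e_def)
    then show "x \<in> P0 \<epsilon>" by (auto simp: P0_def)
  qed
  moreover have "e > 0" using nk by (simp add: e_def)
  ultimately obtain P' d' e' where P': "trap d' P'" "P0 \<epsilon> \<subseteq> P'" "e' > 0" "ball v e' \<subseteq> P'" "\<forall>z\<in>P'. \<exists>n. (f ^^ n) z \<in> P0 \<epsilon>"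
    using trap_extend[OF trap_P0[OF b]] by blast
  have "d' > 0" using P'(1) by (simp add: trap_def)
  \<comment> \<open>The margin is capped at 1 so that \<open>exp\<close> is injective on discs of
    radius \<open>d\<close>.\<close>
  then have "trap (min d' 1) P'" by (intro trap_mono[OF P'(1)]) auto
  moreover have "v \<in> P'" using P'(3,4) by auto
  ultimately show ?thesis using b P'
    by (intro exI[of _ P'] exI[of _ "min d' 1"] exI[of _ \<epsilon>] exI[of _ \<mu>] exI[of _ d0]) auto
qed

end


section \<open>The complement of the basins\<close>

locale lc_trap = lc_map +
  fixes P :: "complex set" and d \<epsilon> \<mu> d0 :: real
  assumes bas: "basin \<epsilon> \<mu> d0" and tr: "trap d P" and d1: "d \<le> 1" and P0P: "P0 \<epsilon> \<subseteq> P"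
    and vP: "v \<in> P" and PP0: "\<And>z. z \<in> P \<Longrightarrow> \<exists>n. (f ^^ n) z \<in> P0 \<epsilon>"
begin

lemma d_pos: "d > 0" using tr by (simp add: trap_def)

lemma P_per: "z \<in> P \<Longrightarrow> z + per k \<in> P"
  using tr by (auto simp: trap_def)

lemma P_nbhd: "z \<in> P \<Longrightarrow> dist z u < d \<Longrightarrow> f u \<in> P"
  using tr by (auto simp: trap_def)

lemma CV_P: "CV \<subseteq> P"
  using P_per[OF vP] by (auto simp: CV_def exp_eq_per)

lemma p_P: "p + per k \<in> P"
proof -
  have "dist (p + per k) (p + per k) \<le> \<epsilon>" using bas by (simp add: basin_def)
  then have "p + per k \<in> P0 \<epsilon>" unfolding P0_def by blast
  then show ?thesis using P0P by blast
qed

definition X :: "complex set" where "X = {z. \<forall>n. (f ^^ n) z \<notin> P}"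

lemma X_f: "f z \<in> X \<longleftrightarrow> z \<in> X"
proof
  assume z: "f z \<in> X"
  show "z \<in> X"
    unfolding X_def
  proof (rule, rule)
    fix n
    show "(f ^^ n) z \<notin> P"
    proof
      assume "(f ^^ n) z \<in> P"
      then have "(f ^^ Suc n) z \<in> P" using trap_forward[OF tr] by simp
      then show False using z by (auto simp: X_def funpow_Suc_right simp del: funpow.simps)
    qed
  qed
next
  assume "z \<in> X"
  then have "(f ^^ Suc n) z \<notin> P" for n unfolding X_def by blast
  then show "f z \<in> X" by (simp add: X_def funpow_Suc_right del: funpow.simps)
qed

lemma X_fn: "(f ^^ n) z \<in> X \<longleftrightarrow> z \<in> X"
  by (induction n) (auto simp: X_f)

lemma X_per: "z + per k \<in> X \<longleftrightarrow> z \<in> X"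
proof -
  have "z + per k \<in> X" if "z \<in> X" for z k
    unfolding X_def
  proof (rule, rule, rule)
    fix n assume "(f ^^ n) (z + per k) \<in> P"
    then have "(f ^^ n) z + per (int l ^ n * k) + per (- (int l ^ n * k)) \<in> P"
      unfolding fn_per by (rule P_per)
    then show False using that by (simp add: X_def per_minus)
  qed
  from this[of z k] this[of "z + per k" "- k"] show ?thesis by (auto simp: per_minus)
qed

text \<open>The margin of the trap read backwards: a point of \<open>P\<close> closer than
  \<open>d\<close> to \<open>y\<close> would put \<open>f y\<close> into \<open>P\<close>.\<close>

lemma X_ball: "y \<in> X \<Longrightarrow> u \<in> ball y d \<Longrightarrow> u \<notin> P"
  using P_nbhd[of u y] X_f[of y] unfolding X_def by (auto simp: dist_commute dest: spec[of _ 0])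

lemma X_notP: "y \<in> X \<Longrightarrow> y \<notin> P"
  unfolding X_def by (auto dest: spec[of _ 0])

lemma continuous_fn: "continuous_on A (f ^^ n)"
  by (intro holomorphic_on_imp_continuous_on hol_fn)

text \<open>\<open>P\<close> need not be open, but a point within \<open>d\<close> of
  \<open>P\<close> enters it one step later.\<close>

lemma closed_X: "closed X"
proof -
  have "open (- X)"
    unfolding open_contains_ball
  proof
    fix z assume "z \<in> - X"
    then obtain n where n: "(f ^^ n) z \<in> P" by (auto simp: X_def)
    have "isCont (f ^^ n) z" using DERIV_fn DERIV_isCont by blast
    then obtain e where e: "e > 0" "\<And>u. dist u z < e \<Longrightarrow> dist ((f ^^ n) u) ((f ^^ n) z) < d"
      using d_pos unfolding continuous_at_eps_delta by blast
    have "ball z e \<subseteq> - X"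
    proof
      fix u assume "u \<in> ball z e"
      then have "dist ((f ^^ n) z) ((f ^^ n) u) < d" using e(2)[of u] by (simp add: dist_commute)
      then have "(f ^^ Suc n) u \<in> P" using P_nbhd[OF n] by simp
      then show "u \<in> - X" unfolding X_def by blast
    qed
    then show "\<exists>e>0. ball z e \<subseteq> - X" using e(1) by blast
  qed
  then show ?thesis by (simp add: closed_def)
qed

lemma X_Re: "z \<in> X \<Longrightarrow> Re z > - norm a0 - 4"
  using X_notP[of z] P0P unfolding P0_def by force

lemma X_deriv_nz: assumes "z \<in> X" shows "of_nat l - exp z \<noteq> 0"
proof
  assume "of_nat l - exp z = 0"
  then have "exp z = exp (Ln (of_nat l))" using l2 by simp
  then obtain k where "z = Ln (of_nat l) + per k" unfolding exp_eq_per by blast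
  then have "f z = v + per (int l * k)" by (simp add: f_per v_def)
  then have "f z \<in> P" using P_per[OF vP] by simp
  then show False using assms X_f X_notP by blast
qed

lemma X_deriv_fn_nz: "z \<in> X \<Longrightarrow> deriv (f ^^ n) z \<noteq> 0"
proof (induction n arbitrary: z)
  case 0
  then show ?case by simp
next
  case (Suc n)
  then show ?case using X_deriv_nz X_f by (simp add: deriv_fn_Suc del: funpow.simps)
qed

text \<open>A disc in the complement of \<open>P\<close> lifts under \<open>f\<close> to a disc that keeps distance \<open>d\<close> from
  \<open>P\<close>, so it may be enlarged by \<open>d\<close>; this replaces the expansion of the hyperbolic metric.\<close>

lemma large_disc:
  assumes "z \<in> X"
  shows "\<exists>\<phi>. \<phi> holomorphic_on ball 0 1 \<and> \<phi> 0 = z \<and> (\<forall>\<zeta>\<in>ball 0 1. \<phi> \<zeta> \<notin> P) \<and>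
           d * (\<Sum>k<n. 1 / norm (deriv (f ^^ k) z)) \<le> norm (deriv \<phi> 0)"
  using assms
proof (induction n arbitrary: z)
  case 0
  then show ?case using X_notP by (intro exI[of _ "\<lambda>_. z"]) auto
next
  case (Suc n)
  have "f z \<in> X" using Suc.prems X_f by blast
  then obtain \<phi> where \<phi>: "\<phi> holomorphic_on ball 0 1" "\<phi> 0 = f z" "\<forall>\<zeta>\<in>ball 0 1. \<phi> \<zeta> \<notin> P"
     "d * (\<Sum>k<n. 1 / norm (deriv (f ^^ k) (f z))) \<le> norm (deriv \<phi> 0)"
    using Suc.IH by blast
  obtain \<psi> where \<psi>: "\<psi> holomorphic_on ball 0 1" "\<psi> 0 = z" "\<And>\<zeta>. \<zeta> \<in> ball 0 1 \<Longrightarrow> f (\<psi> \<zeta>) = \<phi> \<zeta>"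
    using f_lift[OF \<phi>(1), of z] \<phi>(2,3) CV_P by (metis subsetD zero_less_one)
  define D where "D = deriv \<psi> 0"
  \<comment> \<open>The direction of \<open>D\<close>, so that the added term
    \<open>of_real d * u * \<zeta>\<close> raises the modulus of the derivative by exactly
    \<open>d\<close>.\<close>
  define u where "u = (if D = 0 then 1 else sgn D)"
  have u: "norm u = 1" by (simp add: u_def norm_sgn)
  have Du: "norm (D + of_real d * u) = norm D + d"
  proof (cases "D = 0")
    case False
    then have "D + of_real d * u = of_real (norm D + d) * u"
      by (simp add: u_def sgn_eq algebra_simps)
    then show ?thesis using u d_pos by (simp add: norm_mult del: of_real_add)
  qed (use u d_pos in \<open>simp add: norm_mult\<close>)
  define \<chi>' where "\<chi>' = (\<lambda>\<zeta>. \<psi> \<zeta> + of_real d * u * \<zeta>)"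
  have d\<psi>: "(\<psi> has_field_derivative D) (at 0)"
    unfolding D_def using \<psi>(1) by (intro holomorphic_derivI) auto
  have d\<chi>: "deriv \<chi>' 0 = D + of_real d * u"
    unfolding \<chi>'_def by (rule DERIV_imp_deriv) (auto intro!: derivative_eq_intros d\<psi>)
  have "((\<lambda>\<zeta>. f (\<psi> \<zeta>)) has_field_derivative (of_nat l - exp (\<psi> 0)) * D) (at 0)"
    by (rule DERIV_chain2[OF DERIV_f d\<psi>])
  then have "(\<phi> has_field_derivative (of_nat l - exp (\<psi> 0)) * D) (at 0)"
    by (rule has_field_derivative_transform_within_open[where S = "ball 0 1"]) (use \<psi> in auto)
  then have "deriv \<phi> 0 = (of_nat l - exp z) * D" using \<psi>(2) by (simp add: DERIV_imp_deriv)
  then have nD: "norm D = norm (deriv \<phi> 0) / norm (of_nat l - exp z)"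
    using X_deriv_nz[OF Suc.prems] by (simp add: norm_mult)
  have "d * (\<Sum>k<Suc n. 1 / norm (deriv (f ^^ k) z)) =
        d + d * (\<Sum>k<n. 1 / norm (deriv (f ^^ k) (f z))) / norm (of_nat l - exp z)"
    unfolding sum.lessThan_Suc_shift deriv_fn_Suc
  proof -
    have "deriv (f ^^ 0) z = 1" by simp
    moreover have "(\<Sum>k<n. 1 / norm (deriv (f ^^ k) (f z) * (of_nat l - exp z))) =
        (\<Sum>k<n. 1 / norm (deriv (f ^^ k) (f z))) / norm (of_nat l - exp z)"
      by (simp add: norm_mult sum_divide_distrib)
    ultimately show "d * (1 / norm (deriv (f ^^ 0) z) + (\<Sum>k<n. 1 / norm (deriv (f ^^ k) (f z) * (of_nat l - exp z)))) =
        d + d * (\<Sum>k<n. 1 / norm (deriv (f ^^ k) (f z))) / norm (of_nat l - exp z)"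
      by (simp only: distrib_left times_divide_eq_right norm_one mult_1_right div_by_1)
  qed
  also have "\<dots> \<le> d + norm D"
    unfolding nD using \<phi>(4) by (intro add_left_mono divide_right_mono) auto
  also have "\<dots> = norm (deriv \<chi>' 0)" unfolding d\<chi> Du by simp
  finally have "d * (\<Sum>k<Suc n. 1 / norm (deriv (f ^^ k) z)) \<le> norm (deriv \<chi>' 0)" .
  moreover have "\<chi>' holomorphic_on ball 0 1" unfolding \<chi>'_def by (intro holomorphic_intros \<psi>)
  moreover have "\<chi>' 0 = z" by (simp add: \<chi>'_def \<psi>)
  moreover have "\<chi>' \<zeta> \<notin> P" if "\<zeta> \<in> ball 0 1" for \<zeta>
  proof
    assume "\<chi>' \<zeta> \<in> P"
    moreover have "norm (of_real d * u * \<zeta>) < d"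
    proof -
      have "norm \<zeta> < 1" using that by simp
      then have "d * norm \<zeta> < d * 1" using d_pos by (intro mult_strict_left_mono) auto
      then show ?thesis using u d_pos by (simp add: norm_mult)
    qed
    then have "dist (\<chi>' \<zeta>) (\<psi> \<zeta>) < d" by (simp add: \<chi>'_def dist_norm)
    ultimately have "f (\<psi> \<zeta>) \<in> P" by (rule P_nbhd)
    then show False using \<psi>(3)[OF that] \<phi>(3) that by simp
  qed
  ultimately show ?case by blast
qed

text \<open>The discs of \<open>large_disc\<close> avoid all translates of \<open>p\<close>, so the
  Landau bound at \<open>z\<close> controls the partial sums independently of
  \<open>n\<close>.\<close>

lemma expansion:
  assumes "z \<in> X"
  shows "filterlim (\<lambda>n. norm (deriv (f ^^ n) z)) at_top sequentially"
proof -
  have le: "(\<Sum>k<n. 1 / norm (deriv (f ^^ k) z)) \<le> landau_const * (1 + \<bar>Re z - Re p\<bar>) / d" for n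
  proof -
    obtain \<phi> where \<phi>: "\<phi> holomorphic_on ball 0 1" "\<phi> 0 = z" "\<forall>\<zeta>\<in>ball 0 1. \<phi> \<zeta> \<notin> P"
      "d * (\<Sum>k<n. 1 / norm (deriv (f ^^ k) z)) \<le> norm (deriv \<phi> 0)"
      using large_disc[OF assms] by blast
    have "norm (deriv \<phi> 0) \<le> landau_const * (1 + \<bar>Re (\<phi> 0) - Re p\<bar>) / 1"
    proof (rule deriv_bound_omit_periodic[OF \<phi>(1)])
      fix u k assume "u \<in> ball (0::complex) 1"
      then show "\<phi> u \<noteq> p + 2 * of_real pi * \<i> * of_int k"
        unfolding per_def[symmetric] using \<phi>(3) p_P[of k] by metis
    qed simp
    then show ?thesis using \<phi>(2,4) d_pos by (simp add: field_simps)
  qed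
  have "summable (\<lambda>k. 1 / norm (deriv (f ^^ k) z))"
    by (rule summableI_nonneg_bounded[OF _ le]) auto
  then have "(\<lambda>k. 1 / norm (deriv (f ^^ k) z)) \<longlonglongrightarrow> 0" by (rule summable_LIMSEQ_zero)
  then have "filterlim (\<lambda>k. inverse (1 / norm (deriv (f ^^ k) z))) at_top sequentially"
    by (rule filterlim_inverse_at_top) (use X_deriv_fn_nz[OF assms] in auto)
  then show ?thesis by simp
qed

text \<open>The disc around \<open>y\<close> avoids the forward invariant set \<open>P\<close>,
  hence so do its lifts; as \<open>P\<close> contains \<open>CV\<close>, lifting can be repeated
  without shrinking the disc.\<close>

lemma inverse_branch:
  assumes "y \<in> X" "(f ^^ n) x = y"
  shows "\<exists>\<psi>. \<psi> holomorphic_on ball y d \<and> \<psi> y = x \<and> (\<forall>u\<in>ball y d. (f ^^ n) (\<psi> u) = u)"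
  using assms(2)
proof (induction n arbitrary: x)
  case 0
  then show ?case by (intro exI[of _ "\<lambda>u. u"]) auto
next
  case (Suc n)
  then have "(f ^^ n) (f x) = y" by (simp add: funpow_Suc_right del: funpow.simps)
  then obtain \<psi> where \<psi>: "\<psi> holomorphic_on ball y d" "\<psi> y = f x" "\<forall>u\<in>ball y d. (f ^^ n) (\<psi> u) = u"
    using Suc.IH by blast
  have "\<psi> u \<notin> CV" if u: "u \<in> ball y d" for u
  proof
    assume "\<psi> u \<in> CV"
    then have "(f ^^ n) (\<psi> u) \<in> P" using CV_P trap_forward_n[OF tr] by blast
    then show False using \<psi>(3) u X_ball[OF assms(1) u] by simp
  qed
  then obtain \<psi>' where "\<psi>' holomorphic_on ball y d" "\<psi>' y = x" "\<And>u. u \<in> ball y d \<Longrightarrow> f (\<psi>' u) = \<psi> u"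
    using f_lift[OF \<psi>(1) d_pos, of x] \<psi>(2) by metis
  then show ?case using \<psi> by (intro exI[of _ \<psi>']) (auto simp: funpow_Suc_right simp del: funpow.simps)
qed

text \<open>If the translates of \<open>a\<close> were omitted, the Landau bound would give
  \<open>norm (deriv (f ^^ n) z) \<le> C * (1 + |Re (f^n z)|)\<close> for all \<open>n\<close>. This
  is a uniform bound when the real part is small. When it is large, the estimate at time
  \<open>n + 1\<close> is used: the extra factor of the derivative is at least half of
  \<open>exp (Re y)\<close>, while the real part of \<open>f y\<close> is at most of that order. So
  the derivatives stay bounded, against \<open>expansion\<close>.\<close>

lemma blow_up:
  assumes z: "z \<in> X" and r: "r > 0" and j: "j \<ge> 1"
  shows "\<exists>n k u. dist z u < r \<and> (f ^^ (j * n)) u = a + per k"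
proof (rule ccontr)
  assume neg: "\<not> ?thesis"
  \<comment> \<open>Only iterates with exponent divisible by \<open>j\<close> are assumed to omit
    \<open>a\<close>. An iterate of order \<open>i\<close> modulo \<open>j\<close> omits instead the
    translates of a point that reaches a translate of \<open>a\<close> in \<open>j - i\<close>
    further steps.\<close>
  have "\<forall>i. \<exists>b. \<exists>k. (f ^^ (j - i)) b = a + per k" using fn_surj_per by blast
  then obtain b where b: "\<And>i. \<exists>k. (f ^^ (j - i)) (b i) = a + per k" by metis
  define B where "B = (\<Sum>i<j. \<bar>Re (b i)\<bar>)"
  have B: "\<bar>Re (b i)\<bar> \<le> B" if "i < j" for i
    unfolding B_def using that by (intro member_le_sum) auto
  have B0: "B \<ge> 0" unfolding B_def by (intro sum_nonneg) auto
  define C where "C = landau_const * (1 + B) / r"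
  have C: "C > 0" unfolding C_def using B0 r landau_const_pos by simp
  have bound: "norm (deriv (f ^^ n) z) \<le> C * (1 + \<bar>Re ((f ^^ n) z)\<bar>)" for n
  proof -
    define i where "i = n mod j"
    have i: "i < j" using j by (simp add: i_def)
    have n: "j - i + n = j * Suc (n div j)"
    proof -
      have "n = j * (n div j) + i" by (simp add: i_def)
      then show ?thesis using i by simp
    qed
    obtain k0 where k0: "(f ^^ (j - i)) (b i) = a + per k0" using b by blast
    have "norm (deriv (f ^^ n) z) \<le> landau_const * (1 + \<bar>Re ((f ^^ n) z) - Re (b i)\<bar>) / r"
    proof (rule deriv_bound_omit_periodic[OF hol_fn r])
      fix u k assume u: "u \<in> ball z r"
      show "(f ^^ n) u \<noteq> b i + 2 * of_real pi * \<i> * of_int k"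
        unfolding per_def[symmetric]
      proof
        assume "(f ^^ n) u = b i + per k"
        then have "(f ^^ (j - i)) ((f ^^ n) u) = a + per (k0 + int l ^ (j - i) * k)"
          by (simp add: fn_per k0 per_add)
        then have "(f ^^ (j * Suc (n div j))) u = a + per (k0 + int l ^ (j - i) * k)"
          unfolding n[symmetric] funpow_add by simp
        then show False using neg u unfolding mem_ball by blast
      qed
    qed
    also have "1 + \<bar>Re ((f ^^ n) z) - Re (b i)\<bar> \<le> (1 + B) * (1 + \<bar>Re ((f ^^ n) z)\<bar>)"
    proof -
      have "1 + \<bar>Re ((f ^^ n) z) - Re (b i)\<bar> \<le> 1 + \<bar>Re ((f ^^ n) z)\<bar> + B" using B[OF i] by simp
      also have "\<dots> \<le> (1 + B) * (1 + \<bar>Re ((f ^^ n) z)\<bar>)"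
        using B0 by (simp add: algebra_simps)
      finally show ?thesis .
    qed
    finally show ?thesis using r landau_const_pos by (simp add: C_def divide_right_mono mult_left_mono mult.assoc)
  qed
  define A where "A = norm a0 + 4"
  \<comment> \<open>Beyond \<open>T\<close> the modulus of \<open>exp y\<close> is at least
    \<open>2 * l\<close>, so \<open>of_nat l - exp y\<close> keeps at least half of it.\<close>
  define T where "T = ln (2 * real l)"
  have A: "A \<ge> 0" by (simp add: A_def)
  have T: "T \<ge> 0" using l2 by (simp add: T_def)
  define K where "K = C * (1 + A + T) + 2 * C * (2 + A + l)"
  have "norm (deriv (f ^^ n) z) \<le> K" for n
  proof -
    define y where "y = (f ^^ n) z"
    define D where "D = norm (deriv (f ^^ n) z)"
    have yX: "y \<in> X" "f y \<in> X" unfolding y_def using z X_fn X_f by auto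
    have Ky: "Re y > - A" "Re (f y) > - A" using X_Re[OF yX(1)] X_Re[OF yX(2)] by (auto simp: A_def)
    have Kp: "0 \<le> C * (1 + A + T)" "0 \<le> 2 * C * (2 + A + l)" using C A T by auto
    show ?thesis
    proof (cases "Re y \<le> T")
      case True
      have "norm (deriv (f ^^ n) z) \<le> C * (1 + \<bar>Re y\<bar>)" using bound y_def by simp
      also have "\<dots> \<le> C * (1 + A + T)" using True Ky A T C by (intro mult_left_mono) auto
      finally show ?thesis using Kp by (simp add: K_def)
    next
      case False
      define E where "E = exp (Re y)"
      have "exp T = 2 * l" using l2 by (simp add: T_def)
      then have E2: "E \<ge> 2 * l" using False by (metis E_def exp_le_cancel_iff linear)
      have E1: "Re y \<le> E" "1 \<le> E" using exp_ge_add_one_self[of "Re y"] False T unfolding E_def by linarith+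
      have nE: "norm (of_nat l - exp y) \<ge> E / 2"
        using norm_triangle_ineq2[of "exp y" "of_nat l"] E2 by (simp add: E_def norm_minus_commute)
      have "\<bar>Re (f y)\<bar> \<le> A + l * E + E"
      proof -
        have "Re (f y) \<le> norm a0 + l * Re y + E"
          using complex_Re_le_cmod[of a0] abs_Re_le_cmod[of "exp y"] by (simp add: f_eq E_def)
        also have "l * Re y \<le> l * E" using E1 by (intro mult_left_mono) auto
        finally have "Re (f y) \<le> A + l * E + E" by (simp add: A_def)
        moreover have "0 \<le> l * E + E" using E1 by simp
        ultimately show ?thesis using Ky(2) A by linarith
      qed
      then have "1 + \<bar>Re (f y)\<bar> \<le> 1 + A + l * E + E" by simp
      also have "\<dots> \<le> (2 + A + l) * E"
        using mult_left_mono[OF E1(2) A] E1(2) by (simp add: algebra_simps)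
      finally have le: "1 + \<bar>Re (f y)\<bar> \<le> (2 + A + l) * E" .
      have "E / 2 * D \<le> norm (of_nat l - exp y) * D"
        using nE by (intro mult_right_mono) (auto simp: D_def)
      also have "\<dots> = norm (deriv (f ^^ Suc n) z)"
        unfolding deriv_fn_Suc' by (simp add: D_def y_def norm_mult)
      also have "\<dots> \<le> C * (1 + \<bar>Re (f y)\<bar>)" using bound[of "Suc n"] by (simp add: y_def)
      also have "\<dots> \<le> C * ((2 + A + l) * E)" using le C by (intro mult_left_mono) auto
      finally have "E * D \<le> E * (2 * C * (2 + A + l))" by (simp add: algebra_simps)
      then have "D \<le> 2 * C * (2 + A + l)" using E1(2) by (simp add: mult_le_cancel_left)
      then show ?thesis using Kp by (simp add: K_def D_def)
    qed
  qed
  moreover have "\<forall>\<^sub>F n in sequentially. norm (deriv (f ^^ n) z) > K"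
    using expansion[OF z] unfolding filterlim_at_top_dense by blast
  then obtain n where "norm (deriv (f ^^ n) z) > K" using eventually_happens by fastforce
  ultimately show False by (simp add: not_less[symmetric])
qed

end


section \<open>The Julia set\<close>

context lc_map
begin

text \<open>The region is convex and \<open>exp\<close> there stays within pi/4 of the direction
  \<open>\<theta>\<close>; a mean value argument for one real component of \<open>f\<close> along
  the segment gives expansion, not just injectivity.\<close>

lemma sector_expand:
  assumes T: "T \<le> Re u" "T \<le> Re u'" and I: "\<bar>Im u - \<theta>\<bar> \<le> pi/4" "\<bar>Im u' - \<theta>\<bar> \<le> pi/4"
  shows "norm (f u - f u') \<ge> (exp T / 2 - l) * norm (u - u')"
proof -
  define \<Delta> where "\<Delta> = u - u'"
  \<comment> \<open>Chosen so that the derivative of \<open>h\<close> is the squared length of the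
    segment times the component of the derivative of \<open>f\<close> in direction
    \<open>\<theta>\<close>.\<close>
  define K where "K = cnj \<Delta> * cis (- \<theta>)"
  define h where "h = (\<lambda>s::real. Re (K * f (u' + of_real s * \<Delta>)))"
  define h' where "h' = (\<lambda>s::real. Re (K * ((of_nat l - exp (u' + of_real s * \<Delta>)) * \<Delta>)))"
  have dh: "(h has_real_derivative h' s) (at s)" for s
  proof -
    have "((\<lambda>w. K * f (u' + w * \<Delta>)) has_field_derivative K * ((of_nat l - exp (u' + of_real s * \<Delta>)) * \<Delta>)) (at (of_real s))"
      by (rule DERIV_cmult) (rule DERIV_chain2[OF DERIV_f], auto intro!: derivative_eq_intros)
    then have "((\<lambda>x. K * f (u' + of_real x * \<Delta>)) has_vector_derivative K * ((of_nat l - exp (u' + of_real s * \<Delta>)) * \<Delta>)) (at s)"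
      by (rule has_vector_derivative_real_field)
    then have "((\<lambda>x. Re (K * f (u' + of_real x * \<Delta>))) has_vector_derivative Re (K * ((of_nat l - exp (u' + of_real s * \<Delta>)) * \<Delta>))) (at s)"
      by (rule bounded_linear.has_vector_derivative[OF bounded_linear_Re])
    then show ?thesis unfolding h_def h'_def has_real_derivative_iff_has_vector_derivative .
  qed
  obtain s where s: "0 < s" "s < 1" "h 1 - h 0 = (1 - 0) * h' s"
    using MVT2[of 0 1 h h'] dh by auto
  define \<zeta> where "\<zeta> = u' + of_real s * \<Delta>"
  have \<zeta>Re: "Re \<zeta> = (1 - s) * Re u' + s * Re u" and \<zeta>Im: "Im \<zeta> - \<theta> = (1 - s) * (Im u' - \<theta>) + s * (Im u - \<theta>)"
    by (simp_all add: \<zeta>_def \<Delta>_def algebra_simps)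
  have R: "T \<le> Re \<zeta>"
  proof -
    have "(1 - s) * T + s * T \<le> Re \<zeta>" unfolding \<zeta>Re using s T by (intro add_mono mult_left_mono) auto
    then show ?thesis by (simp add: algebra_simps)
  qed
  have "\<bar>Im \<zeta> - \<theta>\<bar> \<le> (1 - s) * \<bar>Im u' - \<theta>\<bar> + s * \<bar>Im u - \<theta>\<bar>"
    unfolding \<zeta>Im using abs_triangle_ineq[of "(1 - s) * (Im u' - \<theta>)" "s * (Im u - \<theta>)"] s by (simp add: abs_mult)
  also have "\<dots> \<le> (1 - s) * (pi/4) + s * (pi/4)" using s I by (intro add_mono mult_left_mono) auto
  also have "\<dots> = pi/4" by (simp add: field_simps)
  finally have I\<zeta>: "\<bar>Im \<zeta> - \<theta>\<bar> \<le> pi/4" .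
  have cs: "cos (Im \<zeta> - \<theta>) \<ge> 1/2"
  proof -
    have "cos (pi/3) \<le> cos \<bar>Im \<zeta> - \<theta>\<bar>"
    proof (rule cos_monotone_0_pi_le)
      show "\<bar>Im \<zeta> - \<theta>\<bar> \<le> pi/3" using I\<zeta> pi_gt_zero by argo
    qed auto
    then show ?thesis by (simp add: cos_60)
  qed
  have "h' s = (norm \<Delta>)\<^sup>2 * Re (cis (- \<theta>) * (of_nat l - exp \<zeta>))"
  proof -
    have aux: "Re (of_real r * w) = r * Re w" for r w by simp
    have "K * ((of_nat l - exp \<zeta>) * \<Delta>) = (\<Delta> * cnj \<Delta>) * (cis (- \<theta>) * (of_nat l - exp \<zeta>))"
      by (simp add: K_def algebra_simps)
    also have "\<Delta> * cnj \<Delta> = of_real ((norm \<Delta>)\<^sup>2)" by (rule complex_norm_square[symmetric])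
    finally show ?thesis unfolding h'_def \<zeta>_def[symmetric] by (simp only: aux)
  qed
  also have "Re (cis (- \<theta>) * (of_nat l - exp \<zeta>)) \<le> l - exp T / 2"
  proof -
    have "Re (cis (- \<theta>) * exp \<zeta>) = exp (Re \<zeta>) * cos (Im \<zeta> - \<theta>)"
      by (simp add: Re_exp Im_exp cos_diff algebra_simps)
    also have "\<dots> \<ge> exp T * (1/2)" using R cs by (intro mult_mono) auto
    finally have "Re (cis (- \<theta>) * exp \<zeta>) \<ge> exp T / 2" by simp
    moreover have "Re (cis (- \<theta>) * of_nat l) \<le> l"
      using mult_right_mono[OF cos_le_one[of \<theta>], of "real l"] by simp
    ultimately show ?thesis by (simp add: right_diff_distrib)
  qed
  finally have "h' s \<le> (norm \<Delta>)\<^sup>2 * (l - exp T / 2)" by (simp add: mult_left_mono)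
  then have "(norm \<Delta>)\<^sup>2 * (exp T / 2 - l) \<le> h 0 - h 1" using s(3) by (simp add: algebra_simps)
  also have "\<dots> \<le> norm (K * (f u' - f u))"
  proof -
    have "h 0 - h 1 = Re (K * (f u' - f u))" by (simp add: h_def \<Delta>_def algebra_simps)
    then show ?thesis by (simp only: complex_Re_le_cmod)
  qed
  also have "\<dots> = norm \<Delta> * norm (f u - f u')" by (simp add: K_def norm_mult norm_minus_commute)
  finally have le: "norm \<Delta> * (norm \<Delta> * (exp T / 2 - l)) \<le> norm \<Delta> * norm (f u - f u')"
    by (simp add: power2_eq_square mult.assoc)
  show ?thesis
  proof (cases "\<Delta> = 0")
    case False
    then show ?thesis using le by (simp add: mult_le_cancel_left \<Delta>_def mult.commute)
  qed (simp add: \<Delta>_def)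
qed

lemma sector_ball:
  assumes T: "exp (Re z - 1/4) / 2 - l > 0"
  shows "ball (f z) ((exp (Re z - 1/4) / 2 - l) / 4) \<subseteq> f ` ball z (1/4)"
proof -
  let ?T = "Re z - 1/4"
  have near: "?T \<le> Re u \<and> \<bar>Im u - Im z\<bar> \<le> pi/4" if "u \<in> cball z (1/4)" for u
  proof -
    have "norm (z - u) \<le> 1/4" using that by (simp add: dist_norm)
    then have "\<bar>Re z - Re u\<bar> \<le> 1/4" "\<bar>Im z - Im u\<bar> \<le> 1/4"
      using abs_Re_le_cmod[of "z - u"] abs_Im_le_cmod[of "z - u"] by auto
    then show ?thesis using pi_ge_two by argo
  qed
  have e: "norm (f u - f u') \<ge> (exp ?T / 2 - l) * norm (u - u')" if "u \<in> cball z (1/4)" "u' \<in> cball z (1/4)" for u u'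
    using near[OF that(1)] near[OF that(2)] by (intro sector_expand[where \<theta> = "Im z"]) auto
  have inj: "inj_on f (ball z (1/4))"
  proof (rule inj_onI)
    fix u u' assume "u \<in> ball z (1/4)" "u' \<in> ball z (1/4)" "f u = f u'"
    then have "(exp ?T / 2 - l) * norm (u - u') \<le> 0" using e[of u u'] by auto
    then show "u = u'" using T by (simp add: mult_le_0_iff)
  qed
  show ?thesis
  proof (rule ball_subset_open_map_image)
    show "continuous_on (closure (ball z (1/4))) f" by (intro holomorphic_on_imp_continuous_on hol_f)
    show "open (f ` interior (ball z (1/4)))" using inj by (auto intro!: open_mapping_thm3 hol_f)
    show "(exp ?T / 2 - l) / 4 \<le> norm (f u - f z)" if "u \<in> frontier (ball z (1/4))" for u
    proof -
      have "norm (u - z) = 1/4" using that by (auto simp: frontier_ball dist_norm norm_minus_commute)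
      moreover have "(exp ?T / 2 - l) * norm (u - z) \<le> norm (f u - f z)"
        using that by (intro e) (auto simp: frontier_ball)
      ultimately show ?thesis by (simp only: times_divide_eq_right mult_1_right)
    qed
  qed (use T in auto)
qed

text \<open>The point is found by shadowing an approximate orbit. The term \<open>real l ^ m\<close>
  in the bound later absorbs the drift of a translate: \<open>per q\<close> becomes
  \<open>per (int l ^ m * q)\<close> after \<open>m\<close> steps.\<close>

lemma fast_escaping_point:
  "\<exists>a. \<forall>C>0. \<forall>\<^sub>F m in sequentially. exp (Re ((f ^^ m) a)) > C * (1 + norm ((f ^^ m) a) + real l ^ m)"
proof -
  define x0 where "x0 = 100 + 4 * real l + 2 * norm a0"
  \<comment> \<open>On these horizontal lines \<open>- exp z\<close> is positive, so the real part
    grows exponentially at each step; \<open>|Im z| \<le> Re z\<close> keeps the modulus comparable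
    with the real part.\<close>
  define good where "good = (\<lambda>z. Re z \<ge> x0 \<and> (\<exists>k::int. Im z = pi + 2 * pi * k) \<and> \<bar>Im z\<bar> \<le> Re z)"
  have step: "\<exists>z'. good z' \<and> exp (Re z) \<le> Re z' \<and> cball z' (1/4) \<subseteq> f ` ball z (1/4)" if z: "good z" for z
  proof -
    obtain k where k: "Im z = pi + 2 * pi * of_int k" using z by (auto simp: good_def)
    have x: "Re z \<ge> 100 + 4 * real l + 2 * norm a0" using z by (simp add: good_def x0_def)
    have ez: "exp z = - of_real (exp (Re z))"
    proof -
      have "z = of_real (Re z) + \<i> * of_real pi + per k"
        by (rule complex_eqI) (simp_all add: k)
      then have "exp z = exp (of_real (Re z) + \<i> * of_real pi)" by (metis exp_per)
      then show ?thesis by (simp add: exp_add exp_pi_i' exp_of_real)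
    qed
    have e1: "exp (Re z) \<ge> 1 + Re z" by (rule exp_ge_add_one_self)
    have Ref: "Re (f z) = Re a0 + l * Re z + exp (Re z)" and Imf: "Im (f z) = Im a0 + l * Im z"
      by (simp_all add: f_eq ez)
    have a0: "\<bar>Re a0\<bar> \<le> norm a0" "\<bar>Im a0\<bar> \<le> norm a0" by (rule abs_Re_le_cmod abs_Im_le_cmod)+
    define j where "j = \<lfloor>(Im (f z) - pi) / (2 * pi)\<rfloor>"
    have j: "pi + 2 * pi * j \<le> Im (f z)" "Im (f z) \<le> pi + 2 * pi * j + 2 * pi"
    proof -
      have "of_int j \<le> (Im (f z) - pi) / (2 * pi)" "(Im (f z) - pi) / (2 * pi) \<le> of_int j + 1"
        unfolding j_def by linarith+
      then show "pi + 2 * pi * j \<le> Im (f z)" "Im (f z) \<le> pi + 2 * pi * j + 2 * pi"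
        by (simp_all add: field_simps)
    qed
    \<comment> \<open>The point on the next good line at or below \<open>f z\<close>; the
      displacement is at most 2 pi.\<close>
    define z' where "z' = Complex (Re (f z)) (pi + 2 * pi * j)"
    have lx: "1 * Re z \<le> l * Re z" using x l2 norm_ge_zero[of a0] by (intro mult_right_mono) (auto simp del: norm_ge_zero)
    have Rez': "Re z' = Re (f z)" "Im z' = pi + 2 * pi * j" by (simp_all add: z'_def)
    have big: "exp (Re z) \<le> Re z'"
      using Ref a0 lx x unfolding Rez' by linarith
    have "\<bar>Im z'\<bar> \<le> \<bar>Im (f z)\<bar> + 2 * pi" using j unfolding Rez' by linarith
    also have "\<bar>Im (f z)\<bar> \<le> norm a0 + l * \<bar>Im z\<bar>" unfolding Imf using a0 abs_triangle_ineq[of "Im a0" "l * Im z"] by (simp add: abs_mult)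
    also have "l * \<bar>Im z\<bar> \<le> l * Re z" using z by (intro mult_left_mono) (auto simp: good_def)
    finally have "\<bar>Im z'\<bar> \<le> Re z'" using Ref a0 e1 x pi_less_4 unfolding Rez' by linarith
    moreover have "Re z' \<ge> x0" using big e1 x unfolding x0_def by linarith
    ultimately have g: "good z'" unfolding good_def using Rez'(2) by blast
    \<comment> \<open>After division by 4 the covered disc has radius at least 10, which exceeds the
      displacement 2 pi plus the radius 1/4.\<close>
    have T: "exp (Re z - 1/4) / 2 - l \<ge> 40"
      using exp_ge_add_one_self[of "Re z - 1/4"] x norm_ge_zero[of a0] of_nat_0_le_iff[of l, where ?'a = real] by argo
    have "cball z' (1/4) \<subseteq> ball (f z) ((exp (Re z - 1/4) / 2 - l) / 4)"
    proof
      fix w assume w: "w \<in> cball z' (1/4)"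
      have "dist (f z) z' \<le> \<bar>Re (f z - z')\<bar> + \<bar>Im (f z - z')\<bar>" unfolding dist_norm by (rule cmod_le)
      also have "\<dots> \<le> 2 * pi" using j Rez' by simp
      finally have "dist (f z) w < 10" using w dist_triangle[of "f z" w z'] pi_less_4 by simp
      then show "w \<in> ball (f z) ((exp (Re z - 1/4) / 2 - l) / 4)" using T by simp
    qed
    also have "\<dots> \<subseteq> f ` ball z (1/4)" using T by (intro sector_ball) auto
    finally show ?thesis using g big by blast
  qed
  define z0 where "z0 = Complex x0 pi"
  have "\<exists>k::int. pi = pi + 2 * pi * k" by (rule exI[of _ 0]) simp
  moreover have "pi \<le> x0" unfolding x0_def using pi_less_4 by (simp add: add_increasing2)
  ultimately have g0: "good z0" by (simp add: good_def z0_def)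
  obtain zs where zs: "zs 0 = z0" "\<And>n. good (zs n)" 
    "\<And>n. exp (Re (zs n)) \<le> Re (zs (Suc n)) \<and> cball (zs (Suc n)) (1/4) \<subseteq> f ` ball (zs n) (1/4)"
  proof -
    have "\<exists>F. (\<forall>n. good (F n)) \<and> (\<forall>n. exp (Re (F n)) \<le> Re (F (Suc n)) \<and> cball (F (Suc n)) (1/4) \<subseteq> f ` ball (F n) (1/4)) \<and> F 0 = z0"
    proof -
      define F where "F = rec_nat z0 (\<lambda>n z. SOME z'. good z' \<and> exp (Re z) \<le> Re z' \<and> cball z' (1/4) \<subseteq> f ` ball z (1/4))"
      have FS: "F (Suc n) = (SOME z'. good z' \<and> exp (Re (F n)) \<le> Re z' \<and> cball z' (1/4) \<subseteq> f ` ball (F n) (1/4))" for n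
        by (simp add: F_def)
      have F0: "F 0 = z0" by (simp add: F_def)
      have gF: "good (F n)" for n
      proof (induction n)
        case 0 then show ?case using F0 g0 by simp
      next
        case (Suc n)
        then show ?case unfolding FS using someI_ex[OF step[OF Suc]] by blast
      qed
      have "exp (Re (F n)) \<le> Re (F (Suc n)) \<and> cball (F (Suc n)) (1/4) \<subseteq> f ` ball (F n) (1/4)" for n
        unfolding FS using someI_ex[OF step[OF gF[of n]]] by blast
      then show ?thesis using gF F0 by blast
    qed
    then show ?thesis using that by blast
  qed
  \<comment> \<open>Points whose first \<open>n\<close> iterates follow \<open>zs\<close>; these
    nested compact sets have a common point, a true orbit shadowing the sequence.\<close>
  define Q where "Q = (\<lambda>n. {u. \<forall>i\<le>n. (f ^^ i) u \<in> cball (zs i) (1/4)})"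
  have ex: "\<exists>u. (f ^^ n) u = w \<and> (\<forall>i\<le>n. (f ^^ i) u \<in> cball (zs i) (1/4))" if "w \<in> cball (zs n) (1/4)" for n w
    using that
  proof (induction n arbitrary: w)
    case 0
    then show ?case by (intro exI[of _ w]) auto
  next
    case (Suc n)
    then obtain w' where w': "w' \<in> ball (zs n) (1/4)" "w = f w'" using zs(3)[of n] by blast
    then obtain u where "(f ^^ n) u = w'" "\<forall>i\<le>n. (f ^^ i) u \<in> cball (zs i) (1/4)"
      using Suc.IH[of w'] by auto
    then show ?case using Suc.prems w' by (intro exI[of _ u]) (auto simp: le_Suc_eq)
  qed
  have "\<Inter> (range Q) \<noteq> {}"
  proof (rule compact_nest)
    fix n
    have "Q n = (\<Inter>i\<le>n. (f ^^ i) -` cball (zs i) (1/4))" by (auto simp: Q_def)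
    moreover have "closed ((f ^^ i) -` cball (zs i) (1/4))" for i
      by (intro closed_vimage closed_cball holomorphic_on_imp_continuous_on hol_fn)
    ultimately have "closed (Q n)" by auto
    moreover have "Q n \<subseteq> cball (zs 0) (1/4)" unfolding Q_def by (auto dest: spec[of _ 0])
    then have "bounded (Q n)" using bounded_cball bounded_subset by blast
    ultimately show "compact (Q n)" by (simp add: compact_eq_bounded_closed)
    show "Q n \<noteq> {}" using ex[of "zs n" n] by (auto simp: Q_def)
  qed (auto simp: Q_def)
  then obtain a where a: "\<And>n. a \<in> Q n" by auto
  then have fa: "(f ^^ m) a \<in> cball (zs m) (1/4)" for m by (auto simp: Q_def)
  define x where "x = (\<lambda>m. Re (zs m))"
  have xm: "x m \<ge> real m" for m
  proof (induction m)
    case 0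
    have "x0 \<ge> 0" by (simp add: x0_def)
    then show ?case using zs(2)[of 0] by (simp add: good_def x_def)
  next
    case (Suc m)
    have "real (Suc m) = 1 + real m" by simp
    then show ?case using Suc zs(3)[of m] exp_ge_add_one_self[of "x m"] unfolding x_def by linarith
  qed
  have xe: "x (Suc m) \<ge> exp (real m)" for m
    using zs(3)[of m] xm[of m] by (simp add: x_def) (meson exp_le_cancel_iff order.trans)
  have low: "exp (Re ((f ^^ m) a)) \<ge> exp (x m - 1/4)" for m
    using fa[of m] abs_Re_le_cmod[of "zs m - (f ^^ m) a"] by (simp add: dist_norm x_def)
  have up: "norm ((f ^^ m) a) \<le> 2 * x m + 1" for m
  proof -
    have "norm ((f ^^ m) a) \<le> norm (zs m) + 1/4"
      using fa[of m] norm_triangle_sub[of "(f ^^ m) a" "zs m"] by (simp add: dist_norm norm_minus_commute)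
    also have "norm (zs m) \<le> \<bar>Re (zs m)\<bar> + \<bar>Im (zs m)\<bar>" by (rule cmod_le)
    also have "\<dots> \<le> 2 * x m" using zs(2)[of m] xm[of m] by (auto simp: good_def x_def)
    finally show ?thesis by simp
  qed
  have xtop: "filterlim x at_top sequentially"
    by (rule filterlim_at_top_mono[OF filterlim_real_sequentially]) (use xm in auto)
  define K where "K = ln (real l)"
  have K: "K > 0" using l2 by (simp add: K_def)
  have lm: "real l ^ m = exp (K * m)" for m
    using l2 by (simp add: K_def exp_of_nat2_mult)
  \<comment> \<open>The centres satisfy \<open>x (Suc m) \<ge> exp m\<close>, so
    \<open>exp (x (Suc m))\<close> is doubly exponential in \<open>m\<close> and beats every power
    \<open>l ^ m\<close>.\<close>
  have ev1: "\<forall>\<^sub>F m in sequentially. K * real (Suc m) \<le> exp (real m) / 2"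
    using K by real_asymp
  have ev2: "\<forall>\<^sub>F m in sequentially. real l ^ Suc m \<le> exp (x (Suc m) / 2)"
    using ev1
  proof eventually_elim
    case (elim m)
    then show ?case unfolding lm using xe[of m] by simp
  qed
  then have ev3: "\<forall>\<^sub>F m in sequentially. real l ^ m \<le> exp (x m / 2)"
    by (subst (asm) eventually_sequentially_Suc)
  show ?thesis
  proof (intro exI[of _ a] allI impI)
    fix C :: real assume C: "C > 0"
    have "\<forall>\<^sub>F y in at_top. exp (y - 1/4) > C * (2 + 2 * y + exp (y / 2))" using C by real_asymp
    then have "\<forall>\<^sub>F m in sequentially. exp (x m - 1/4) > C * (2 + 2 * x m + exp (x m / 2))"
      using xtop by (rule eventually_compose_filterlim)
    with ev3 show "\<forall>\<^sub>F m in sequentially. exp (Re ((f ^^ m) a)) > C * (1 + norm ((f ^^ m) a) + real l ^ m)"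
    proof eventually_elim
      case (elim m)
      have "C * (1 + norm ((f ^^ m) a) + real l ^ m) \<le> C * (2 + 2 * x m + exp (x m / 2))"
        using elim(1) up[of m] C by (intro mult_left_mono) auto
      then show ?case using elim(2) low[of m] by linarith
    qed
  qed
qed

end


text \<open>A sequence of iterates may repeat itself or come in any order. One index recurs
  infinitely often, which gives a constant subsequence, or the indices tend to infinity and the full
  sequence of iterates decides.\<close>

lemma nat_sequence_cases:
  fixes N :: "nat \<Rightarrow> nat"
  shows "(\<exists>n. \<exists>r :: nat \<Rightarrow> nat. strict_mono r \<and> (\<forall>i. N (r i) = n)) \<or> filterlim N at_top sequentially"
proof (cases "\<exists>n. infinite {i. N i = n}")
  case True
  then obtain n where n: "infinite {i. N i = n}" by blast
  have "N (enumerate {i. N i = n} i) = n" for i using enumerate_in_set[OF n, of i] by simp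
  then show ?thesis using strict_mono_enumerate[OF n] by blast
next
  case False
  have "\<forall>\<^sub>F i in sequentially. Z \<le> N i" for Z
  proof -
    have "{i. N i < Z} = (\<Union>n<Z. {i. N i = n})" by auto
    then have "finite {i. N i < Z}" using False by auto
    then show ?thesis unfolding cofinite_eq_sequentially[symmetric] eventually_cofinite by (simp add: not_le)
  qed
  then show ?thesis unfolding filterlim_at_top by blast
qed

lemma normal_on_iterates:
  assumes hol: "\<And>n. (g ^^ n) holomorphic_on U"
    and lim: "(\<exists>h. h holomorphic_on U \<and> uniform_limit U (\<lambda>n. g ^^ n) h sequentially) \<or>
           (\<forall>B::real. \<forall>\<^sub>F n in sequentially. \<forall>z\<in>U. B < cmod ((g ^^ n) z))"
  shows "normal_on U (range (\<lambda>n. g ^^ n))"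
  unfolding normal_on_def
proof (intro allI impI)
  fix s :: "nat \<Rightarrow> complex \<Rightarrow> complex"
  assume "range s \<subseteq> range (\<lambda>n. g ^^ n)"
  then have "\<forall>i. \<exists>n. s i = g ^^ n" by blast
  then obtain N where N: "\<And>i. s i = g ^^ (N i)" by metis
  show "\<exists>r. strict_mono r \<and>
         ((\<exists>h. h holomorphic_on U \<and>
            (\<forall>K. compact K \<and> K \<subseteq> U \<longrightarrow> uniform_limit K (\<lambda>n. s (r n)) h sequentially)) \<or>
          (\<forall>K. compact K \<and> K \<subseteq> U \<longrightarrow>
            (\<forall>B::real. \<forall>\<^sub>F n in sequentially. \<forall>z\<in>K. B < cmod (s (r n) z))))"
    using nat_sequence_cases[of N]
  proof (elim disjE exE conjE)
    fix n r assume "strict_mono (r :: nat \<Rightarrow> nat)" "\<forall>i. N (r i) = n"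
    then show ?thesis
      by (intro exI[of _ r] conjI disjI1 exI[of _ "g ^^ n"]) (auto simp: N hol uniform_limit_const)
  next
    assume top: "filterlim N at_top sequentially"
    show ?thesis
    proof (intro exI[of _ "\<lambda>i. i"] conjI)
      show "strict_mono (\<lambda>i::nat. i)" by (simp add: strict_mono_def)
      show "(\<exists>h. h holomorphic_on U \<and>
            (\<forall>K. compact K \<and> K \<subseteq> U \<longrightarrow> uniform_limit K s h sequentially)) \<or>
          (\<forall>K. compact K \<and> K \<subseteq> U \<longrightarrow>
            (\<forall>B::real. \<forall>\<^sub>F n in sequentially. \<forall>z\<in>K. B < cmod (s n z)))"
        using lim
      proof
        assume "\<exists>h. h holomorphic_on U \<and> uniform_limit U (\<lambda>n. g ^^ n) h sequentially"
        then obtain h where h: "h holomorphic_on U" "uniform_limit U (\<lambda>n. g ^^ n) h sequentially" by blast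
        have "uniform_limit U s h sequentially"
          unfolding uniform_limit_iff N
        proof (intro allI impI)
          fix e :: real assume "e > 0"
          with h(2) have "\<forall>\<^sub>F n in sequentially. \<forall>x\<in>U. dist ((g ^^ n) x) (h x) < e" by (simp add: uniform_limit_iff)
          then show "\<forall>\<^sub>F n in sequentially. \<forall>x\<in>U. dist ((g ^^ N n) x) (h x) < e"
            using top by (rule eventually_compose_filterlim)
        qed
        then show ?thesis using h(1) uniform_limit_on_subset by blast
      next
        assume inf: "\<forall>B::real. \<forall>\<^sub>F n in sequentially. \<forall>z\<in>U. B < cmod ((g ^^ n) z)"
        have "\<forall>\<^sub>F n in sequentially. \<forall>z\<in>U. B < cmod (s n z)" for B :: real
          unfolding N using spec[OF inf] top by (rule eventually_compose_filterlim)
        then show ?thesis by (intro disjI2 allI impI) (rule eventually_mono, assumption, blast)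
      qed
    qed
  qed
qed

section \<open>Normality on the basins and its failure on \<open>X\<close>\<close>

context lc_trap
begin

lemma eventually_shift: "(\<forall>\<^sub>F i in sequentially. Q (i + m)) \<Longrightarrow> (\<forall>\<^sub>F i in sequentially. Q i)" for m :: nat
  by (simp add: eventually_sequentially_seg)

lemma fatou_left_half_plane:
  assumes "Re ((f ^^ m) z) \<le> - norm a0 - 4"
  shows "z \<notin> Julia_set f"
proof -
  have "isCont (f ^^ m) z" using DERIV_fn DERIV_isCont by blast
  then obtain e where e: "e > 0" "\<And>u. dist u z < e \<Longrightarrow> dist ((f ^^ m) u) ((f ^^ m) z) < 1"
    unfolding continuous_at_eps_delta by (metis zero_less_one)
  have R: "Re ((f ^^ (i + m)) u) \<le> - norm a0 - 3 - real i" if "u \<in> ball z e" for u i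
  proof (induction i)
    case 0
    have "dist ((f ^^ m) u) ((f ^^ m) z) < 1" using e(2)[of u] that by (simp add: dist_commute)
    then have "\<bar>Re ((f ^^ m) u - (f ^^ m) z)\<bar> < 1"
      unfolding dist_norm using abs_Re_le_cmod order.strict_trans1 by blast
    then show ?case using assms by simp
  next
    case (Suc i)
    have "Re (f ((f ^^ (i + m)) u)) \<le> Re ((f ^^ (i + m)) u) - 1"
      using Suc by (intro left_half_plane) simp
    then show ?case using Suc by simp
  qed
  have "normal_on (ball z e) (range (\<lambda>n. f ^^ n))"
  proof (rule normal_on_iterates[OF hol_fn], intro disjI2 allI)
    fix B :: real
    have "\<forall>\<^sub>F i in sequentially. \<forall>u\<in>ball z e. B < cmod ((f ^^ (i + m)) u)"
      using eventually_ge_at_top[of "nat \<lceil>B\<rceil>"]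
    proof eventually_elim
      case (elim i)
      then have iB: "real i \<ge> B" by linarith
      show ?case
      proof
        fix u assume "u \<in> ball z e"
        then have "Re ((f ^^ (i + m)) u) \<le> - norm a0 - 3 - real i" by (rule R)
        moreover have "- cmod ((f ^^ (i + m)) u) \<le> Re ((f ^^ (i + m)) u)"
          using abs_Re_le_cmod[of "(f ^^ (i + m)) u"] by linarith
        ultimately show "B < cmod ((f ^^ (i + m)) u)" using iB norm_ge_zero[of a0] by linarith
      qed
    qed
    then show "\<forall>\<^sub>F n in sequentially. \<forall>u\<in>ball z e. B < cmod ((f ^^ n) u)"
      by (rule eventually_shift)
  qed
  then show ?thesis using e(1) unfolding Julia_set_def by (auto intro!: exI[of _ "ball z e"])
qed

text \<open>In the plane only the disc around \<open>p\<close> itself has a finite limit. A disc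
  around \<open>p + per k\<close> with nonzero \<open>k\<close> travels along
  \<open>p + per (int l ^ i * k)\<close> and escapes, so convergence to infinity has to count as
  normal.\<close>

lemma fatou_basin:
  assumes "dist (p + per k) ((f ^^ m) z) \<le> \<epsilon>"
  shows "z \<notin> Julia_set f"
proof -
  have b: "0 < \<epsilon>" "\<epsilon> \<le> 1" "0 < \<mu>" "\<mu> < 1" "0 < d0" "d0 \<le> 1" using bas by (auto simp: basin_def)
  have "isCont (f ^^ m) z" using DERIV_fn DERIV_isCont by blast
  then obtain e where e: "e > 0" "\<And>u. dist u z < e \<Longrightarrow> dist ((f ^^ m) u) ((f ^^ m) z) < d0"
    using b(5) unfolding continuous_at_eps_delta by blast
  have R: "dist (p + per (int l ^ i * k)) ((f ^^ (i + m)) u) < \<mu> ^ i * (\<epsilon> + d0)" if "u \<in> ball z e" for u i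
  proof (induction i)
    case 0
    have "dist ((f ^^ m) z) ((f ^^ m) u) < d0" using e(2)[of u] that by (simp add: dist_commute)
    then show ?case using assms dist_triangle[of "p + per k" "(f ^^ m) u" "(f ^^ m) z"] by simp
  next
    case (Suc i)
    have "\<mu> ^ i * (\<epsilon> + d0) \<le> 1 * (\<epsilon> + d0)" using b by (intro mult_right_mono power_le_one) auto
    then have "dist (p + per (int l * (int l ^ i * k))) (f ((f ^^ (i + m)) u)) \<le> \<mu> * dist (p + per (int l ^ i * k)) ((f ^^ (i + m)) u)"
      using Suc by (intro basin_per[OF bas]) simp
    also have "\<dots> < \<mu> * (\<mu> ^ i * (\<epsilon> + d0))" using Suc b by simp
    finally show ?case by (simp add: mult.assoc)
  qed
  have "normal_on (ball z e) (range (\<lambda>n. f ^^ n))"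
  proof (rule normal_on_iterates[OF hol_fn], cases "k = 0")
    case True
    have "uniform_limit (ball z e) (\<lambda>n. f ^^ n) (\<lambda>_. p) sequentially"
      unfolding uniform_limit_iff
    proof (intro allI impI)
      fix x :: real assume x: "x > 0"
      have "(\<lambda>i. \<mu> ^ i * (\<epsilon> + d0)) \<longlonglongrightarrow> 0 * (\<epsilon> + d0)"
        using b by (intro tendsto_intros LIMSEQ_power_zero) auto
      then have "\<forall>\<^sub>F i in sequentially. \<mu> ^ i * (\<epsilon> + d0) < x" using x by (intro order_tendstoD) auto
      then have "\<forall>\<^sub>F i in sequentially. \<forall>u\<in>ball z e. dist ((f ^^ (i + m)) u) p < x"
      proof eventually_elim
        case (elim i)
        show ?case
        proof
          fix u assume "u \<in> ball z e"
          then show "dist ((f ^^ (i + m)) u) p < x" using R[of u i] True elim by (simp add: dist_commute)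
        qed
      qed
      then show "\<forall>\<^sub>F n in sequentially. \<forall>u\<in>ball z e. dist ((f ^^ n) u) p < x"
        by (rule eventually_shift)
    qed
    then show "(\<exists>h. h holomorphic_on ball z e \<and> uniform_limit (ball z e) (\<lambda>n. f ^^ n) h sequentially) \<or>
           (\<forall>B::real. \<forall>\<^sub>F n in sequentially. \<forall>u\<in>ball z e. B < cmod ((f ^^ n) u))"
      by (intro disjI1 exI[of _ "\<lambda>_. p"]) auto
  next
    case False
    have "\<forall>\<^sub>F n in sequentially. \<forall>u\<in>ball z e. B < cmod ((f ^^ n) u)" for B :: real
    proof (rule eventually_shift[of _ m])
      show "\<forall>\<^sub>F i in sequentially. \<forall>u\<in>ball z e. B < cmod ((f ^^ (i + m)) u)"
        using eventually_ge_at_top[of "nat \<lceil>B + norm p + 2\<rceil>"]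
      proof eventually_elim
        case (elim i)
        then have iB: "real i \<ge> B + norm p + 2" by linarith
        show ?case
        proof
          fix u assume u: "u \<in> ball z e"
          have "1 \<le> \<bar>k\<bar>" using False by simp
          then have "(1::real) \<le> \<bar>of_int k\<bar>" by linarith
          moreover have "real i < real l ^ i"
          proof -
            have "real i < 2 ^ i" by (rule of_nat_less_two_power)
            also have "(2::real) ^ i \<le> real l ^ i" using l2 by (intro power_mono) auto
            finally show ?thesis .
          qed
          ultimately have "real i * 1 \<le> real l ^ i * \<bar>of_int k\<bar>" by (intro mult_mono) auto
          then have "real i \<le> \<bar>real_of_int (int l ^ i * k)\<bar>" by (simp add: abs_mult)
          moreover have "1 * \<bar>real_of_int (int l ^ i * k)\<bar> \<le> 2 * pi * \<bar>real_of_int (int l ^ i * k)\<bar>"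
            using pi_ge_two by (intro mult_right_mono) auto
          ultimately have 1: "real i \<le> norm (per (int l ^ i * k))" unfolding norm_per by simp
          have "\<mu> ^ i * (\<epsilon> + d0) \<le> 1 * (\<epsilon> + d0)" using b by (intro mult_right_mono power_le_one) auto
          with R[OF u, of i] have "dist (p + per (int l ^ i * k)) ((f ^^ (i + m)) u) < 1 * (\<epsilon> + d0)"
            by (rule order.strict_trans2)
          then have 2: "dist (p + per (int l ^ i * k)) ((f ^^ (i + m)) u) < 2" using b by simp
          have "norm (per (int l ^ i * k)) \<le> norm (p + per (int l ^ i * k) - (f ^^ (i + m)) u) + norm ((f ^^ (i + m)) u) + norm p"
            using norm_triangle_ineq4[of "p + per (int l ^ i * k)" p]
              norm_triangle_sub[of "p + per (int l ^ i * k)" "(f ^^ (i + m)) u"] by simp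
          then show "B < cmod ((f ^^ (i + m)) u)" using 1 2 iB unfolding dist_norm by linarith
        qed
      qed
    qed
    then show "(\<exists>h. h holomorphic_on ball z e \<and> uniform_limit (ball z e) (\<lambda>n. f ^^ n) h sequentially) \<or>
           (\<forall>B::real. \<forall>\<^sub>F n in sequentially. \<forall>u\<in>ball z e. B < cmod ((f ^^ n) u))" by blast
  qed
  then show ?thesis using e(1) unfolding Julia_set_def by (auto intro!: exI[of _ "ball z e"])
qed

lemma Julia_subset_X: "Julia_set f \<subseteq> X"
proof (rule ccontr)
  assume "\<not> ?thesis"
  then obtain z where z: "z \<in> Julia_set f" "z \<notin> X" by blast
  then obtain n where "(f ^^ n) z \<in> P" by (auto simp: X_def)
  then obtain i where "(f ^^ i) ((f ^^ n) z) \<in> P0 \<epsilon>" using PP0 by blast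
  then have "(f ^^ (i + n)) z \<in> P0 \<epsilon>" by (simp add: funpow_add)
  then show False using fatou_left_half_plane[of "i + n" z] fatou_basin[of _ "i + n" z] z(1) by (auto simp: P0_def)
qed

text \<open>A holomorphic limit along a subsequence would bound the derivatives at \<open>z\<close>
  by Cauchy's inequality, against \<open>expansion\<close>. So infinity is the only possible
  limit.\<close>

lemma X_normal_imp_escape:
  assumes z: "z \<in> X" and norm: "normal_on U (range (\<lambda>n. f ^^ n))" and r: "r > 0" "cball z r \<subseteq> U"
  shows "\<forall>\<^sub>F n in sequentially. \<forall>u\<in>cball z r. B < cmod ((f ^^ n) u)"
proof (rule ccontr)
  assume neg: "\<not> ?thesis"
  \<comment> \<open>The times at which the bound fails; normality is applied to the iterates at
    these times.\<close>
  define S where "S = {n. \<not> (\<forall>u\<in>cball z r. B < cmod ((f ^^ n) u))}"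
  have infS: "infinite S"
    using neg unfolding S_def cofinite_eq_sequentially[symmetric] eventually_cofinite .
  define N where "N = enumerate S"
  have N: "strict_mono N" "\<And>i. N i \<in> S"
    unfolding N_def using infS strict_mono_enumerate enumerate_in_set by auto
  have "range (\<lambda>i. f ^^ (N i)) \<subseteq> range (\<lambda>n. f ^^ n)" by auto
  then obtain s where s: "strict_mono s" and
    "(\<exists>h. h holomorphic_on U \<and>
            (\<forall>K. compact K \<and> K \<subseteq> U \<longrightarrow> uniform_limit K (\<lambda>n. f ^^ (N (s n))) h sequentially)) \<or>
          (\<forall>K. compact K \<and> K \<subseteq> U \<longrightarrow>
            (\<forall>B::real. \<forall>\<^sub>F n in sequentially. \<forall>z\<in>K. B < cmod ((f ^^ (N (s n))) z)))"
    using norm unfolding normal_on_def by blast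
  then show False
  proof (elim disjE exE conjE)
    fix h assume h: "h holomorphic_on U" "\<forall>K. compact K \<and> K \<subseteq> U \<longrightarrow> uniform_limit K (\<lambda>n. f ^^ (N (s n))) h sequentially"
    have ul: "uniform_limit (cball z r) (\<lambda>n. f ^^ (N (s n))) h sequentially" using h(2) r by auto
    have "compact (h ` cball z r)"
      using h(1) r(2) by (intro compact_continuous_image holomorphic_on_imp_continuous_on holomorphic_on_subset[OF h(1)]) auto
    then obtain H where H: "\<And>u. u \<in> cball z r \<Longrightarrow> norm (h u) \<le> H" using compact_imp_bounded bounded_iff by (metis imageI)
    have "\<forall>\<^sub>F n in sequentially. \<forall>u\<in>cball z r. dist ((f ^^ (N (s n))) u) (h u) < 1"
      using ul by (auto simp: uniform_limit_iff)
    then have ev: "\<forall>\<^sub>F n in sequentially. norm (deriv (f ^^ (N (s n))) z) \<le> (H + 1) / r"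
    proof eventually_elim
      case (elim n)
      have "norm ((deriv ^^ 1) (f ^^ (N (s n))) z) \<le> fact 1 * (H + 1) / r ^ 1"
      proof (rule Cauchy_inequality[OF hol_fn continuous_fn r(1)])
        fix u assume "norm (z - u) = r"
        then have u: "u \<in> cball z r" by (simp add: dist_norm)
        have "norm ((f ^^ (N (s n))) u) \<le> norm (h u) + dist ((f ^^ (N (s n))) u) (h u)"
          unfolding dist_norm by (rule norm_triangle_sub)
        then show "norm ((f ^^ (N (s n))) u) \<le> H + 1" using H[OF u] bspec[OF elim u] by linarith
      qed
      then show ?case by simp
    qed
    have "strict_mono (\<lambda>n. N (s n))" using N(1) s by (auto simp: strict_mono_def)
    then have "filterlim (\<lambda>n. N (s n)) at_top sequentially" by (rule filterlim_subseq)
    then have "filterlim (\<lambda>n. norm (deriv (f ^^ (N (s n))) z)) at_top sequentially"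
      by (rule filterlim_compose[OF expansion[OF z]])
    then have "\<forall>\<^sub>F n in sequentially. norm (deriv (f ^^ (N (s n))) z) > (H + 1) / r"
      unfolding filterlim_at_top_dense by blast
    with ev have "\<forall>\<^sub>F n in sequentially. False" by eventually_elim simp
    then show False by simp
  next
    assume "\<forall>K. compact K \<and> K \<subseteq> U \<longrightarrow>
            (\<forall>B::real. \<forall>\<^sub>F n in sequentially. \<forall>z\<in>K. B < cmod ((f ^^ (N (s n))) z))"
    then have "\<forall>\<^sub>F n in sequentially. \<forall>u\<in>cball z r. B < cmod ((f ^^ (N (s n))) u)" using r by auto
    then obtain n where "\<forall>u\<in>cball z r. B < cmod ((f ^^ (N (s n))) u)" using eventually_happens by fastforce
    then show False using N(2)[of "s n"] by (simp add: S_def)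
  qed
qed

text \<open>On a normal neighbourhood of a point of \<open>X\<close> the iterates omit the fixed point \<open>p\<close>, and
  \<open>f\<^sup>n\<^sup>+\<^sup>1 = p\<close> says that \<open>exp f\<^sup>n / (l f\<^sup>n + a0 - p)\<close> equals \<open>1\<close>. Schottky's theorem for these
  quotients bounds the growth of the orbits, which contradicts the presence of preimages
  of a fast escaping point.\<close>

lemma X_subset_Julia: "X \<subseteq> Julia_set f"
proof
  fix z assume z: "z \<in> X"
  show "z \<in> Julia_set f"
  proof (rule ccontr)
    assume "z \<notin> Julia_set f"
    then obtain U where U: "open U" "z \<in> U" "normal_on U (range (\<lambda>n. f ^^ n))" by (auto simp: Julia_set_def)
    obtain r where r: "r > 0" "cball z r \<subseteq> U" using U open_contains_cball by blast
    note esc = X_normal_imp_escape[OF z U(3) r]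
    \<comment> \<open>An orbit that hits the fixed point \<open>p\<close> stays there and cannot
      escape.\<close>
    have nop: "(f ^^ n) u \<noteq> p" if u: "u \<in> cball z r" for n u
    proof
      assume n: "(f ^^ n) u = p"
      obtain M where M: "\<And>m. m \<ge> M \<Longrightarrow> norm p < cmod ((f ^^ m) u)"
        using esc[of "norm p"] u unfolding eventually_sequentially by blast
      have "(f ^^ (M + n)) u = p" using n fn_p by (simp add: funpow_add)
      then show False using M[of "M + n"] by simp
    qed
    obtain n0 where n0: "\<And>n u. n \<ge> n0 \<Longrightarrow> u \<in> cball z r \<Longrightarrow> norm a0 + norm p + 1 < cmod ((f ^^ n) u)"
      using esc[of "norm a0 + norm p + 1"] unfolding eventually_sequentially by blast
    define den where "den = (\<lambda>n u. of_nat l * (f ^^ n) u + a0 - p)"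
    have den: "norm (den n u) \<ge> 1" if "n \<ge> n0" "u \<in> cball z r" for n u
    proof -
      have "1 * cmod ((f ^^ n) u) \<le> l * cmod ((f ^^ n) u)" using l2 by (intro mult_right_mono) auto
      then have "norm a0 + norm p + 1 \<le> norm (of_nat l * (f ^^ n) u)" using n0[OF that] by (simp add: norm_mult)
      moreover have "norm (of_nat l * (f ^^ n) u) \<le> norm (den n u) + norm (a0 - p)"
        using norm_triangle_ineq4[of "den n u" "a0 - p"] by (simp add: den_def)
      moreover have "norm (a0 - p) \<le> norm a0 + norm p" by (rule norm_triangle_ineq4)
      ultimately show ?thesis by linarith
    qed
    \<comment> \<open>Two points within \<open>r / 16\<close> of \<open>z\<close> are within a
      quarter of \<open>r / 2\<close> of each other, as \<open>Schottky_ball\<close> around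
      \<open>u1\<close> requires.\<close>
    have r16: "r / 16 > 0" using r by simp
    \<comment> \<open>This point anchors the estimate: from time \<open>N1\<close> on,
      \<open>exp\<close> of its iterates equals \<open>c\<close>, so the quotients are bounded there
      independently of \<open>n\<close>.\<close>
    obtain N1 q1 u1 where u1: "dist z u1 < r / 16" "(f ^^ N1) u1 = p + per q1"
      using blow_up[OF z r16, of 1 p] by auto
    obtain a where a: "\<And>C. C > 0 \<Longrightarrow> \<forall>\<^sub>F m in sequentially. exp (Re ((f ^^ m) a)) > C * (1 + norm ((f ^^ m) a) + real l ^ m)"
      using fast_escaping_point by blast
    obtain N2 q2 u2 where u2: "dist z u2 < r / 16" "(f ^^ N2) u2 = a + per q2"
      using blow_up[OF z r16, of 1 a] by auto
    have sub: "ball u1 (r/2) \<subseteq> cball z r"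
    proof
      fix x assume "x \<in> ball u1 (r/2)"
      then show "x \<in> cball z r" using u1(1) dist_triangle[of z x u1] r(1) by simp
    qed
    have u12: "u2 \<in> cball u1 (r/2/4)"
      using u1(1) u2(1) dist_triangle[of u1 u2 z] by (simp add: dist_commute)
    have u1z: "u1 \<in> cball z r" "u2 \<in> cball z r" using u1(1) u2(1) r by auto
    define C where "C = schottky_const (norm c)"
    have C: "C > 0" by (simp add: C_def schottky_const_pos)
    have main: "exp (Re ((f ^^ n) u2)) \<le> C * norm (den n u2)" if n: "n \<ge> n0" "n \<ge> N1" for n
    proof -
      define q where "q = (\<lambda>u. exp ((f ^^ n) u) / den n u)"
      have dn: "den n u \<noteq> 0" if "u \<in> cball z r" for u using den[OF n(1) that] by auto
      have "norm (q u2) \<le> C"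
        unfolding C_def
      proof (rule Schottky_ball[where q = q and u = u2 and z = u1 and r = "r/2"])
        show "q holomorphic_on ball u1 (r/2)"
          unfolding q_def den_def
          by (intro holomorphic_intros hol_fn) (use dn sub in \<open>auto simp: den_def\<close>)
        show "q u \<noteq> 0 \<and> q u \<noteq> 1" if "u \<in> ball u1 (r/2)" for u
        proof
          have u: "u \<in> cball z r" using that sub by blast
          show "q u \<noteq> 0" using dn[OF u] by (simp add: q_def)
          show "q u \<noteq> 1"
          proof
            assume "q u = 1"
            then have "exp ((f ^^ n) u) = den n u" using dn[OF u] by (simp add: q_def)
            then have "f ((f ^^ n) u) = p" by (simp add: f_eq den_def)
            then show False using nop[OF u, of "Suc n"] by simp
          qed
        qed
        have "(f ^^ (n - N1 + N1)) u1 = p + per (int l ^ (n - N1) * q1)"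
          unfolding funpow_add o_apply u1(2) fn_per fn_p ..
        then have "exp ((f ^^ n) u1) = c" using n(2) exp_p by simp
        then have "norm (q u1) = norm c / norm (den n u1)" by (simp add: q_def norm_divide)
        also have "\<dots> \<le> norm c / 1" using den[OF n(1) u1z(1)] by (intro divide_left_mono) auto
        finally show "norm (q u1) \<le> norm c" by simp
      qed (use r u12 in auto)
      moreover have "norm (den n u2) > 0" using den[OF n(1) u1z(2)] by linarith
      ultimately show ?thesis by (simp add: q_def norm_divide field_simps)
    qed
    define C' where "C' = C * (real l + real l * norm (per q2) + norm a0 + norm p)"
    have C': "C' > 0" unfolding C'_def using C l2 by (intro mult_pos_pos) (auto intro!: add_pos_nonneg)
    obtain M where M: "\<And>m. m \<ge> M \<Longrightarrow> exp (Re ((f ^^ m) a)) > C' * (1 + norm ((f ^^ m) a) + real l ^ m)"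
      using a[OF C'] unfolding eventually_sequentially by blast
    define m where "m = M + n0 + N1"
    have fm: "(f ^^ (m + N2)) u2 = (f ^^ m) a + per (int l ^ m * q2)"
      unfolding funpow_add o_apply u2(2) fn_per ..
    define Y where "Y = 1 + norm ((f ^^ m) a) + real l ^ m"
    have Y: "1 \<le> Y" "norm ((f ^^ m) a) \<le> Y" "real l ^ m \<le> Y" "0 \<le> Y" by (simp_all add: Y_def)
    have "exp (Re ((f ^^ m) a)) \<le> C * norm (den (m + N2) u2)"
    proof -
      have "n0 \<le> m + N2" "N1 \<le> m + N2" by (simp_all add: m_def)
      from main[OF this] show ?thesis unfolding fm by simp
    qed
    also have "norm (den (m + N2) u2) \<le> C' / C * Y"
    proof -
      have "norm (den (m + N2) u2) \<le> norm (of_nat l * ((f ^^ m) a + per (int l ^ m * q2))) + norm a0 + norm p"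
        unfolding den_def fm using norm_triangle_ineq4[of "of_nat l * ((f ^^ m) a + per (int l ^ m * q2)) + a0" p]
          norm_triangle_ineq[of "of_nat l * ((f ^^ m) a + per (int l ^ m * q2))" a0] by linarith
      also have "norm (of_nat l * ((f ^^ m) a + per (int l ^ m * q2))) \<le> real l * (norm ((f ^^ m) a) + norm (per (int l ^ m * q2)))"
        unfolding norm_mult norm_of_nat by (intro mult_left_mono norm_triangle_ineq) auto
      also have "norm (per (int l ^ m * q2)) = real l ^ m * norm (per q2)" by (simp add: norm_per abs_mult)
      also have "real l * (norm ((f ^^ m) a) + real l ^ m * norm (per q2)) \<le> real l * (Y + Y * norm (per q2))"
        using Y by (intro mult_left_mono add_mono mult_right_mono) auto
      also have "norm a0 \<le> norm a0 * Y" using Y by (simp add: mult_left_le mult_le_cancel_left1)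
      also have "norm p \<le> norm p * Y" using Y by (simp add: mult_left_le mult_le_cancel_left1)
      finally have "norm (den (m + N2) u2) \<le> (real l + real l * norm (per q2) + norm a0 + norm p) * Y"
        by (simp add: algebra_simps)
      moreover have "C' / C = real l + real l * norm (per q2) + norm a0 + norm p"
        using C by (simp add: C'_def)
      ultimately show ?thesis by simp
    qed
    finally have "exp (Re ((f ^^ m) a)) \<le> C' * Y" using C by simp
    then show False using M[of m] by (simp add: m_def Y_def)
  qed
qed

theorem Julia_eq_X: "Julia_set f = X"
  using Julia_subset_X X_subset_Julia by blast

end


section \<open>Conformal measures in the punctured plane\<close>

text \<open>\<open>Ln\<close> jumps across the negative reals, but on them it agrees with the
  continuous function \<open>Ln (- z) + \<i> * of_real pi\<close>; the plane splits into three Borel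
  pieces.\<close>

lemma borel_measurable_Ln: "Ln \<in> borel_measurable borel"
proof -
  have 1: "(\<lambda>z. indicator (- \<real>\<^sub>\<le>\<^sub>0) z *\<^sub>R Ln z) \<in> borel_measurable borel"
    by (rule borel_measurable_continuous_on_indicator) (auto intro!: continuous_intros)
  have 2: "(\<lambda>z. indicator (\<real>\<^sub>\<le>\<^sub>0 - {0}) z *\<^sub>R (Ln (- z) + \<i> * of_real pi)) \<in> borel_measurable borel"
  proof (rule borel_measurable_continuous_on_indicator)
    show "\<real>\<^sub>\<le>\<^sub>0 - {0} \<in> sets (borel :: complex measure)" by auto
    show "continuous_on (\<real>\<^sub>\<le>\<^sub>0 - {0}) (\<lambda>z. Ln (- z) + \<i> * of_real pi)"
      by (intro continuous_intros) (auto simp: complex_nonpos_Reals_iff complex_eq_iff)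
  qed
  have eq: "Ln z = indicator (- \<real>\<^sub>\<le>\<^sub>0) z *\<^sub>R Ln z + indicator (\<real>\<^sub>\<le>\<^sub>0 - {0}) z *\<^sub>R (Ln (- z) + \<i> * of_real pi)
      + indicator {0} z *\<^sub>R Ln 0" for z
  proof (cases "z \<in> \<real>\<^sub>\<le>\<^sub>0 \<and> z \<noteq> 0")
    case True
    then have "Ln z = Ln (- z) + \<i> * of_real pi"
      using Ln_minus[of "- z"] by (auto simp: complex_nonpos_Reals_iff complex_eq_iff)
    then show ?thesis using True by simp
  qed (auto simp: indicator_def)
  have 3: "(\<lambda>z::complex. indicator {0} z *\<^sub>R Ln 0) \<in> borel_measurable borel"
    by (intro borel_measurable_continuous_on_indicator) auto
  show ?thesis by (subst ext[OF eq]) (intro borel_measurable_add 1 2 3)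
qed

text \<open>An image under an injective holomorphic map is a preimage under its holomorphic
  inverse.\<close>

lemma holomorphic_inj_image_borel:
  assumes hol: "h holomorphic_on U" and U: "open U" and inj: "inj_on h U"
    and A: "A \<in> sets borel" "A \<subseteq> U"
  shows "h ` A \<in> sets borel"
proof -
  obtain k where k: "k holomorphic_on h ` U" "\<And>z. z \<in> U \<Longrightarrow> k (h z) = z"
    using holomorphic_has_inverse[OF hol U inj] by metis
  have op: "open (h ` U)" by (rule open_mapping_thm3[OF hol U inj])
  have "k \<in> borel_measurable (restrict_space borel (h ` U))"
    by (intro borel_measurable_continuous_on_restrict holomorphic_on_imp_continuous_on k)
  then have "k -` A \<inter> space (restrict_space borel (h ` U)) \<in> sets (restrict_space borel (h ` U))"
    using A(1) by (rule measurable_sets)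
  moreover have "k -` A \<inter> space (restrict_space borel (h ` U)) = h ` A"
    using A(2) k(2) by (auto simp: space_restrict_space)
  ultimately show ?thesis using op by (simp add: sets_restrict_space_iff)
qed

text \<open>Serves for \<open>D = L M2 - M1\<close>: integrals against a difference of measures are
  handled by adding, without signed measures.\<close>

lemma nn_integral_measure_sum:
  fixes D M N :: "'a measure" and h :: "'a \<Rightarrow> ennreal"
  assumes sets: "sets D = sets N" "sets M = sets N"
    and sum: "\<And>A. A \<in> sets N \<Longrightarrow> emeasure N A = emeasure D A + emeasure M A"
    and h: "h \<in> borel_measurable N"
  shows "nn_integral N h = nn_integral D h + nn_integral M h"
proof -
  have meas: "u \<in> borel_measurable D" "u \<in> borel_measurable M" if "u \<in> borel_measurable N" for u :: "'a \<Rightarrow> ennreal"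
    using that measurable_cong_sets[OF sets(1) refl, of borel] measurable_cong_sets[OF sets(2) refl, of borel] by auto
  show ?thesis
    using h
  proof (induction rule: borel_measurable_induct)
    case (cong f g)
    have sp: "space D = space N" "space M = space N" using sets sets_eq_imp_space_eq by blast+
    have "nn_integral N f = nn_integral N g" "nn_integral D f = nn_integral D g" "nn_integral M f = nn_integral M g"
      using cong(3) sp by (auto intro!: nn_integral_cong)
    then show ?case using cong by simp
  next
    case (set A)
    then show ?case using sum sets by simp
  next
    case (mult u c)
    note u = meas[OF \<open>u \<in> borel_measurable N\<close>]
    show ?case unfolding nn_integral_cmult[OF u(1)] nn_integral_cmult[OF u(2)]
      nn_integral_cmult[OF \<open>u \<in> borel_measurable N\<close>] mult.IH distrib_left ..
  next
    case (add u v)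
    note u = meas[OF \<open>u \<in> borel_measurable N\<close>] and v = meas[OF \<open>v \<in> borel_measurable N\<close>]
    show ?case unfolding nn_integral_add[OF \<open>v \<in> borel_measurable N\<close> \<open>u \<in> borel_measurable N\<close>]
        nn_integral_add[OF v(1) u(1)] nn_integral_add[OF v(2) u(2)] add.IH by (simp add: ac_simps)
  next
    case (seq U)
    have mD: "U i \<in> borel_measurable D" "U i \<in> borel_measurable M" for i
      by (rule meas[OF seq.hyps(1)])+
    have SUP: "(SUP i. U i) = (\<lambda>x. SUP i. U i x)" by (rule ext) (simp add: image_comp)
    have eqs: "nn_integral Q (SUP i. U i) = (SUP i. nn_integral Q (U i))" if "\<And>i. U i \<in> borel_measurable Q" for Q
      unfolding SUP by (rule nn_integral_monotone_convergence_SUP[OF seq.hyps(3) that])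
    have inc: "incseq (\<lambda>i. nn_integral Q (U i))" for Q
      by (intro incseq_SucI nn_integral_mono) (use seq.hyps(3) in \<open>simp add: incseq_Suc_iff le_fun_def\<close>)
    show ?case unfolding eqs[OF seq.hyps(1)] eqs[OF mD(1)] eqs[OF mD(2)] seq.IH
      by (rule ennreal_SUP_add[OF inc inc])
  qed
qed

section \<open>The induced map in the coordinate \<open>w = exp z\<close>\<close>

context lc_trap
begin

definition S :: "complex set" where "S = exp ` X"

text \<open>The map \<open>F\<close> after identifying the cylinder with the punctured plane through
  \<open>exp\<close>; it extends to an entire function fixing 0.\<close>

definition g :: "complex \<Rightarrow> complex" where "g w = exp a0 * w ^ l * exp (- w)"

lemma g_exp: "g (exp z) = exp (f z)"
  by (simp add: g_def f_eq exp_add exp_diff exp_of_nat_mult exp_minus divide_inverse)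

lemma gn_exp: "(g ^^ n) (exp z) = exp ((f ^^ n) z)"
  by (induction n) (auto simp: g_exp)

lemma S_exp: "exp z \<in> S \<longleftrightarrow> z \<in> X"
proof
  assume "exp z \<in> S"
  then obtain x where "x \<in> X" "exp z = exp x" by (auto simp: S_def)
  then show "z \<in> X" unfolding exp_eq_per using X_per by auto
qed (auto simp: S_def)

lemma S_Ln: "w \<in> S \<longleftrightarrow> w \<noteq> 0 \<and> Ln w \<in> X"
  using S_exp[of "Ln w"] by (cases "w = 0") (auto simp: S_def)

lemma S_nz: "w \<in> S \<Longrightarrow> w \<noteq> 0"
  by (simp add: S_Ln)

lemma S_g: "w \<noteq> 0 \<Longrightarrow> g w \<in> S \<longleftrightarrow> w \<in> S"
  using g_exp[of "Ln w"] S_exp X_f by (metis exp_Ln)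

lemma S_gn: "w \<in> S \<Longrightarrow> (g ^^ n) w \<in> S"
  by (induction n) (auto simp: S_g S_nz)

lemma S_borel [measurable]: "S \<in> sets borel"
proof -
  have "Ln -` X \<inter> space borel \<in> sets borel"
    by (rule measurable_sets[OF borel_measurable_Ln]) (use closed_X in auto)
  moreover have "S = (Ln -` X \<inter> space borel) - {0}" by (auto simp: S_Ln)
  ultimately show ?thesis by auto
qed

lemma S_l: "w \<in> S \<Longrightarrow> of_nat l - w \<noteq> 0"
  using X_deriv_nz[of "Ln w"] by (simp add: S_Ln)

lemma hol_g: "g holomorphic_on A"
  unfolding g_def by (intro holomorphic_intros)

lemma cont_g: "continuous_on A g"
  by (intro holomorphic_on_imp_continuous_on hol_g)

lemma cont_gn: "continuous_on A (g ^^ n)"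
proof (induction n)
  case (Suc n)
  show ?case by (simp add: continuous_on_compose[OF Suc cont_g] del: o_apply)
qed (simp add: id_def)

lemma gn_measurable [measurable]: "(g ^^ n) \<in> borel_measurable borel"
  by (intro borel_measurable_continuous_onI cont_gn)

lemma g_measurable [measurable]: "g \<in> borel_measurable borel"
  by (intro borel_measurable_continuous_onI cont_g)

lemma deriv_g_nz:
  assumes "w \<in> S"
  shows "deriv g w \<noteq> 0"
proof -
  have "(g has_field_derivative exp a0 * (of_nat l * w ^ (l - 1)) * exp (- w) - exp a0 * w ^ l * exp (- w)) (at w)"
    unfolding g_def by (rule derivative_eq_intros refl | simp)+
  moreover have "w ^ l = w * w ^ (l - 1)" using l2 by (simp flip: power_Suc)
  ultimately have "deriv g w = exp a0 * w ^ (l - 1) * exp (- w) * (of_nat l - w)"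
    by (simp add: DERIV_imp_deriv algebra_simps)
  then show ?thesis using S_l[OF assms] S_nz[OF assms] by simp
qed

text \<open>Conformality speaks only of sets on which the map is injective; a countable cover by
  such pieces reduces Borel images and null sets to that case.\<close>

lemma g_pieces:
  obtains B :: "nat \<Rightarrow> complex set" where "\<And>n. open (B n)" "\<And>n. inj_on g (B n)" "S \<subseteq> (\<Union>n. B n)"
proof -
  let ?F = "insert {} {U. open U \<and> inj_on g U}"
  obtain F' where F': "F' \<subseteq> ?F" "countable F'" "\<Union> F' = \<Union> ?F"
    by (rule Lindelof[of ?F]) auto
  let ?G = "insert {} F'"
  have ne: "?G \<noteq> {}" "countable ?G" using F' by auto
  have r: "range (from_nat_into ?G) = ?G" using ne by (rule range_from_nat_into)
  have mem: "from_nat_into ?G n \<in> ?F" for n using from_nat_into[OF ne(1), of n] F'(1) by blast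
  show ?thesis
  proof (rule that[of "from_nat_into ?G"])
    show "open (from_nat_into ?G n)" "inj_on g (from_nat_into ?G n)" for n using mem[of n] by auto
    show "S \<subseteq> (\<Union>n. from_nat_into ?G n)"
    proof
      fix w assume "w \<in> S"
      then obtain e where "e > 0" "inj_on g (ball w e)"
        using has_complex_derivative_locally_injective[OF hol_g, of w UNIV] deriv_g_nz by auto
      then have "w \<in> \<Union> ?F" by (auto intro!: exI[of _ "ball w e"])
      then show "w \<in> (\<Union>n. from_nat_into ?G n)" unfolding r using F'(3) by auto
    qed
  qed
qed

lemma g_image_borel:
  assumes A: "A \<in> sets borel" "A \<subseteq> S"
  shows "g ` A \<in> sets borel"
proof -
  obtain B :: "nat \<Rightarrow> complex set" where B: "\<And>n. open (B n)" "\<And>n. inj_on g (B n)" "S \<subseteq> (\<Union>n. B n)"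
    using g_pieces by blast
  have "A = (\<Union>n. A \<inter> B n)" using A(2) B(3) by blast
  then have "g ` A = (\<Union>n. g ` (A \<inter> B n))" by (metis image_UN)
  moreover have "g ` (A \<inter> B n) \<in> sets borel" for n
    using A B by (intro holomorphic_inj_image_borel[OF hol_g B(1,2)]) auto
  ultimately show ?thesis by auto
qed

lemma gn_image_borel: "A \<in> sets borel \<Longrightarrow> A \<subseteq> S \<Longrightarrow> (g ^^ n) ` A \<in> sets borel"
proof (induction n arbitrary: A)
  case (Suc n)
  have "g ` A \<subseteq> S" using Suc.prems S_g S_nz by blast
  then have "(g ^^ n) ` (g ` A) \<in> sets borel" using Suc g_image_borel by blast
  then show ?case by (simp add: image_comp funpow_Suc_right del: funpow.simps)
qed simp

end

section \<open>Conformal measures: null sets, change of variables, iterates\<close>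

locale lc_conf = lc_trap +
  fixes \<alpha> t :: real
  assumes \<alpha>_pos: "\<alpha> > 0" and t1: "t > 1"
begin

definition wt :: "complex \<Rightarrow> ennreal" where "wt w = ennreal (\<alpha> * norm (of_nat l - w) powr t)"

text \<open>The measure lives on \<open>S\<close> but on the Borel sets of the whole plane, which
  gives access to outer regularity and covering lemmas. It is only required to be finite, so that
  \<open>L M2 - M1\<close> falls under the same notion.\<close>

definition conf :: "complex measure \<Rightarrow> bool" where
  "conf \<mu>' \<longleftrightarrow> sets \<mu>' = sets borel \<and> finite_measure \<mu>' \<and> emeasure \<mu>' (- S) = 0 \<and>
     (\<forall>A\<in>sets borel. A \<subseteq> S \<longrightarrow> inj_on g A \<longrightarrow> emeasure \<mu>' (g ` A) = (\<integral>\<^sup>+w\<in>A. wt w \<partial>\<mu>'))"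

lemma wt_measurable [measurable]: "wt \<in> borel_measurable borel"
  unfolding wt_def by measurable

context
  fixes M :: "complex measure"
  assumes M: "conf M"
begin

lemma conf_sets [measurable_cong]: "sets M = sets borel"
  using M by (simp add: conf_def)

lemma conf_space: "space M = UNIV"
  using sets_eq_imp_space_eq[OF conf_sets] by simp

lemma conf_finite: "finite_measure M"
  using M by (simp add: conf_def)

lemma conf_image: "A \<in> sets borel \<Longrightarrow> A \<subseteq> S \<Longrightarrow> inj_on g A \<Longrightarrow> emeasure M (g ` A) = (\<integral>\<^sup>+w\<in>A. wt w \<partial>M)"
  using M by (simp add: conf_def)

lemma conf_null: "A \<in> sets borel \<Longrightarrow> A \<inter> S = {} \<Longrightarrow> emeasure M A = 0"
proof -
  assume "A \<in> sets borel" "A \<inter> S = {}"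
  then have "emeasure M A \<le> emeasure M (- S)" using conf_sets by (intro emeasure_mono) auto
  then show ?thesis using M by (simp add: conf_def)
qed

lemma conf_Int_S: "A \<in> sets borel \<Longrightarrow> emeasure M (A \<inter> S) = emeasure M A"
proof -
  assume A: "A \<in> sets borel"
  have "emeasure M A = emeasure M (A \<inter> S) + emeasure M (A - S)"
    using A conf_sets by (subst plus_emeasure) (auto intro!: arg_cong[where f = "emeasure M"])
  also have "emeasure M (A - S) = 0" using A by (intro conf_null) auto
  finally show ?thesis by simp
qed

lemma null_image:
  assumes N: "N \<in> sets borel" "N \<subseteq> S" "emeasure M N = 0"
  shows "emeasure M (g ` N) = 0"
proof -
  obtain B :: "nat \<Rightarrow> complex set" where B: "\<And>n. open (B n)" "\<And>n. inj_on g (B n)" "S \<subseteq> (\<Union>n. B n)"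
    using g_pieces by blast
  have "N = (\<Union>n. N \<inter> B n)" using N(2) B(3) by blast
  then have "g ` N = (\<Union>n. g ` (N \<inter> B n))" by (metis image_UN)
  moreover have "(\<Union>n. g ` (N \<inter> B n)) \<in> null_sets M"
  proof (rule null_sets_UN)
    fix n
    have NB: "N \<inter> B n \<in> sets borel" "N \<inter> B n \<subseteq> S" using N B by auto
    have "N \<in> null_sets M" using N conf_sets by (auto simp: null_sets_def)
    then have "N \<inter> B n \<in> null_sets M"
      by (rule null_sets_subset) (use NB(1) in \<open>simp_all add: conf_sets\<close>)
    then have "(\<integral>\<^sup>+w\<in>N \<inter> B n. wt w \<partial>M) = 0"
      by (rule nn_integral_null_set)
    then have "emeasure M (g ` (N \<inter> B n)) = 0"
      using conf_image[OF NB inj_on_subset[OF B(2)[of n] Int_lower2]] by simp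
    then show "g ` (N \<inter> B n) \<in> null_sets M" using g_image_borel[OF NB] conf_sets by (auto simp: null_sets_def)
  qed
  ultimately show ?thesis by (simp add: null_sets_def)
qed

lemma null_image_n:
  "N \<in> sets borel \<Longrightarrow> N \<subseteq> S \<Longrightarrow> emeasure M N = 0 \<Longrightarrow> emeasure M ((g ^^ n) ` N) = 0"
proof (induction n arbitrary: N)
  case (Suc n)
  have "g ` N \<subseteq> S" using Suc.prems S_g S_nz by blast
  then have "emeasure M ((g ^^ n) ` (g ` N)) = 0"
    using Suc.prems by (intro Suc.IH g_image_borel null_image)
  then show ?case by (simp add: image_comp funpow_Suc_right del: funpow.simps)
qed simp

lemma wt_integral_zero:
  assumes A: "A \<in> sets borel" "A \<subseteq> S" and 0: "(\<integral>\<^sup>+w\<in>A. wt w \<partial>M) = 0"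
  shows "emeasure M A = 0"
proof -
  have m: "(\<lambda>w. wt w * indicator A w) \<in> borel_measurable M" using A by measurable
  have "AE w in M. wt w * indicator A w = 0" using 0 nn_integral_0_iff_AE[OF m] by simp
  then have "AE w in M. w \<notin> A"
  proof eventually_elim
    case (elim w)
    show ?case
    proof
      assume "w \<in> A"
      then have "\<alpha> * norm (of_nat l - w) powr t \<le> 0" using elim by (simp add: wt_def ennreal_eq_0_iff del: mult_eq_0_iff powr_eq_0_iff ennreal_eq_zero_iff)
      moreover have "of_nat l - w \<noteq> 0" using A \<open>w \<in> A\<close> S_l by blast
      then have "\<alpha> * norm (of_nat l - w) powr t > 0" using \<alpha>_pos by simp
      ultimately show False by linarith
    qed
  qed
  then show ?thesis using A conf_sets conf_space by (subst (asm) AE_iff_null) (auto simp: null_sets_def)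
qed

text \<open>The weight integrates to zero over each injective piece of the preimage, and it is
  positive on \<open>S\<close>, which does not contain the critical point \<open>l\<close>.\<close>

lemma null_preimage:
  assumes N: "N \<in> sets borel" "N \<subseteq> S" "emeasure M N = 0"
  shows "emeasure M (S \<inter> g -` N) = 0"
proof -
  obtain B :: "nat \<Rightarrow> complex set" where B: "\<And>n. open (B n)" "\<And>n. inj_on g (B n)" "S \<subseteq> (\<Union>n. B n)"
    using g_pieces by blast
  have gN: "g -` N \<in> sets borel" using measurable_sets[OF g_measurable N(1)] by simp
  have "S \<inter> g -` N = (\<Union>n. S \<inter> g -` N \<inter> B n)" using B by blast
  moreover have "(\<Union>n. S \<inter> g -` N \<inter> B n) \<in> null_sets M"
  proof (rule null_sets_UN)
    fix n
    let ?A = "S \<inter> g -` N \<inter> B n"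
    have A: "?A \<in> sets borel" "?A \<subseteq> S" "inj_on g ?A" using gN B inj_on_subset[OF B(2)[of n], of ?A] by auto
    have "emeasure M (g ` ?A) \<le> emeasure M N" using N conf_sets by (intro emeasure_mono) auto
    then have "(\<integral>\<^sup>+w\<in>?A. wt w \<partial>M) = 0" using N conf_image[OF A] by simp
    then have "emeasure M ?A = 0" by (rule wt_integral_zero[OF A(1,2)])
    then show "?A \<in> null_sets M" using A conf_sets by (auto simp: null_sets_def)
  qed
  ultimately show ?thesis by (simp add: null_sets_def)
qed

lemma null_preimage_n:
  "N \<in> sets borel \<Longrightarrow> N \<subseteq> S \<Longrightarrow> emeasure M N = 0 \<Longrightarrow> emeasure M (S \<inter> (g ^^ n) -` N) = 0"
proof (induction n arbitrary: N)
  case 0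
  then show ?case by (simp add: Int_absorb1)
next
  case (Suc n)
  have "g -` N \<in> sets borel" using measurable_sets[OF g_measurable Suc.prems(1)] by simp
  then have "emeasure M (S \<inter> (g ^^ n) -` (S \<inter> g -` N)) = 0"
    using Suc.prems by (intro Suc.IH null_preimage) auto
  moreover have "S \<inter> (g ^^ n) -` (S \<inter> g -` N) = S \<inter> (g ^^ Suc n) -` N" using S_gn by auto
  ultimately show ?case by metis
qed

text \<open>Conformality on all Borel subsets of \<open>A\<close> says that \<open>M\<close> on the
  image of \<open>A\<close> is the push-forward under \<open>g\<close> of the density
  \<open>wt\<close> on \<open>A\<close>; equal measures have equal integrals.\<close>

lemma change_of_variables:
  assumes A: "A \<in> sets borel" "A \<subseteq> S" "inj_on g A" and h: "h \<in> borel_measurable borel"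
  shows "(\<integral>\<^sup>+w\<in>g ` A. h w \<partial>M) = (\<integral>\<^sup>+w\<in>A. wt w * h (g w) \<partial>M)"
proof -
  note [measurable] = A(1) h
  have gA [measurable]: "g ` A \<in> sets borel" by (rule g_image_borel[OF A(1,2)])
  let ?N1 = "density M (indicator (g ` A))" and ?N2 = "distr (density M (\<lambda>w. wt w * indicator A w)) borel g"
  have "?N1 = ?N2"
  proof (rule measure_eqI)
    show "sets ?N1 = sets ?N2" using conf_sets by simp
    fix B assume "B \<in> sets ?N1"
    then have B [measurable]: "B \<in> sets borel" using conf_sets by simp
    have gB: "g -` B \<in> sets borel" using measurable_sets[OF g_measurable B] by simp
    have AB: "A \<inter> g -` B \<in> sets borel" "A \<inter> g -` B \<subseteq> S" "inj_on g (A \<inter> g -` B)"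
      using A gB inj_on_subset by (auto simp: inj_on_def)
    have "emeasure ?N1 B = (\<integral>\<^sup>+w. indicator (g ` A) w * indicator B w \<partial>M)"
      by (rule emeasure_density) (use conf_sets in auto)
    also have "\<dots> = (\<integral>\<^sup>+w. indicator (g ` A \<inter> B) w \<partial>M)"
      by (intro nn_integral_cong) (simp add: indicator_inter_arith)
    also have "\<dots> = emeasure M (g ` A \<inter> B)" using conf_sets by simp
    also have "g ` A \<inter> B = g ` (A \<inter> g -` B)" by auto
    also have "emeasure M \<dots> = (\<integral>\<^sup>+w\<in>A \<inter> g -` B. wt w \<partial>M)" by (rule conf_image[OF AB])
    also have "\<dots> = (\<integral>\<^sup>+w. wt w * indicator A w * indicator (g -` B) w \<partial>M)"
      by (intro nn_integral_cong) (simp add: indicator_inter_arith mult.assoc)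
    also have "\<dots> = emeasure (density M (\<lambda>w. wt w * indicator A w)) (g -` B)"
      using gB conf_sets by (subst emeasure_density) auto
    also have "\<dots> = emeasure ?N2 B"
    proof -
      have "g \<in> measurable (density M (\<lambda>w. wt w * indicator A w)) borel"
        using g_measurable conf_sets by (simp cong: measurable_cong_sets)
      then show ?thesis using conf_space by (simp add: emeasure_distr)
    qed
    finally show "emeasure ?N1 B = emeasure ?N2 B" .
  qed
  then have "nn_integral ?N1 h = nn_integral ?N2 h" by simp
  also have "nn_integral ?N1 h = (\<integral>\<^sup>+w. indicator (g ` A) w * h w \<partial>M)"
    by (subst nn_integral_density) auto
  also have "nn_integral ?N2 h = (\<integral>\<^sup>+w. wt w * indicator A w * h (g w) \<partial>M)"
    by (subst nn_integral_distr) (auto simp: nn_integral_density)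
  finally show ?thesis by (simp add: ac_simps)
qed

lemma conf_iterate:
  assumes "A \<in> sets borel" "A \<subseteq> S" "inj_on (g ^^ n) A"
  shows "emeasure M ((g ^^ n) ` A) = (\<integral>\<^sup>+w\<in>A. (\<Prod>k<n. wt ((g ^^ k) w)) \<partial>M)"
  using assms
proof (induction n arbitrary: A)
  case 0
  then show ?case by (simp add: conf_sets)
next
  case (Suc n)
  have io: "inj_on ((g ^^ n) \<circ> g) A" using Suc.prems(3) unfolding funpow_Suc_right .
  note inj = inj_on_imageI[OF io] inj_on_imageI2[OF io]
  have "g ` A \<subseteq> S" using Suc.prems S_g S_nz by blast
  then have "emeasure M ((g ^^ n) ` (g ` A)) = (\<integral>\<^sup>+w\<in>g ` A. (\<Prod>k<n. wt ((g ^^ k) w)) \<partial>M)"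
    using Suc.prems by (intro Suc.IH g_image_borel inj)
  also have "\<dots> = (\<integral>\<^sup>+w\<in>A. wt w * (\<Prod>k<n. wt ((g ^^ k) (g w))) \<partial>M)"
    using Suc.prems inj by (intro change_of_variables) auto
  also have "\<dots> = (\<integral>\<^sup>+w\<in>A. (\<Prod>k<Suc n. wt ((g ^^ k) w)) \<partial>M)"
    unfolding prod.lessThan_Suc_shift by (simp add: funpow_Suc_right del: funpow.simps)
  finally show ?case by (simp add: image_comp funpow_Suc_right del: funpow.simps)
qed

end

lemma prod_wt: "(\<Prod>k<n. wt ((g ^^ k) (exp z))) = ennreal (\<alpha> ^ n * norm (deriv (f ^^ n) z) powr t)"
proof (induction n)
  case (Suc n)
  have "(\<Prod>k<Suc n. wt ((g ^^ k) (exp z))) =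
        ennreal (\<alpha> ^ n * norm (deriv (f ^^ n) z) powr t) * ennreal (\<alpha> * norm (of_nat l - exp ((f ^^ n) z)) powr t)"
  proof -
    have "(\<Prod>k<Suc n. wt ((g ^^ k) (exp z))) = (\<Prod>k<n. wt ((g ^^ k) (exp z))) * wt ((g ^^ n) (exp z))"
      by (rule prod.lessThan_Suc)
    then show ?thesis unfolding Suc by (simp only: gn_exp wt_def)
  qed
  also have "\<dots> = ennreal (\<alpha> ^ n * norm (deriv (f ^^ n) z) powr t * (\<alpha> * norm (of_nat l - exp ((f ^^ n) z)) powr t))"
    using \<alpha>_pos by (intro ennreal_mult[symmetric]) auto
  also have "\<alpha> ^ n * norm (deriv (f ^^ n) z) powr t * (\<alpha> * norm (of_nat l - exp ((f ^^ n) z)) powr t) =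
     \<alpha> ^ Suc n * norm (deriv (f ^^ Suc n) z) powr t"
    unfolding deriv_fn_Suc' norm_mult by (simp add: powr_mult)
  finally show ?case .
qed simp

end


section \<open>Loss of mass near infinity, and recurrence\<close>

context lc_conf
begin

lemma f_measurable [measurable]: "f \<in> borel_measurable borel"
  by (intro borel_measurable_continuous_onI holomorphic_on_imp_continuous_on hol_f)

text \<open>The index codes a pair: \<open>n mod 4\<close> is a quarter of the range of the
  argument, \<open>n div 4\<close> a horizontal strip of height 2 pi for \<open>f (Ln w)\<close>.
  Inside a strip equal values of \<open>g\<close> force equal values of \<open>f\<close>; inside a
  quarter \<open>sector_expand\<close> makes \<open>f\<close> injective.\<close>

definition piece :: "nat \<Rightarrow> nat \<Rightarrow> complex set" where
  "piece N n = {w. w \<noteq> 0 \<and> real N < norm w \<and>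
     - pi + real (n mod 4) * (pi/2) \<le> Im (Ln w) \<and> Im (Ln w) \<le> - pi + real (n mod 4) * (pi/2) + pi/2 \<and>
     of_int (int_decode (n div 4)) * (2 * pi) \<le> Im (f (Ln w)) \<and>
     Im (f (Ln w)) < (of_int (int_decode (n div 4)) + 1) * (2 * pi)}"

lemma piece_borel [measurable]: "piece N n \<in> sets borel"
proof -
  note [measurable] = borel_measurable_Ln
  have [measurable]: "(\<lambda>w. Im (Ln w)) \<in> borel_measurable borel" "(\<lambda>w. Im (f (Ln w))) \<in> borel_measurable borel"
    by measurable
  have "{w \<in> space borel. w \<noteq> 0 \<and> real N < norm w \<and>
     - pi + real (n mod 4) * (pi/2) \<le> Im (Ln w) \<and> Im (Ln w) \<le> - pi + real (n mod 4) * (pi/2) + pi/2 \<and>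
     of_int (int_decode (n div 4)) * (2 * pi) \<le> Im (f (Ln w)) \<and>
     Im (f (Ln w)) < (of_int (int_decode (n div 4)) + 1) * (2 * pi)} \<in> sets borel"
    by measurable
  then show ?thesis by (simp add: piece_def)
qed

lemma piece_inj:
  assumes N: "real N > 2 * real l"
  shows "inj_on g (piece N n)"
proof (rule inj_onI)
  fix w w' assume w: "w \<in> piece N n" and w': "w' \<in> piece N n" and eq: "g w = g w'"
  let ?z = "Ln w" and ?z' = "Ln w'" and ?k = "real_of_int (int_decode (n div 4))"
  have nz: "w \<noteq> 0" "w' \<noteq> 0" using w w' by (auto simp: piece_def)
  have "exp (f ?z) = exp (f ?z')" using g_exp[of ?z] g_exp[of ?z'] eq nz by simp
  then obtain i where i: "f ?z = f ?z' + per i" unfolding exp_eq_per by blast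
  have b: "?k * (2 * pi) \<le> Im (f ?z)" "Im (f ?z) < (?k + 1) * (2 * pi)"
       "?k * (2 * pi) \<le> Im (f ?z')" "Im (f ?z') < (?k + 1) * (2 * pi)"
    using w w' by (auto simp: piece_def)
  have "\<bar>Im (f ?z) - Im (f ?z')\<bar> < 2 * pi" using b by (simp add: algebra_simps)
  moreover have "Im (f ?z) - Im (f ?z') = 2 * pi * i" using i by simp
  ultimately have "2 * pi * \<bar>real_of_int i\<bar> < 2 * pi * 1" by (simp add: abs_mult)
  then have "\<bar>real_of_int i\<bar> < 1" using mult_less_cancel_left_pos[of "2 * pi" "\<bar>real_of_int i\<bar>" 1] pi_gt_zero by simp
  then have "i = 0" by linarith
  then have feq: "f ?z = f ?z'" using i by simp
  have Re: "ln (real N) \<le> Re ?z" "ln (real N) \<le> Re ?z'"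
    using w w' nz N by (auto simp: piece_def)
  have N0: "real N > 0" using N l2 by linarith
  have "(exp (ln (real N)) / 2 - l) * norm (?z - ?z') \<le> norm (f ?z - f ?z')"
  proof (rule sector_expand[OF Re])
    have I: "- pi + real (n mod 4) * (pi/2) \<le> Im ?z" "Im ?z \<le> - pi + real (n mod 4) * (pi/2) + pi/2"
      "- pi + real (n mod 4) * (pi/2) \<le> Im ?z'" "Im ?z' \<le> - pi + real (n mod 4) * (pi/2) + pi/2"
      using w w' by (auto simp: piece_def)
    show "\<bar>Im ?z - (- pi + real (n mod 4) * (pi/2) + pi/4)\<bar> \<le> pi/4"
      "\<bar>Im ?z' - (- pi + real (n mod 4) * (pi/2) + pi/4)\<bar> \<le> pi/4"
      using I by argo+
  qed
  then have "(real N / 2 - l) * norm (?z - ?z') \<le> 0" using feq N0 by simp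
  then have "?z = ?z'" using N by (simp add: mult_le_0_iff)
  then show "w = w'" using nz by (metis exp_Ln)
qed

lemma piece_cover:
  assumes "w \<noteq> 0" "real N < norm w"
  shows "\<exists>n. w \<in> piece N n"
proof -
  let ?z = "Ln w"
  define k where "k = \<lfloor>Im (f ?z) / (2 * pi)\<rfloor>"
  have "of_int k \<le> Im (f ?z) / (2 * pi)" "Im (f ?z) / (2 * pi) < of_int k + 1"
    unfolding k_def by linarith+
  then have k: "of_int k * (2 * pi) \<le> Im (f ?z)" "Im (f ?z) < (of_int k + 1) * (2 * pi)"
    by (simp_all add: field_simps)
  have I: "- pi < Im ?z" "Im ?z \<le> pi" using assms by (auto simp: mpi_less_Im_Ln Im_Ln_le_pi)
  have "\<exists>s<4::nat. - pi + real s * (pi/2) \<le> Im ?z \<and> Im ?z \<le> - pi + real s * (pi/2) + pi/2"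
  proof -
    consider "Im ?z \<le> - pi/2" | "- pi/2 \<le> Im ?z" "Im ?z \<le> 0" | "0 \<le> Im ?z" "Im ?z \<le> pi/2" | "pi/2 \<le> Im ?z"
      by linarith
    then show ?thesis
    proof cases
      case 1 then show ?thesis using I by (intro exI[of _ 0]) auto
    next
      case 2 then show ?thesis by (intro exI[of _ 1]) auto
    next
      case 3 then show ?thesis by (intro exI[of _ 2]) auto
    next
      case 4 then show ?thesis using I by (intro exI[of _ 3]) auto
    qed
  qed
  then obtain s where s: "s < 4" "- pi + real s * (pi/2) \<le> Im ?z" "Im ?z \<le> - pi + real s * (pi/2) + pi/2" by blast
  have "(4 * int_encode k + s) mod 4 = s" "(4 * int_encode k + s) div 4 = int_encode k" using s(1) by auto
  then have "w \<in> piece N (4 * int_encode k + s)" unfolding piece_def using s k assms by simp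
  then show ?thesis by blast
qed

text \<open>Up to a constant, \<open>|Im (f (Ln w))|\<close> is at most \<open>norm w\<close>. So a
  strip of large index can only be reached from large \<open>w\<close>, and the distance grows
  linearly with \<open>n\<close>.\<close>

lemma piece_lower:
  assumes w: "w \<in> piece N n" and N: "real N \<ge> 4 * ((2 * pi + norm a0 + l * pi + 3) / 2 + l + 1/4)"
  shows "(real n + 1 + real N) / 4 \<le> norm (of_nat l - w)"
proof -
  let ?z = "Ln w"
  define k where "k = int_decode (n div 4)"
  have nz: "w \<noteq> 0" and nw: "real N < norm w" using w by (auto simp: piece_def)
  have b: "of_int k * (2 * pi) \<le> Im (f ?z)" "Im (f ?z) < (of_int k + 1) * (2 * pi)"
    using w by (auto simp: piece_def k_def)
  have "int_encode k \<le> nat (2 * \<bar>k\<bar>)"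
    by (auto simp: int_encode_def sum_encode_def nat_mult_distrib)
  then have "n div 4 \<le> nat (2 * \<bar>k\<bar>)" by (simp add: k_def)
  then have "int n \<le> 8 * \<bar>k\<bar> + 3" by linarith
  then have n: "real n \<le> 8 * \<bar>real_of_int k\<bar> + 3" by linarith
  have Im_f: "\<bar>Im (f ?z)\<bar> \<le> norm a0 + l * pi + norm w"
  proof -
    have "\<bar>Im ?z\<bar> \<le> pi" using mpi_less_Im_Ln[OF nz] Im_Ln_le_pi[OF nz] by linarith
    then have "\<bar>l * Im ?z\<bar> \<le> l * pi" unfolding abs_mult by (simp add: mult_left_mono)
    moreover have "Im (f ?z) = Im a0 + l * Im ?z - Im w" using nz by (simp add: f_eq)
    ultimately show ?thesis using abs_Im_le_cmod[of a0] abs_Im_le_cmod[of w] by linarith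
  qed
  have "2 * pi * \<bar>real_of_int k\<bar> \<le> \<bar>Im (f ?z)\<bar> + 2 * pi"
  proof (cases "k \<ge> 0")
    case True
    then have "2 * pi * \<bar>real_of_int k\<bar> = of_int k * (2 * pi)" by simp
    then show ?thesis using b(1) pi_gt_zero by linarith
  next
    case False
    then have "2 * pi * \<bar>real_of_int k\<bar> = 2 * pi - (of_int k + 1) * (2 * pi)" by (simp add: algebra_simps)
    then show ?thesis using b(2) pi_gt_zero by linarith
  qed
  moreover have "4 * \<bar>real_of_int k\<bar> \<le> 2 * pi * \<bar>real_of_int k\<bar>" using pi_ge_two by (intro mult_right_mono) auto
  ultimately have "norm w \<ge> (real n - 3) / 2 - (2 * pi + norm a0 + l * pi)" using n Im_f by argo
  then have "norm w \<ge> real n / 2 - (2 * pi + norm a0 + l * pi + 3)" by argo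
  then have "norm w - l \<ge> (real n + 1 + real N) / 4" using nw N by argo
  moreover have "norm (of_nat l - w) \<ge> norm w - l"
    using norm_triangle_ineq2[of w "of_nat l"] by (simp add: norm_minus_commute)
  ultimately show ?thesis by linarith
qed

text \<open>On the \<open>n\<close>-th piece the weight is at least of order
  \<open>(n + N) powr t\<close>, so that part of the preimage has mass at most the mass of
  \<open>A\<close> times a term of a convergent series. The tail is made small by a choice of
  \<open>N\<close> that serves all conformal measures at once.\<close>

lemma escape_step:
  "\<exists>N::nat. \<forall>M A. conf M \<longrightarrow> A \<in> sets borel \<longrightarrow> A \<subseteq> S \<longrightarrow>
     measure M (S \<inter> {w. real N < norm w} \<inter> g -` A) \<le> 1/2 * measure M A"
proof -
  define c3 where "c3 = 4 powr t / \<alpha>"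
  have c3: "c3 > 0" using \<alpha>_pos by (simp add: c3_def)
  have summ: "summable (\<lambda>n. real n powr (- t))" using t1 by (simp add: summable_real_powr_iff)
  have "(\<lambda>n. \<Sum>k. real (k + n) powr (- t)) \<longlonglongrightarrow> 0" by (rule suminf_exist_split2[OF summ])
  then have "\<forall>\<^sub>F n in sequentially. (\<Sum>k. real (k + n) powr (- t)) < 1 / (2 * c3)"
    using c3 by (intro order_tendstoD) auto
  then obtain n1 where n1: "\<And>n. n \<ge> n1 \<Longrightarrow> (\<Sum>k. real (k + n) powr (- t)) < 1 / (2 * c3)"
    unfolding eventually_sequentially by blast
  \<comment> \<open>The threshold of \<open>piece_lower\<close>; it also exceeds
    \<open>2 * l\<close>, as \<open>piece_inj\<close> demands.\<close>
  define c4 where "c4 = 4 * ((2 * pi + norm a0 + l * pi + 3) / 2 + l + 1/4)"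
  define N where "N = max n1 (nat \<lceil>c4\<rceil>)"
  have N: "N \<ge> n1" "real N \<ge> c4" unfolding N_def by linarith+
  have "0 \<le> real l * pi" "0 \<le> real l" by simp_all
  then have "c4 > 2 * real l" unfolding c4_def using pi_gt_zero norm_ge_zero[of a0] by argo
  then have Nl: "real N > 2 * real l" using N by linarith
  define s where "s = (\<lambda>n. real (n + (N + 1)) powr (- t))"
  have sums: "summable s" unfolding s_def by (rule summable_ignore_initial_segment[OF summ])
  have tail: "suminf s < 1 / (2 * c3)" unfolding s_def using n1[of "N + 1"] N by simp
  show ?thesis
  proof (intro exI[of _ N] allI impI)
    fix M A assume M: "conf M" and A: "A \<in> sets borel" "A \<subseteq> S"
    interpret finite_measure M by (rule conf_finite[OF M])
    have sM: "sets M = sets borel" by (rule conf_sets[OF M])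
    have gA: "g -` A \<in> sets borel" using measurable_sets[OF g_measurable A(1)] by simp
    define C where "C = (\<lambda>n. S \<inter> g -` A \<inter> piece N n)"
    have C: "C n \<in> sets borel" "C n \<subseteq> S" "inj_on g (C n)" for n
      using gA inj_on_subset[OF piece_inj[OF Nl, of n], of "C n"] by (auto simp: C_def)
    have le: "measure M (C n) \<le> c3 * measure M A * s n" for n
    proof -
      define q where "q = (real n + 1 + real N) / 4"
      have q: "q > 0" by (simp add: q_def)
      have "ennreal (\<alpha> * q powr t) * emeasure M (C n) = (\<integral>\<^sup>+w\<in>C n. ennreal (\<alpha> * q powr t) \<partial>M)"
        using C sM by (simp add: nn_integral_cmult_indicator)
      also have "\<dots> \<le> (\<integral>\<^sup>+w\<in>C n. wt w \<partial>M)"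
      proof (rule nn_integral_mono)
        fix w
        show "ennreal (\<alpha> * q powr t) * indicator (C n) w \<le> wt w * indicator (C n) w"
        proof (cases "w \<in> C n")
          case True
          then have "q \<le> norm (of_nat l - w)"
            unfolding q_def using N(2) by (intro piece_lower) (auto simp: C_def c4_def)
          then have "\<alpha> * q powr t \<le> \<alpha> * norm (of_nat l - w) powr t"
            using \<alpha>_pos q t1 by (intro mult_left_mono powr_mono2) auto
          then show ?thesis unfolding wt_def by (intro mult_right_mono ennreal_leI) auto
        qed simp
      qed
      also have "\<dots> = emeasure M (g ` C n)" by (rule conf_image[OF M C, symmetric])
      also have "\<dots> \<le> emeasure M A" using A sM by (intro emeasure_mono) (auto simp: C_def)
      finally have "ennreal (\<alpha> * q powr t * measure M (C n)) \<le> ennreal (measure M A)"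
        unfolding emeasure_eq_measure using \<alpha>_pos by (simp add: ennreal_mult)
      then have "\<alpha> * q powr t * measure M (C n) \<le> measure M A" by (simp add: ennreal_le_iff)
      moreover have "\<alpha> * q powr t > 0" using \<alpha>_pos q by simp
      ultimately have "measure M (C n) \<le> measure M A / (\<alpha> * q powr t)" by (simp add: field_simps)
      also have "1 / (\<alpha> * q powr t) = c3 * s n"
      proof -
        have "q powr t = (real n + 1 + real N) powr t / 4 powr t" unfolding q_def by (rule powr_divide)
        moreover have "s n = 1 / (real n + 1 + real N) powr t"
          unfolding s_def by (simp add: powr_minus_divide add_ac)
        ultimately show ?thesis by (simp add: c3_def)
      qed
      then have "measure M A / (\<alpha> * q powr t) = c3 * measure M A * s n"
        by (simp add: divide_inverse)
      finally show ?thesis .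
    qed
    have sC: "summable (\<lambda>n. c3 * measure M A * s n)" by (rule summable_mult[OF sums])
    have smC: "summable (\<lambda>n. measure M (C n))"
      by (rule summable_comparison_test'[OF sC, of 0]) (use le in auto)
    have "S \<inter> {w. real N < norm w} \<inter> g -` A = (\<Union>n. C n)"
    proof
      show "S \<inter> {w. real N < norm w} \<inter> g -` A \<subseteq> (\<Union>n. C n)"
        using piece_cover S_nz unfolding C_def by blast
    qed (auto simp: C_def piece_def)
    then have "measure M (S \<inter> {w. real N < norm w} \<inter> g -` A) = measure M (\<Union>n. C n)" by simp
    also have "\<dots> \<le> (\<Sum>n. measure M (C n))"
      using C sM smC by (intro finite_measure_subadditive_countably) auto
    also have "\<dots> \<le> (\<Sum>n. c3 * measure M A * s n)" by (rule suminf_le[OF le smC sC])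
    also have "\<dots> = c3 * measure M A * suminf s" by (rule suminf_mult[OF sums])
    also have "\<dots> \<le> c3 * measure M A * (1 / (2 * c3))" using tail c3 by (intro mult_left_mono) auto
    also have "\<dots> = 1/2 * measure M A" using c3 by simp
    finally show "measure M (S \<inter> {w. real N < norm w} \<inter> g -` A) \<le> 1/2 * measure M A" .
  qed
qed

text \<open>By \<open>escape_step\<close>, staying beyond radius \<open>N\<close> for one more step
  at least halves the mass, so the points that stay there forever form a null set.\<close>

lemma recurrence:
  "\<exists>N::nat. \<forall>M. conf M \<longrightarrow> (\<exists>Z\<in>sets borel. emeasure M Z = 0 \<and> (\<forall>w\<in>S - Z. \<forall>m. \<exists>n\<ge>m. norm ((g ^^ n) w) \<le> real N))"
proof -
  obtain N :: nat where N: "\<And>M A. conf M \<Longrightarrow> A \<in> sets borel \<Longrightarrow> A \<subseteq> S \<Longrightarrow>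
     measure M (S \<inter> {w. real N < norm w} \<inter> g -` A) \<le> 1/2 * measure M A"
    using escape_step by blast
  show ?thesis
  proof (intro exI[of _ N] allI impI)
    fix M assume M: "conf M"
    interpret finite_measure M by (rule conf_finite[OF M])
    have sM: "sets M = sets borel" by (rule conf_sets[OF M])
    define E where "E = (\<lambda>n. {w\<in>S. \<forall>k\<le>n. real N < norm ((g ^^ k) w)})"
    have E: "E n \<in> sets borel" "E n \<subseteq> S" for n
    proof -
      have "{w \<in> space borel. w \<in> S \<and> (\<forall>k\<le>n. real N < norm ((g ^^ k) w))} \<in> sets borel" by measurable
      then show "E n \<in> sets borel" by (simp add: E_def)
    qed (auto simp: E_def)
    have ES: "E (Suc n) \<subseteq> S \<inter> {w. real N < norm w} \<inter> g -` E n" for n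
    proof
      fix w assume w: "w \<in> E (Suc n)"
      then have "\<And>k. k \<le> Suc n \<Longrightarrow> real N < norm ((g ^^ k) w)" "w \<in> S" by (auto simp: E_def)
      from this(1)[of 0] this(1)[of "Suc k" for k] this(2) 
      show "w \<in> S \<inter> {w. real N < norm w} \<inter> g -` E n"
        by (auto simp: E_def S_g S_nz funpow_Suc_right simp del: funpow.simps)
    qed
    have mE: "measure M (E n) \<le> (1/2) ^ n * measure M UNIV" for n
    proof (induction n)
      case 0
      have "measure M (E 0) \<le> measure M UNIV" using sM by (intro finite_measure_mono) auto
      then show ?case by simp
    next
      case (Suc n)
      have "g -` E n \<in> sets borel" using measurable_sets[OF g_measurable E(1)[of n]] by simp
      then have "measure M (E (Suc n)) \<le> measure M (S \<inter> {w. real N < norm w} \<inter> g -` E n)"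
        using sM by (intro finite_measure_mono ES) auto
      also have "\<dots> \<le> 1/2 * measure M (E n)" by (rule N[OF M E])
      also have "\<dots> \<le> 1/2 * ((1/2) ^ n * measure M UNIV)" using Suc by simp
      finally show ?case by simp
    qed
    define E' where "E' = {w\<in>S. \<forall>k. real N < norm ((g ^^ k) w)}"
    have E': "E' \<in> sets borel" "E' \<subseteq> S"
    proof -
      have "{w \<in> space borel. w \<in> S \<and> (\<forall>k. real N < norm ((g ^^ k) w))} \<in> sets borel" by measurable
      then show "E' \<in> sets borel" by (simp add: E'_def)
    qed (auto simp: E'_def)
    have "measure M E' \<le> (1/2) ^ n * measure M UNIV" for n
    proof -
      have "measure M E' \<le> measure M (E n)" using E sM by (intro finite_measure_mono) (auto simp: E_def E'_def)
      then show ?thesis using mE[of n] by linarith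
    qed
    moreover have "(\<lambda>n. (1/2) ^ n * measure M UNIV) \<longlonglongrightarrow> 0 * measure M UNIV"
      by (intro tendsto_intros LIMSEQ_power_zero) auto
    ultimately have "measure M E' \<le> 0" using LIMSEQ_le_const by fastforce
    then have E'0: "emeasure M E' = 0" by (simp add: emeasure_eq_measure measure_le_0_iff)
    \<comment> \<open>Orbits that eventually stay outside; preimages of null sets are null.\<close>
    define Z where "Z = (\<Union>m. S \<inter> (g ^^ m) -` E')"
    have gm: "(g ^^ m) -` E' \<in> sets borel" for m using measurable_sets[OF gn_measurable E'(1)] by simp
    have "Z \<in> null_sets M"
      unfolding Z_def by (rule null_sets_UN) (use null_preimage_n[OF M E' E'0] gm sM in \<open>auto simp: null_sets_def\<close>)
    moreover have "\<exists>n\<ge>m. norm ((g ^^ n) w) \<le> real N" if w: "w \<in> S - Z" for w m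
    proof (rule ccontr)
      assume neg: "\<not> ?thesis"
      have "real N < norm ((g ^^ k) ((g ^^ m) w))" for k
        using neg funpow_add[of k m g] by (metis comp_apply le_add2 not_le)
      then have "(g ^^ m) w \<in> E'" using w S_gn by (auto simp: E'_def)
      then show False using w by (auto simp: Z_def)
    qed
    ultimately show "\<exists>Z\<in>sets borel. emeasure M Z = 0 \<and> (\<forall>w\<in>S - Z. \<forall>m. \<exists>n\<ge>m. norm ((g ^^ n) w) \<le> real N)"
      using sM by (intro bexI[of _ Z]) (auto simp: null_sets_def)
  qed
qed

text \<open>Rounding a return time up to a multiple of \<open>j\<close> costs at most
  \<open>j\<close> further steps, and these map the compact ball of radius \<open>N\<close> into a
  bounded set.\<close>

lemma recurrence_multiples:
  assumes j: "j \<ge> 1"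
  shows "\<exists>R. \<forall>M. conf M \<longrightarrow> (\<exists>Z\<in>sets borel. emeasure M Z = 0 \<and> (\<forall>w\<in>S - Z. \<forall>m. \<exists>n\<ge>m. norm ((g ^^ (j * n)) w) \<le> R))"
proof -
  obtain N :: nat where N: "\<And>M. conf M \<Longrightarrow> (\<exists>Z\<in>sets borel. emeasure M Z = 0 \<and> (\<forall>w\<in>S - Z. \<forall>m. \<exists>n\<ge>m. norm ((g ^^ n) w) \<le> real N))"
    using recurrence by blast
  have "\<exists>R. \<forall>w\<in>cball 0 (real N). norm ((g ^^ i) w) \<le> R" for i
  proof -
    have "compact ((g ^^ i) ` cball 0 (real N))" by (intro compact_continuous_image cont_gn compact_cball)
    then have "bounded ((g ^^ i) ` cball 0 (real N))" by (rule compact_imp_bounded)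
    then show ?thesis unfolding bounded_iff by blast
  qed
  then have "\<forall>i. \<exists>R. \<forall>w\<in>cball 0 (real N). norm ((g ^^ i) w) \<le> R" by blast
  then obtain R where "\<forall>i. \<forall>w\<in>cball 0 (real N). norm ((g ^^ i) w) \<le> R i" by (rule choice[THEN exE])
  then have R: "\<And>i w. norm w \<le> real N \<Longrightarrow> norm ((g ^^ i) w) \<le> R i" by (simp add: dist_norm)
  define R' where "R' = (\<Sum>i\<le>j. \<bar>R i\<bar>)"
  have R': "R i \<le> R'" if "i \<le> j" for i
  proof -
    have "\<bar>R i\<bar> \<le> R'" unfolding R'_def using that by (intro member_le_sum) auto
    then show ?thesis by linarith
  qed
  have key: "\<exists>n\<ge>m. norm ((g ^^ (j * n)) w) \<le> R'" if w: "\<forall>m. \<exists>n\<ge>m. norm ((g ^^ n) w) \<le> real N" for w m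
  proof -
    obtain n where n: "n \<ge> j * m" "norm ((g ^^ n) w) \<le> real N" using w by blast
    define i where "i = j - n mod j"
    have i: "i \<le> j" "j * (n div j + 1) = i + n"
    proof -
      have "j - b + (j * a + b) = j * (a + 1)" if "b < j" for a b using that by simp
      moreover have "n mod j < j" using j by simp
      ultimately have "i + (j * (n div j) + n mod j) = j * (n div j + 1)" unfolding i_def by metis
      then show "j * (n div j + 1) = i + n" by (simp only: mult_div_mod_eq)
    qed (simp add: i_def)
    have "m \<le> n div j" using n(1) j by (simp add: less_eq_div_iff_mult_less_eq mult.commute)
    moreover have "norm ((g ^^ (j * (n div j + 1))) w) \<le> R'"
      unfolding i(2) funpow_add o_apply using R[OF n(2), of i] R'[OF i(1)] by linarith
    ultimately show ?thesis by (intro exI[of _ "n div j + 1"]) auto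
  qed
  show ?thesis
  proof (intro exI[of _ R'] allI impI)
    fix M assume "conf M"
    then obtain Z where "Z \<in> sets borel" "emeasure M Z = 0" "\<forall>w\<in>S - Z. \<forall>m. \<exists>n\<ge>m. norm ((g ^^ n) w) \<le> real N"
      using N by metis
    then show "\<exists>Z\<in>sets borel. emeasure M Z = 0 \<and> (\<forall>w\<in>S - Z. \<forall>m. \<exists>n\<ge>m. norm ((g ^^ (j * n)) w) \<le> R')"
      using key by (intro bexI[of _ Z] conjI ballI allI) auto
  qed
qed

end


section \<open>Comparison of conformal measures\<close>

lemma emeasure_UN_countable_le:
  assumes X: "\<And>i. i \<in> I \<Longrightarrow> X i \<in> sets M" and I: "countable I"
  shows "emeasure M (\<Union>i\<in>I. X i) \<le> (\<integral>\<^sup>+i. emeasure M (X i) \<partial>count_space I)"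
proof -
  have "emeasure M (\<Union>i\<in>I. X i) = (\<integral>\<^sup>+x. indicator (\<Union>i\<in>I. X i) x \<partial>M)"
    using X I by (intro nn_integral_indicator[symmetric] sets.countable_UN'') auto
  also have "\<dots> \<le> (\<integral>\<^sup>+x. (\<integral>\<^sup>+i. indicator (X i) x \<partial>count_space I) \<partial>M)"
  proof (rule nn_integral_mono)
    fix x
    show "indicator (\<Union>i\<in>I. X i) x \<le> (\<integral>\<^sup>+i. indicator (X i) x \<partial>count_space I)"
    proof (cases "x \<in> (\<Union>i\<in>I. X i)")
      case True
      then obtain i where i: "i \<in> I" "x \<in> X i" by blast
      have "indicator (X i) x \<le> (\<integral>\<^sup>+i. indicator (X i) x \<partial>count_space I)"
        by (rule nn_integral_ge_point[OF i(1)])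
      then show ?thesis using i True by simp
    qed simp
  qed
  also have "\<dots> = (\<integral>\<^sup>+i. (\<integral>\<^sup>+x. indicator (X i) x \<partial>M) \<partial>count_space I)"
    using X I by (intro nn_integral_count_space_nn_integral) auto
  also have "\<dots> = (\<integral>\<^sup>+i. emeasure M (X i) \<partial>count_space I)"
    using X by (intro nn_integral_cong) simp
  finally show ?thesis .
qed

section \<open>Conformal measure along inverse branches, and domination\<close>

context lc_conf
begin

lemma exp_inj_ball: "r \<le> 1 \<Longrightarrow> inj_on exp (ball (y::complex) r)"
proof (rule inj_onI)
  fix u u' assume r: "r \<le> 1" and u: "u \<in> ball y r" "u' \<in> ball y r" and eq: "exp u = exp u'"
  have "dist u u' < 2" using u r dist_triangle[of u u' y] by (simp add: dist_commute)
  then have "\<bar>Im u - Im u'\<bar> < 2 * pi"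
    using abs_Im_le_cmod[of "u - u'"] pi_ge_two by (simp add: dist_norm)
  then show "u = u'" using eq by (rule exp_complex_eqI)
qed

lemma exp_image_borel: "r \<le> 1 \<Longrightarrow> B \<in> sets borel \<Longrightarrow> B \<subseteq> ball (y::complex) r \<Longrightarrow> exp ` B \<in> sets borel"
  by (rule holomorphic_inj_image_borel[OF _ open_ball exp_inj_ball]) (auto intro!: holomorphic_intros)

lemma kd: "koebe_const * d > 0" "koebe_const * d \<le> d" "ball y (koebe_const * d) \<subseteq> ball y d"
proof -
  show "koebe_const * d > 0" using koebe_const d_pos by simp
  have "koebe_const * d \<le> 1 * d" using koebe_const d_pos by (intro mult_right_mono) auto
  then show "koebe_const * d \<le> d" by simp
  then show "ball y (koebe_const * d) \<subseteq> ball y d" by (rule subset_ball)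
qed

definition branch :: "nat \<Rightarrow> complex \<Rightarrow> (complex \<Rightarrow> complex) \<Rightarrow> bool" where
  "branch n y \<psi> \<longleftrightarrow> \<psi> holomorphic_on ball y d \<and> (\<forall>u\<in>ball y d. (f ^^ n) (\<psi> u) = u)"

context
  fixes n y \<psi>
  assumes br: "branch n y \<psi>"
begin

lemma branch_hol: "\<psi> holomorphic_on ball y d" and branch_eq: "u \<in> ball y d \<Longrightarrow> (f ^^ n) (\<psi> u) = u"
  using br by (auto simp: branch_def)

lemma branch_gn: "u \<in> ball y d \<Longrightarrow> (g ^^ n) (exp (\<psi> u)) = exp u"
  by (simp add: gn_exp branch_eq)

lemma branch_inj: "inj_on \<psi> (ball y d)"
  using branch_eq by (metis inj_onI)

lemma branch_exp_inj: "inj_on (\<lambda>u. exp (\<psi> u)) (ball y d)"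
proof (rule inj_onI)
  fix u u' assume u: "u \<in> ball y d" "u' \<in> ball y d" and eq: "exp (\<psi> u) = exp (\<psi> u')"
  then have "exp u = exp u'" using branch_gn by metis
  then show "u = u'" using exp_inj_ball[OF d1, of y] u by (auto dest: inj_onD)
qed

lemma branch_exp_hol: "(\<lambda>u. exp (\<psi> u)) holomorphic_on ball y d"
  by (intro holomorphic_intros branch_hol)

lemma branch_X: "u \<in> ball y d \<Longrightarrow> \<psi> u \<in> X \<longleftrightarrow> u \<in> X"
  using X_fn[of n "\<psi> u"] branch_eq by simp

lemma branch_deriv:
  assumes u: "u \<in> ball y d"
  shows "norm (deriv (f ^^ n) (\<psi> u)) * norm (deriv \<psi> u) = 1"
proof -
  have "((\<lambda>u. (f ^^ n) (\<psi> u)) has_field_derivative deriv (f ^^ n) (\<psi> u) * deriv \<psi> u) (at u)"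
    using u by (intro DERIV_chain2[OF DERIV_fn] holomorphic_derivI[OF branch_hol]) auto
  then have "((\<lambda>u. u) has_field_derivative deriv (f ^^ n) (\<psi> u) * deriv \<psi> u) (at u)"
    by (rule has_field_derivative_transform_within_open[OF _ open_ball u]) (use branch_eq in auto)
  then have "deriv (f ^^ n) (\<psi> u) * deriv \<psi> u = 1" using DERIV_unique[OF _ DERIV_ident] by blast
  then show ?thesis by (metis norm_mult norm_one)
qed

lemma branch_image_borel:
  assumes "B \<in> sets borel" "B \<subseteq> ball y d"
  shows "(\<lambda>u. exp (\<psi> u)) ` B \<in> sets borel"
  by (rule holomorphic_inj_image_borel[OF branch_exp_hol open_ball branch_exp_inj assms])

text \<open>On the disc of radius \<open>koebe_const * d\<close> the derivative of the branch agrees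
  with \<open>D\<close> up to a factor 2, so the integrand supplied by \<open>conf_iterate\<close>
  and \<open>prod_wt\<close> lies between the two stated constants.\<close>

lemma branch_estimate:
  assumes M: "conf M" and B: "B \<in> sets borel" "B \<subseteq> ball y (koebe_const * d)" "B \<subseteq> X"
  defines "D \<equiv> norm (deriv \<psi> y)"
  shows "\<alpha> ^ n * (1 / (2 * D)) powr t * measure M ((\<lambda>u. exp (\<psi> u)) ` B) \<le> measure M (exp ` B)"
    and "measure M (exp ` B) \<le> \<alpha> ^ n * (2 / D) powr t * measure M ((\<lambda>u. exp (\<psi> u)) ` B)"
proof -
  interpret finite_measure M by (rule conf_finite[OF M])
  have sM: "sets M = sets borel" by (rule conf_sets[OF M])
  let ?A = "(\<lambda>u. exp (\<psi> u)) ` B"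
  have Bd: "B \<subseteq> ball y d" using B(2) kd(3) by blast
  have A: "?A \<in> sets borel" by (rule branch_image_borel[OF B(1) Bd])
  have AS: "?A \<subseteq> S"
  proof (rule image_subsetI)
    fix u assume "u \<in> B"
    then show "exp (\<psi> u) \<in> S" using Bd B(3) branch_X[of u] S_exp by blast
  qed
  have Aim: "(g ^^ n) ` ?A = exp ` B" using Bd branch_gn by (force simp: image_iff)
  have Ainj: "inj_on (g ^^ n) ?A"
  proof (rule inj_onI)
    fix w w' assume "w \<in> ?A" "w' \<in> ?A" and eq: "(g ^^ n) w = (g ^^ n) w'"
    then obtain u u' where u: "u \<in> B" "w = exp (\<psi> u)" "u' \<in> B" "w' = exp (\<psi> u')" by blast
    then have "exp u = exp u'" using eq Bd branch_gn by (metis subsetD)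
    then have "u = u'" using exp_inj_ball[OF d1, of y] u Bd by (auto dest: inj_onD)
    then show "w = w'" using u by simp
  qed
  have D: "D > 0" using branch_deriv[of y] d_pos unfolding D_def by (metis centre_in_ball less_eq_real_def mult_zero_right norm_ge_zero zero_neq_one)
  have int: "emeasure M (exp ` B) = (\<integral>\<^sup>+w\<in>?A. (\<Prod>k<n. wt ((g ^^ k) w)) \<partial>M)"
    using conf_iterate[OF M A AS Ainj] unfolding Aim .
  have bnd: "ennreal (\<alpha> ^ n * (1 / (2 * D)) powr t) \<le> (\<Prod>k<n. wt ((g ^^ k) w))"
            "(\<Prod>k<n. wt ((g ^^ k) w)) \<le> ennreal (\<alpha> ^ n * (2 / D) powr t)" if w: "w \<in> ?A" for w
  proof -
    obtain u where u: "u \<in> B" "w = exp (\<psi> u)" using w by blast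
    have ub: "u \<in> ball y (koebe_const * d)" "u \<in> ball y d" using u B(2) Bd by auto
    have dist: "norm (deriv \<psi> u) \<le> 2 * D" "D \<le> 2 * norm (deriv \<psi> u)"
      unfolding D_def using weak_koebe_distortion[OF branch_hol d_pos branch_inj ub(1)] by auto
    have pos: "norm (deriv \<psi> u) > 0" using dist D by linarith
    have eq: "norm (deriv (f ^^ n) (\<psi> u)) = 1 / norm (deriv \<psi> u)"
      using branch_deriv[OF ub(2)] pos by (simp add: field_simps)
    have "1 / (2 * D) \<le> norm (deriv (f ^^ n) (\<psi> u))" "norm (deriv (f ^^ n) (\<psi> u)) \<le> 2 / D"
      unfolding eq using dist pos D by (simp_all add: field_simps)
    then have "(1 / (2 * D)) powr t \<le> norm (deriv (f ^^ n) (\<psi> u)) powr t"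
       "norm (deriv (f ^^ n) (\<psi> u)) powr t \<le> (2 / D) powr t"
      using D t1 by (auto intro!: powr_mono2)
    then show "ennreal (\<alpha> ^ n * (1 / (2 * D)) powr t) \<le> (\<Prod>k<n. wt ((g ^^ k) w))"
            "(\<Prod>k<n. wt ((g ^^ k) w)) \<le> ennreal (\<alpha> ^ n * (2 / D) powr t)"
      unfolding u(2) prod_wt using \<alpha>_pos by (auto intro!: ennreal_leI mult_left_mono)
  qed
  have sA: "?A \<in> sets M" using A sM by simp
  have cA: "(\<integral>\<^sup>+w\<in>?A. ennreal x \<partial>M) = ennreal (x * measure M ?A)" if "x \<ge> 0" for x
    using that sA by (simp add: nn_integral_cmult_indicator emeasure_eq_measure ennreal_mult)
  have "ennreal (\<alpha> ^ n * (1 / (2 * D)) powr t * measure M ?A) \<le> emeasure M (exp ` B)"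
    unfolding int cA[symmetric, of "\<alpha> ^ n * (1 / (2 * D)) powr t", OF mult_nonneg_nonneg[OF zero_le_power[OF less_imp_le[OF \<alpha>_pos]] powr_ge_zero]]
    by (intro nn_integral_mono) (use bnd in \<open>auto simp: indicator_def\<close>)
  then show "\<alpha> ^ n * (1 / (2 * D)) powr t * measure M ?A \<le> measure M (exp ` B)"
    by (simp add: emeasure_eq_measure)
  have "emeasure M (exp ` B) \<le> ennreal (\<alpha> ^ n * (2 / D) powr t * measure M ?A)"
    unfolding int cA[symmetric, of "\<alpha> ^ n * (2 / D) powr t", OF mult_nonneg_nonneg[OF zero_le_power[OF less_imp_le[OF \<alpha>_pos]] powr_ge_zero]]
    by (intro nn_integral_mono) (use bnd in \<open>auto simp: indicator_def\<close>)
  moreover have "0 \<le> \<alpha> ^ n * (2 / D) powr t * measure M ?A" using \<alpha>_pos by simp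
  ultimately show "measure M (exp ` B) \<le> \<alpha> ^ n * (2 / D) powr t * measure M ?A"
    by (simp add: emeasure_eq_measure ennreal_le_iff)
qed

end

text \<open>For \<open>G = S\<close> the next lemmas concern \<open>M\<close> itself; invariant sets of an iterate are needed for
  ergodicity.\<close>

context
  fixes M G j
  assumes M: "conf M" and j: "j \<ge> 1" and G: "G \<in> sets borel" "G \<subseteq> S"
    and inv: "\<And>w. w \<in> S \<Longrightarrow> (g ^^ j) w \<in> G \<longleftrightarrow> w \<in> G" and MG: "measure M G > 0"
begin

lemma inv_n: "w \<in> S \<Longrightarrow> (g ^^ (j * n)) w \<in> G \<longleftrightarrow> w \<in> G"
proof (induction n)
  case (Suc n)
  have "(g ^^ (j * Suc n)) w = (g ^^ j) ((g ^^ (j * n)) w)" by (simp add: funpow_add)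
  then show ?case using inv[OF S_gn[OF Suc.prems]] Suc by simp
qed simp

text \<open>By \<open>blow_up\<close> every point of \<open>G\<close> is the image of a point of the
  small set under some iterate of \<open>g ^^ j\<close>. Images of null sets are null, so a null
  small set would make \<open>G\<close> null.\<close>

lemma full_support:
  assumes y: "y \<in> X" and r: "r > 0" "r \<le> 1"
  shows "measure M (exp ` (ball y r \<inter> X) \<inter> G) > 0"
proof (rule ccontr)
  interpret finite_measure M by (rule conf_finite[OF M])
  have sM: "sets M = sets borel" by (rule conf_sets[OF M])
  let ?T = "exp ` (ball y r \<inter> X) \<inter> G"
  have T: "?T \<in> sets borel" "?T \<subseteq> S" using G closed_X exp_image_borel[OF r(2), of "ball y r \<inter> X" y] by auto
  assume "\<not> measure M ?T > 0"
  then have T0: "emeasure M ?T = 0" using measure_nonneg[of M ?T] by (simp add: emeasure_eq_measure)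
  have sub: "G \<subseteq> (\<Union>n. (g ^^ (j * n)) ` ?T)"
  proof
    fix w assume w: "w \<in> G"
    then have wS: "w \<in> S" using G by blast
    obtain n k u where u: "dist y u < r" "(f ^^ (j * n)) u = Ln w + per k"
      using blow_up[OF y r(1) j] by blast
    have "Ln w + per k \<in> X" using wS X_per by (simp add: S_Ln)
    then have uX: "u \<in> X" using u(2) X_fn by metis
    have gw: "(g ^^ (j * n)) (exp u) = w" unfolding gn_exp u(2) using S_nz[OF wS] by simp
    then have "exp u \<in> G" using inv_n[of "exp u" n] S_exp uX w by simp
    then have "exp u \<in> ?T" using u uX by auto
    then show "w \<in> (\<Union>n. (g ^^ (j * n)) ` ?T)" using gw by blast
  qed
  have "(\<Union>n. (g ^^ (j * n)) ` ?T) \<in> null_sets M"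
    by (rule null_sets_UN) (use null_image_n[OF M T T0] gn_image_borel[OF T] sM in \<open>auto simp: null_sets_def\<close>)
  then have "G \<in> null_sets M" by (rule null_sets_subset[OF _ _ sub]) (use G sM in simp)
  then show False using MG by (simp add: null_sets_def measure_def)
qed

text \<open>Up to translation by periods, the admissible centres lie in a compact set, because real
  parts on \<open>X\<close> are bounded below; finitely many discs of radius \<open>r/2\<close>
  suffice.\<close>

lemma uniform_support:
  assumes r: "r > 0" "r \<le> 1"
  shows "\<exists>\<beta>>0. \<forall>y\<in>X. norm (exp y) \<le> R \<longrightarrow> \<beta> \<le> measure M (exp ` (ball y r \<inter> X) \<inter> G)"
proof -
  interpret finite_measure M by (rule conf_finite[OF M])
  have sM: "sets M = sets borel" by (rule conf_sets[OF M])
  define m where "m = (\<lambda>y r. measure M (exp ` (ball y r \<inter> X) \<inter> G))"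
  define Y where "Y = X \<inter> {y. Re y \<le> ln (max R 1) \<and> 0 \<le> Im y \<and> Im y \<le> 2 * pi}"
  have "closed {y::complex. Re y \<le> ln (max R 1) \<and> 0 \<le> Im y \<and> Im y \<le> 2 * pi}"
    by (intro closed_Collect_conj closed_Collect_le continuous_intros)
  then have "closed Y" unfolding Y_def by (intro closed_Int closed_X)
  moreover have "bounded Y"
    unfolding bounded_iff
  proof (intro exI ballI)
    fix y assume y: "y \<in> Y"
    then have "- norm a0 - 4 < Re y" using X_Re by (auto simp: Y_def)
    moreover have "0 \<le> ln (max R 1)" by simp
    moreover have "Re y \<le> ln (max R 1)" using y by (simp add: Y_def)
    ultimately have "\<bar>Re y\<bar> \<le> norm a0 + 4 + ln (max R 1)" using norm_ge_zero[of a0] by linarith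
    moreover have "\<bar>Im y\<bar> \<le> 2 * pi" using y by (auto simp: Y_def)
    ultimately show "norm y \<le> norm a0 + 4 + ln (max R 1) + 2 * pi" using cmod_le[of y] by linarith
  qed
  ultimately have "compact Y" by (simp add: compact_eq_bounded_closed)
  then obtain F where F: "F \<subseteq> Y" "finite F" "Y \<subseteq> (\<Union>x\<in>F. ball x (r/2))"
    by (rule compactE_image[where C = Y and f = "\<lambda>x. ball x (r/2)"]) (use r in auto)
  define \<beta> where "\<beta> = Min (insert 1 ((\<lambda>x. m x (r/2)) ` F))"
  have "m x (r/2) > 0" if "x \<in> F" for x
    unfolding m_def using that F(1) r by (intro full_support) (auto simp: Y_def)
  then have "\<beta> > 0" unfolding \<beta>_def using F(2) by (subst Min_gr_iff) auto
  moreover have "\<beta> \<le> m y r" if y: "y \<in> X" "norm (exp y) \<le> R" for y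
  proof -
    define k where "k = - \<lfloor>Im y / (2 * pi)\<rfloor>"
    define y' where "y' = y + per k"
    have "of_int (- k) \<le> Im y / (2 * pi)" "Im y / (2 * pi) < of_int (- k) + 1"
      unfolding k_def by linarith+
    then have "- (2 * pi * k) \<le> Im y" "Im y \<le> - (2 * pi * k) + 2 * pi"
      by (simp_all add: field_simps)
    then have Im: "0 \<le> Im y'" "Im y' \<le> 2 * pi" by (simp_all add: y'_def)
    have "exp (Re y) \<le> max R 1" using y(2) by simp
    then have "Re y \<le> ln (max R 1)" by (metis exp_gt_zero exp_le_cancel_iff exp_ln less_le_trans)
    then have "y' \<in> Y" using y Im X_per by (simp add: Y_def y'_def)
    then obtain x where x: "x \<in> F" "y' \<in> ball x (r/2)" using F(3) by blast
    have "exp ` (ball x (r/2) \<inter> X) \<subseteq> exp ` (ball y r \<inter> X)"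
    proof
      fix w assume "w \<in> exp ` (ball x (r/2) \<inter> X)"
      then obtain u where u: "u \<in> ball x (r/2)" "u \<in> X" "w = exp u" by blast
      have "dist y' u < r" using u(1) x(2) dist_triangle[of y' u x] by (simp add: dist_commute)
      then have "dist y (u + per (- k)) < r" by (simp add: y'_def dist_norm per_minus algebra_simps)
      moreover have "u + per (- k) \<in> X" using u X_per by simp
      moreover have "w = exp (u + per (- k))" using u by simp
      ultimately show "w \<in> exp ` (ball y r \<inter> X)" by (intro image_eqI[of _ _ "u + per (- k)"]) auto
    qed
    moreover have "exp ` (ball y r \<inter> X) \<in> sets borel"
      using closed_X by (intro exp_image_borel[OF r(2)]) auto
    ultimately have "m x (r/2) \<le> m y r"
      unfolding m_def using G sM by (intro finite_measure_mono) auto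
    moreover have "\<beta> \<le> m x (r/2)" unfolding \<beta>_def using F(2) x(1) by (intro Min_le) auto
    ultimately show ?thesis by linarith
  qed
  ultimately show ?thesis unfolding m_def by blast
qed

text \<open>Almost every \<open>w\<close> has arbitrarily small radii \<open>r\<close> for which
  \<open>M1\<close> of the disc of radius \<open>5 * r\<close> is at most \<open>L\<close> times the
  mass of \<open>M\<close> in \<open>G\<close> on the disc of radius \<open>r\<close>. The factor 5
  is that of Vitali's lemma, which sums these bounds over disjoint discs inside an open set.\<close>

lemma domination:
  assumes M1: "conf M1"
  shows "\<exists>L\<ge>0. \<forall>A\<in>sets borel. measure M1 A \<le> L * measure M (A \<inter> G)"
proof -
  interpret finite_measure M by (rule conf_finite[OF M])
  interpret M1: finite_measure M1 by (rule conf_finite[OF M1])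
  have sM: "sets M = sets borel" by (rule conf_sets[OF M])
  have sM1: "sets M1 = sets borel" by (rule conf_sets[OF M1])
  obtain R where R: "\<forall>M. conf M \<longrightarrow> (\<exists>Z\<in>sets borel. emeasure M Z = 0 \<and> (\<forall>w\<in>S - Z. \<forall>m. \<exists>n\<ge>m. norm ((g ^^ (j * n)) w) \<le> R))"
    using recurrence_multiples[OF j] by (rule exE)
  obtain Z where Z: "Z \<in> sets borel" "emeasure M1 Z = 0" "\<And>w m. w \<in> S - Z \<Longrightarrow> \<exists>n\<ge>m. norm ((g ^^ (j * n)) w) \<le> R"
    using mp[OF spec[OF R] M1] by metis
  let ?\<kappa> = koebe_const
  \<comment> \<open>The divisor 20 makes \<open>2 * (norm w * D) * \<delta>\<close> equal to the
    radius \<open>r\<close> chosen below; \<open>2 * (norm w * D)\<close> bounds the derivative of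
    the branch followed by \<open>exp\<close>.\<close>
  define \<delta> where "\<delta> = ?\<kappa> ^ 2 * d / 20"
  have \<kappa>: "0 < ?\<kappa>" "?\<kappa> \<le> 1/8" by (rule koebe_const)+
  have \<delta>: "0 < \<delta>" "\<delta> \<le> ?\<kappa> * d" "\<delta> \<le> 1"
  proof -
    show "0 < \<delta>" using \<kappa> d_pos by (simp add: \<delta>_def)
    have "?\<kappa> * d * ?\<kappa> \<le> ?\<kappa> * d * 20" using \<kappa> d_pos by (intro mult_left_mono) auto
    then show "\<delta> \<le> ?\<kappa> * d" by (simp add: \<delta>_def power2_eq_square mult_ac)
    also have "\<dots> \<le> 1 * 1" using \<kappa> d_pos d1 by (intro mult_mono) auto
    finally show "\<delta> \<le> 1" by simp
  qed
  obtain \<beta> where \<beta>: "\<beta> > 0" "\<And>y. y \<in> X \<Longrightarrow> norm (exp y) \<le> R \<Longrightarrow> \<beta> \<le> measure M (exp ` (ball y \<delta> \<inter> X) \<inter> G)"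
    using uniform_support[OF \<delta>(1,3), of R] by blast
  define L where "L = 4 powr t * measure M1 UNIV / \<beta>"
  have L: "L \<ge> 0" unfolding L_def using \<beta> by simp
  have ball: "\<exists>r. 0 < r \<and> r \<le> 1 \<and> r < e \<and> measure M1 (cball w (5 * r)) \<le> L * measure M (cball w r \<inter> G)"
    if w: "w \<in> S - Z" and e: "e > 0" for w e
  proof -
    define x where "x = Ln w"
    have xX: "x \<in> X" and wx: "exp x = w" using w by (auto simp: S_Ln x_def)
    have "\<forall>\<^sub>F n in sequentially. norm (deriv (f ^^ n) x) > norm w / min e 1"
      using expansion[OF xX] unfolding filterlim_at_top_dense by blast
    then obtain m where m: "\<And>n. n \<ge> m \<Longrightarrow> norm (deriv (f ^^ n) x) > norm w / min e 1"
      unfolding eventually_sequentially by blast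
    obtain n' where n': "n' \<ge> m" "norm ((g ^^ (j * n')) w) \<le> R" using Z(3)[OF w, of m] by blast
    \<comment> \<open>A multiple of \<open>j\<close>, so that \<open>inv_n\<close> transports
      membership in \<open>G\<close> along the branch.\<close>
    define n where "n = j * n'"
    have "1 * n' \<le> n" unfolding n_def using j by (rule mult_le_mono1)
    then have nm: "n \<ge> m" using n'(1) by simp
    define y where "y = (f ^^ n) x"
    have yX: "y \<in> X" using xX X_fn by (simp add: y_def)
    have yR: "norm (exp y) \<le> R" using n'(2) by (simp add: y_def n_def gn_exp wx[symmetric] del: norm_exp_eq_Re)
    obtain \<psi> where \<psi>: "branch n y \<psi>" "\<psi> y = x"
      using inverse_branch[OF yX y_def[symmetric]] by (auto simp: branch_def)
    let ?\<phi> = "\<lambda>u. exp (\<psi> u)"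
    have yb: "y \<in> ball y d" using d_pos by simp
    define D where "D = norm (deriv \<psi> y)"
    have Deq: "norm (deriv (f ^^ n) x) * D = 1" using branch_deriv[OF \<psi>(1) yb] \<psi>(2) by (simp add: D_def)
    have D: "D > 0" using Deq unfolding D_def by (metis less_eq_real_def mult_zero_right norm_ge_zero zero_neq_one)
    have D\<phi>: "norm (deriv ?\<phi> y) = norm w * D"
    proof -
      have "(\<psi> has_field_derivative deriv \<psi> y) (at y)" by (rule holomorphic_derivI[OF branch_hol[OF \<psi>(1)] open_ball yb])
      then have "(?\<phi> has_field_derivative exp (\<psi> y) * deriv \<psi> y) (at y)" by (auto intro!: derivative_eq_intros)
      then show ?thesis using \<psi>(2) wx by (simp add: DERIV_imp_deriv norm_mult D_def del: norm_exp_eq_Re)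
    qed
    have w0: "norm w > 0" using w S_nz by auto
    have small: "norm w * D < min e 1"
    proof -
      have "norm w / min e 1 * D < norm (deriv (f ^^ n) x) * D" using m[OF nm] D by (intro mult_strict_right_mono)
      then have "norm w * D / min e 1 < 1" unfolding Deq by simp
      then show ?thesis using e by (simp add: field_simps split: if_splits)
    qed
    \<comment> \<open>The weak quarter theorem on radius \<open>koebe_const * d\<close> covers a
      disc of radius \<open>10 * r\<close>, which leaves room for the closed disc of radius
      \<open>5 * r\<close>.\<close>
    define r where "r = ?\<kappa> ^ 2 * d * (norm w * D) / 10"
    have r0: "r > 0" unfolding r_def using \<kappa> d_pos w0 D by simp
    have "?\<kappa> ^ 2 * d \<le> 1 * 1" using \<kappa> d_pos d1 by (intro mult_mono power_le_one) auto
    then have "?\<kappa> ^ 2 * d * (norm w * D) \<le> 1 * (norm w * D)" using w0 D by (intro mult_right_mono) auto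
    then have rW: "r \<le> norm w * D / 10" unfolding r_def by simp
    have "norm w * D > 0" using w0 D by simp
    moreover have "norm w * D < e" "norm w * D < 1" using small by auto
    ultimately have re: "r < e" "r \<le> 1" using rW by linarith+
    note hk = holomorphic_on_subset[OF branch_exp_hol[OF \<psi>(1)] kd(3)] and ik = inj_on_subset[OF branch_exp_inj[OF \<psi>(1)] kd(3)]
    have "ball (?\<phi> y) (?\<kappa> * (?\<kappa> * d) * norm (deriv ?\<phi> y)) \<subseteq> ?\<phi> ` ball y (?\<kappa> * d)"
      by (rule weak_koebe_quarter[OF hk kd(1) ik])
    then have sub: "ball w (10 * r) \<subseteq> ?\<phi> ` ball y (?\<kappa> * d)"
      unfolding D\<phi> \<psi>(2) wx by (simp add: r_def power2_eq_square mult.assoc)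
    have sub1: "cball w (5 * r) \<inter> S \<subseteq> ?\<phi> ` (ball y (?\<kappa> * d) \<inter> X)"
    proof
      fix x' assume x': "x' \<in> cball w (5 * r) \<inter> S"
      then have "x' \<in> ball w (10 * r)" using r0 by auto
      then obtain u where u: "u \<in> ball y (?\<kappa> * d)" "x' = ?\<phi> u" using sub by blast
      then have "\<psi> u \<in> X" using x' S_exp by simp
      moreover have "u \<in> ball y d" using u(1) kd(3) by blast
      ultimately have "u \<in> X" using branch_X[OF \<psi>(1)] by blast
      then show "x' \<in> ?\<phi> ` (ball y (?\<kappa> * d) \<inter> X)" using u by blast
    qed
    have sub2: "?\<phi> ` ball y \<delta> \<subseteq> cball w r"
    proof
      fix x' assume "x' \<in> ?\<phi> ` ball y \<delta>"
      then obtain u where u: "u \<in> ball y \<delta>" "x' = ?\<phi> u" by blast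
      have uk: "ball y \<delta> \<subseteq> ball y (?\<kappa> * d)" using \<delta> by (intro subset_ball)
      have "norm (?\<phi> u - ?\<phi> y) \<le> 2 * (norm w * D) * norm (u - y)"
      proof (rule field_differentiable_bound[where S = "ball y \<delta>"])
        fix z assume z: "z \<in> ball y \<delta>"
        then have zk: "z \<in> ball y (?\<kappa> * d)" using uk by blast
        then have zd: "z \<in> ball y d" using kd(3) by blast
        show "(?\<phi> has_field_derivative deriv ?\<phi> z) (at z within ball y \<delta>)"
          by (rule DERIV_subset[OF holomorphic_derivI[OF branch_exp_hol[OF \<psi>(1)] open_ball zd]]) auto
        show "norm (deriv ?\<phi> z) \<le> 2 * (norm w * D)"
          using weak_koebe_distortion(1)[OF branch_exp_hol[OF \<psi>(1)] d_pos branch_exp_inj[OF \<psi>(1)] zk] D\<phi> by simp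
      qed (use u \<delta> in auto)
      also have "\<dots> \<le> 2 * (norm w * D) * \<delta>"
        using u w0 D by (intro mult_left_mono) (auto simp: dist_norm norm_minus_commute)
      also have "\<dots> = r" by (simp add: r_def \<delta>_def)
      finally show "x' \<in> cball w r" using u \<psi>(2) wx by (simp add: dist_norm norm_minus_commute)
    qed
    let ?B1 = "ball y (?\<kappa> * d) \<inter> X" and ?B2 = "ball y \<delta> \<inter> X \<inter> exp -` G"
    have expG: "exp -` G \<in> sets borel"
      using measurable_sets[OF borel_measurable_continuous_onI[OF continuous_on_exp[OF continuous_on_id]] G(1)] by simp
    have B1: "?B1 \<in> sets borel" "?B1 \<subseteq> ball y (?\<kappa> * d)" "?B1 \<subseteq> X" using closed_X by auto
    have B2: "?B2 \<in> sets borel" "?B2 \<subseteq> ball y (?\<kappa> * d)" "?B2 \<subseteq> X" using closed_X expG \<delta> by auto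
    have B1d: "?B1 \<subseteq> ball y d" "?B2 \<subseteq> ball y d" using B1 B2 kd(3) by blast+
    have \<alpha>n: "\<alpha> ^ n > 0" using \<alpha>_pos by simp
    have up: "\<alpha> ^ n * (1 / (2 * D)) powr t * measure M1 (cball w (5 * r)) \<le> measure M1 UNIV"
    proof -
      have "measure M1 (cball w (5 * r)) = measure M1 (cball w (5 * r) \<inter> S)"
        using conf_Int_S[OF M1, of "cball w (5 * r)"] by (simp add: M1.emeasure_eq_measure)
      also have "\<dots> \<le> measure M1 (?\<phi> ` ?B1)"
        using branch_image_borel[OF \<psi>(1) B1(1) B1d(1)] sM1 by (intro M1.finite_measure_mono sub1) auto
      finally have "\<alpha> ^ n * (1 / (2 * D)) powr t * measure M1 (cball w (5 * r)) \<le>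
          \<alpha> ^ n * (1 / (2 * D)) powr t * measure M1 (?\<phi> ` ?B1)" using \<alpha>n by (intro mult_left_mono) auto
      also have "\<dots> \<le> measure M1 (exp ` ?B1)" using branch_estimate(1)[OF \<psi>(1) M1 B1] by (simp add: D_def)
      also have "\<dots> \<le> measure M1 UNIV" using sM1 by (intro M1.finite_measure_mono) auto
      finally show ?thesis .
    qed
    have low: "\<beta> \<le> \<alpha> ^ n * (2 / D) powr t * measure M (cball w r \<inter> G)"
    proof -
      have "exp ` (ball y \<delta> \<inter> X) \<inter> G = exp ` ?B2" by auto
      then have "\<beta> \<le> measure M (exp ` ?B2)" using \<beta>(2)[OF yX yR] by simp
      also have "\<dots> \<le> \<alpha> ^ n * (2 / D) powr t * measure M (?\<phi> ` ?B2)" using branch_estimate(2)[OF \<psi>(1) M B2] by (simp add: D_def)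
      also have "\<dots> \<le> \<alpha> ^ n * (2 / D) powr t * measure M (cball w r \<inter> G)"
      proof (intro mult_left_mono finite_measure_mono)
        show "?\<phi> ` ?B2 \<subseteq> cball w r \<inter> G"
        proof
          fix x' assume "x' \<in> ?\<phi> ` ?B2"
          then obtain u where u: "u \<in> ?B2" "x' = ?\<phi> u" by blast
          then have ud: "u \<in> ball y d" using B1d by blast
          have "?\<phi> u \<in> S" using u branch_X[OF \<psi>(1) ud] S_exp by simp
          moreover have "(g ^^ (j * n')) (?\<phi> u) \<in> G" using branch_gn[OF \<psi>(1) ud] u by (simp add: n_def)
          ultimately have "?\<phi> u \<in> G" using inv_n by blast
          moreover have "?\<phi> u \<in> cball w r" using sub2 u by blast
          ultimately show "x' \<in> cball w r \<inter> G" using u by simp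
        qed
        show "cball w r \<inter> G \<in> sets M" using G sM by auto
      qed (use \<alpha>n in auto)
      finally show ?thesis .
    qed
    have "measure M1 (cball w (5 * r)) * \<beta> \<le> 4 powr t * measure M1 UNIV * measure M (cball w r \<inter> G)"
    proof -
      \<comment> \<open>The lower distortion factor; the upper one is \<open>4 powr t\<close> times
        as large, because \<open>2 / D\<close> is four times \<open>1 / (2 * D)\<close>. Hence
        \<open>L\<close> depends on neither \<open>n\<close> nor \<open>w\<close>.\<close>
      define a where "a = \<alpha> ^ n * (1 / (2 * D)) powr t"
      have a: "a > 0" unfolding a_def using \<alpha>n D by simp
      have "(2 / D) powr t = (4 * (1 / (2 * D))) powr t" using D by (simp add: field_simps)
      also have "\<dots> = 4 powr t * (1 / (2 * D)) powr t" by (rule powr_mult)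
      finally have a2: "\<alpha> ^ n * (2 / D) powr t = 4 powr t * a" by (simp add: a_def)
      have "a * (measure M1 (cball w (5 * r)) * \<beta>) \<le> measure M1 UNIV * \<beta>"
        using mult_right_mono[OF up less_imp_le[OF \<beta>(1)]] by (simp add: a_def mult_ac)
      also have "\<dots> \<le> measure M1 UNIV * (4 powr t * a * measure M (cball w r \<inter> G))"
        using low unfolding a2 by (intro mult_left_mono) auto
      also have "\<dots> = a * (4 powr t * measure M1 UNIV * measure M (cball w r \<inter> G))" by (simp add: mult_ac)
      finally show ?thesis using a by (simp add: mult_le_cancel_left)
    qed
    then have "measure M1 (cball w (5 * r)) \<le> L * measure M (cball w r \<inter> G)"
      unfolding L_def using \<beta>(1) by (simp add: field_simps)
    then show ?thesis using r0 re by blast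
  qed
  have main: "measure M1 A \<le> L * (measure M (A \<inter> G) + e)" if A: "A \<in> sets borel" and e: "e > 0" for A e
  proof -
    let ?MG = "density M (indicator G)"
    have GM: "G \<in> sets M" using G sM by simp
    have eMG: "emeasure ?MG B = emeasure M (B \<inter> G)" if "B \<in> sets borel" for B
    proof -
      have "emeasure ?MG B = (\<integral>\<^sup>+x. indicator G x * indicator B x \<partial>M)"
        using that sM by (intro emeasure_density borel_measurable_indicator GM) simp
      also have "\<dots> = (\<integral>\<^sup>+x. indicator (B \<inter> G) x \<partial>M)" by (intro nn_integral_cong) (auto simp: indicator_def)
      also have "\<dots> = emeasure M (B \<inter> G)" using that GM sM by (intro nn_integral_indicator) auto
      finally show ?thesis .
    qed
    let ?A' = "A \<inter> S - Z"
    have A': "?A' \<in> sets borel" using A Z(1) by auto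
    \<comment> \<open>Outer regularity yields an open \<open>U\<close> whose mass in
      \<open>G\<close> exceeds that of \<open>?A'\<close> by at most \<open>e\<close>; the discs are
      kept inside \<open>U\<close>.\<close>
    have "emeasure ?MG ?A' = (INF U \<in> {U. ?A' \<subseteq> U \<and> open U}. emeasure ?MG U)"
      using A' sM eMG[of UNIV] sets_eq_imp_space_eq[OF sM] by (intro outer_regular) (auto simp: emeasure_eq_measure)
    moreover have "emeasure ?MG ?A' < emeasure ?MG ?A' + ennreal e"
      unfolding eMG[OF A'] emeasure_eq_measure using e by (simp add: ennreal_plus[symmetric] ennreal_less_iff del: ennreal_plus)
    ultimately have "\<exists>U\<in>{U. ?A' \<subseteq> U \<and> open U}. emeasure ?MG U < emeasure ?MG ?A' + ennreal e"
      by (metis (no_types, lifting) INF_less_iff)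
    then obtain U where U: "?A' \<subseteq> U" "open U" "emeasure ?MG U < emeasure ?MG ?A' + ennreal e" by blast
    have "emeasure M (U \<inter> G) < emeasure M (?A' \<inter> G) + ennreal e"
      using U(3) eMG[OF A'] eMG[of U] U(2) by simp
    then have mU: "measure M (U \<inter> G) \<le> measure M (?A' \<inter> G) + e"
      unfolding emeasure_eq_measure using e by (simp add: ennreal_plus[symmetric] ennreal_less_iff del: ennreal_plus)
    have "\<forall>w\<in>?A'. \<exists>r. 0 < r \<and> r \<le> 1 \<and> cball w r \<subseteq> U \<and> measure M1 (cball w (5 * r)) \<le> L * measure M (cball w r \<inter> G)"
    proof
      fix w assume w: "w \<in> ?A'"
      then obtain e' where e': "e' > 0" "ball w e' \<subseteq> U" using U open_contains_ball by blast
      obtain r where r: "0 < r" "r \<le> 1" "r < e'" "measure M1 (cball w (5 * r)) \<le> L * measure M (cball w r \<inter> G)"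
        using ball[OF _ e'(1), of w] w by blast
      have "cball w r \<subseteq> ball w e'" using r by auto
      then show "\<exists>r. 0 < r \<and> r \<le> 1 \<and> cball w r \<subseteq> U \<and> measure M1 (cball w (5 * r)) \<le> L * measure M (cball w r \<inter> G)"
        using r e' by blast
    qed
    then obtain r where r: "\<And>w. w \<in> ?A' \<Longrightarrow> 0 < r w \<and> r w \<le> 1 \<and> cball w (r w) \<subseteq> U \<and> measure M1 (cball w (5 * r w)) \<le> L * measure M (cball w (r w) \<inter> G)"
      by metis
    have cov: "?A' \<subseteq> (\<Union>w\<in>?A'. cball w (r w))"
    proof
      fix w assume w: "w \<in> ?A'"
      then have "w \<in> cball w (r w)" using r[OF w] by simp
      then show "w \<in> (\<Union>w\<in>?A'. cball w (r w))" using w by blast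
    qed
    obtain C where C: "countable C" "C \<subseteq> ?A'" "pairwise (\<lambda>i j. disjnt (cball i (r i)) (cball j (r j))) C"
        "?A' \<subseteq> (\<Union>i\<in>C. cball i (5 * r i))"
    proof (rule Vitali_covering_lemma_cballs[OF cov, where B = 1])
      fix i assume "i \<in> ?A'"
      from r[OF this] show "0 < r i \<and> r i \<le> 1" by blast
    qed (rule that)
    have "emeasure M1 ?A' \<le> emeasure M1 (\<Union>i\<in>C. cball i (5 * r i))"
      using C sM1 by (intro emeasure_mono sets.countable_UN'') auto
    also have "\<dots> \<le> (\<integral>\<^sup>+i. emeasure M1 (cball i (5 * r i)) \<partial>count_space C)"
      using C sM1 by (intro emeasure_UN_countable_le) auto
    also have "\<dots> \<le> (\<integral>\<^sup>+i. ennreal L * emeasure M (cball i (r i) \<inter> G) \<partial>count_space C)"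
    proof (rule nn_integral_mono)
      fix i assume "i \<in> space (count_space C)"
      then have "i \<in> ?A'" using C(2) by auto
      from r[OF this] show "emeasure M1 (cball i (5 * r i)) \<le> ennreal L * emeasure M (cball i (r i) \<inter> G)"
        unfolding M1.emeasure_eq_measure emeasure_eq_measure using L by (simp add: ennreal_mult[symmetric] ennreal_leI)
    qed
    also have "\<dots> = ennreal L * (\<integral>\<^sup>+i. emeasure M (cball i (r i) \<inter> G) \<partial>count_space C)"
      by (rule nn_integral_cmult) simp
    also have "(\<integral>\<^sup>+i. emeasure M (cball i (r i) \<inter> G) \<partial>count_space C) = emeasure M (\<Union>i\<in>C. cball i (r i) \<inter> G)"
    proof (rule emeasure_UN_countable[symmetric])
      show "disjoint_family_on (\<lambda>i. cball i (r i) \<inter> G) C"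
        using C(3) unfolding disjoint_family_on_def pairwise_def disjnt_def by blast
    qed (use C sM G in auto)
    also have "ennreal L * \<dots> \<le> ennreal L * emeasure M (U \<inter> G)"
    proof (intro mult_left_mono emeasure_mono)
      show "(\<Union>i\<in>C. cball i (r i) \<inter> G) \<subseteq> U \<inter> G" using C(2) r by blast
    qed (use U sM G in auto)
    finally have "measure M1 ?A' \<le> L * measure M (U \<inter> G)"
      unfolding M1.emeasure_eq_measure emeasure_eq_measure using L
      by (simp add: ennreal_mult[symmetric] ennreal_le_iff)
    also have "\<dots> \<le> L * (measure M (A \<inter> G) + e)"
    proof -
      have "measure M (?A' \<inter> G) \<le> measure M (A \<inter> G)" using A G sM by (intro finite_measure_mono) auto
      then show ?thesis using mU L by (intro mult_left_mono) auto
    qed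
    also have "measure M1 ?A' = measure M1 A"
    proof -
      have Z0: "Z \<in> null_sets M1" using Z sM1 by (auto simp: null_sets_def)
      have "emeasure M1 ?A' = emeasure M1 (A \<inter> S)"
        using A sM1 by (intro emeasure_Diff_null_set[OF Z0]) auto
      also have "\<dots> = emeasure M1 A" by (rule conf_Int_S[OF M1 A])
      finally show ?thesis by (simp add: measure_def)
    qed
    finally show ?thesis .
  qed
  have "measure M1 A \<le> L * measure M (A \<inter> G)" if A: "A \<in> sets borel" for A
  proof (rule field_le_epsilon)
    fix e :: real assume e: "e > 0"
    \<comment> \<open>Dividing by \<open>L + 1\<close> instead of \<open>L\<close> covers the case
      \<open>L = 0\<close>.\<close>
    have "measure M1 A \<le> L * (measure M (A \<inter> G) + e / (L + 1))"
      using L e by (intro main[OF A]) auto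
    also have "\<dots> = L * measure M (A \<inter> G) + L / (L + 1) * e" by (simp add: algebra_simps)
    also have "L / (L + 1) * e \<le> 1 * e" using L e by (intro mult_right_mono) auto
    finally show "measure M1 A \<le> L * measure M (A \<inter> G) + e" by simp
  qed
  then show ?thesis using L by blast
qed

end

end


section \<open>Uniqueness and ergodicity\<close>

context lc_conf
begin

text \<open>The case \<open>j = 1\<close>, \<open>G = S\<close> of \<open>domination\<close>;
  \<open>S\<close> is invariant and carries all the mass.\<close>

lemma conf_dominated:
  assumes M1: "conf M1" and M: "conf M" and pos: "measure M UNIV > 0"
  shows "\<exists>L\<ge>0. \<forall>A\<in>sets borel. measure M1 A \<le> L * measure M A"
proof -
  have eq: "measure M (A \<inter> S) = measure M A" if "A \<in> sets borel" for A
    using conf_Int_S[OF M that] by (simp add: measure_def)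
  have "measure M S > 0" using pos eq[of UNIV] by simp
  then have "\<exists>L\<ge>0. \<forall>A\<in>sets borel. measure M1 A \<le> L * measure M (A \<inter> S)"
    by (intro domination[OF M, of 1] M1) (auto simp: S_g S_nz)
  then show ?thesis using eq by auto
qed

text \<open>The conformality equation is linear in the measure; finiteness allows the
  \<open>M1\<close> terms to be cancelled in the extended reals.\<close>

lemma conf_diff:
  assumes M1: "conf M1" and M2: "conf M2" and L: "L \<ge> 0"
    and le: "\<And>A. A \<in> sets borel \<Longrightarrow> measure M1 A \<le> L * measure M2 A"
  defines "D \<equiv> diff_measure (scale_measure (ennreal L) M2) M1"
  shows "conf D" "\<And>A. A \<in> sets borel \<Longrightarrow> measure D A = L * measure M2 A - measure M1 A"
proof -
  interpret M1: finite_measure M1 by (rule conf_finite[OF M1])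
  interpret M2: finite_measure M2 by (rule conf_finite[OF M2])
  let ?N = "scale_measure (ennreal L) M2"
  have s1: "sets M1 = sets borel" and s2: "sets M2 = sets borel" using conf_sets M1 M2 by auto
  have sD: "sets D = sets borel" by (simp add: D_def s2)
  have eN: "emeasure ?N A = ennreal (L * measure M2 A)" for A
    using L by (simp add: M2.emeasure_eq_measure ennreal_mult)
  have eD: "emeasure D A = ennreal (L * measure M2 A - measure M1 A)" if A: "A \<in> sets borel" for A
  proof -
    have "emeasure D A = emeasure ?N A - emeasure M1 A"
      unfolding D_def
    proof (rule emeasure_diff_measure)
      show "finite_measure ?N" by (rule finite_measureI) (simp add: eN del: emeasure_scale_measure)
      show "finite_measure M1" by (rule M1.finite_measure_axioms)
      show "emeasure M1 B \<le> emeasure ?N B" if "B \<in> sets ?N" for B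
        unfolding eN M1.emeasure_eq_measure using le[of B] that s2 by (intro ennreal_leI) simp
    qed (use A s1 s2 in auto)
    also have "\<dots> = ennreal (L * measure M2 A - measure M1 A)"
      unfolding eN M1.emeasure_eq_measure by (rule ennreal_minus) simp
    finally show ?thesis .
  qed
  then show mD: "measure D A = L * measure M2 A - measure M1 A" if "A \<in> sets borel" for A
    using that le by (simp add: measure_def)
  show "conf D"
    unfolding conf_def
  proof (intro conjI ballI impI)
    show "sets D = sets borel" by (rule sD)
    show "finite_measure D" by (rule finite_measureI) (use eD[of UNIV] sets_eq_imp_space_eq[OF sD] in simp)
    have "measure M2 (- S) = 0" "measure M1 (- S) = 0"
      using conf_null[OF M1, of "- S"] conf_null[OF M2, of "- S"] by (auto simp: measure_def)
    then show "emeasure D (- S) = 0" by (simp add: eD)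
    fix A assume A: "A \<in> sets borel" "A \<subseteq> S" "inj_on g A"
    note [measurable] = A(1)
    have gA: "g ` A \<in> sets borel" by (rule g_image_borel[OF A(1,2)])
    let ?h = "\<lambda>w. wt w * indicator A w"
    have h2: "?h \<in> borel_measurable M2" using s2 by (simp cong: measurable_cong_sets)
    have hN: "?h \<in> borel_measurable ?N" using s2 by (simp cong: measurable_cong_sets)
    have "emeasure ?N B = emeasure D B + emeasure M1 B" if "B \<in> sets ?N" for B
    proof -
      have B: "B \<in> sets borel" using that s2 by simp
      show ?thesis unfolding eN eD[OF B] M1.emeasure_eq_measure using le[OF B]
        by (subst ennreal_plus[symmetric]) auto
    qed
    then have "nn_integral ?N ?h = nn_integral D ?h + nn_integral M1 ?h"
      using s1 s2 sD hN by (intro nn_integral_measure_sum) auto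
    moreover have "nn_integral ?N ?h = ennreal L * nn_integral M2 ?h"
      by (rule nn_integral_scale_measure[OF h2])
    ultimately have "ennreal L * emeasure M2 (g ` A) = nn_integral D ?h + emeasure M1 (g ` A)"
      using conf_image[OF M1 A] conf_image[OF M2 A] by simp
    moreover have "ennreal L * emeasure M2 (g ` A) = emeasure D (g ` A) + emeasure M1 (g ` A)"
      unfolding eD[OF gA] M1.emeasure_eq_measure M2.emeasure_eq_measure using le[OF gA] L
      by (simp add: ennreal_mult[symmetric] ennreal_plus[symmetric] del: ennreal_plus)
    ultimately show "emeasure D (g ` A) = (\<integral>\<^sup>+w\<in>A. wt w \<partial>D)"
      unfolding M1.emeasure_eq_measure using ennreal_add_diff_cancel_right by (metis ennreal_neq_top)
  qed
qed

text \<open>If \<open>L\<close> is the least constant with \<open>M1 \<le> L M2\<close> and \<open>L > 1\<close>, then \<open>L M2 - M1\<close> is again conformal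
  and nonzero, so it dominates a multiple of \<open>M2\<close>; this contradicts the minimality of \<open>L\<close>.\<close>

lemma conf_unique:
  assumes M1: "conf M1" and M2: "conf M2" and 1: "measure M1 UNIV = 1" "measure M2 UNIV = 1"
  shows "M1 = M2"
proof -
  interpret M1: finite_measure M1 by (rule conf_finite[OF M1])
  interpret M2: finite_measure M2 by (rule conf_finite[OF M2])
  have s1: "sets M1 = sets borel" and s2: "sets M2 = sets borel" using conf_sets M1 M2 by auto
  define I where "I = {L. 0 \<le> L \<and> (\<forall>A\<in>sets borel. measure M1 A \<le> L * measure M2 A)}"
  have "\<exists>L\<ge>0. \<forall>A\<in>sets borel. measure M1 A \<le> L * measure M2 A"
    using 1 by (intro conf_dominated[OF M1 M2]) simp
  then have ne: "I \<noteq> {}" by (auto simp: I_def)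
  have bdd: "bdd_below I" by (intro bdd_belowI[of _ 0]) (auto simp: I_def)
  define L where "L = Inf I"
  have low: "x \<le> L" if "\<And>y. y \<in> I \<Longrightarrow> x \<le> y" for x
    unfolding L_def using ne that by (rule cInf_greatest)
  have L0: "L \<ge> 0" by (rule low) (auto simp: I_def)
  \<comment> \<open>The infimum is itself admissible, set by set; sets null for \<open>M2\<close>
    are null for \<open>M1\<close> because some admissible constant exists.\<close>
  have le: "measure M1 A \<le> L * measure M2 A" if A: "A \<in> sets borel" for A
  proof (cases "measure M2 A = 0")
    case True
    obtain y where "y \<in> I" using ne by blast
    then have "measure M1 A \<le> y * measure M2 A" using A by (simp add: I_def)
    then show ?thesis using True by simp
  next
    case False
    then have pos: "measure M2 A > 0" by (simp add: zero_less_measure_iff)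
    have "measure M1 A / measure M2 A \<le> L"
    proof (rule low)
      fix y assume "y \<in> I"
      then have "measure M1 A \<le> y * measure M2 A" using A by (simp add: I_def)
      then show "measure M1 A / measure M2 A \<le> y" using pos by (simp add: field_simps)
    qed
    then show ?thesis using pos by (simp add: field_simps)
  qed
  have "L \<ge> 1" using le[of UNIV] 1 by simp
  have "L = 1"
  proof (rule ccontr)
    assume "L \<noteq> 1"
    then have L1: "L > 1" using \<open>L \<ge> 1\<close> by simp
    define D where "D = diff_measure (scale_measure (ennreal L) M2) M1"
    have D: "conf D" "\<And>A. A \<in> sets borel \<Longrightarrow> measure D A = L * measure M2 A - measure M1 A"
      using conf_diff[OF M1 M2 L0 le] by (auto simp: D_def)
    have "measure D UNIV > 0" using D(2)[of UNIV] 1 L1 by simp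
    then obtain K where K: "K \<ge> 0" "\<And>A. A \<in> sets borel \<Longrightarrow> measure M2 A \<le> K * measure D A"
      using conf_dominated[OF M2 D(1)] by blast
    have "K \<noteq> 0" using K(2)[of UNIV] 1 by auto
    then have K0: "K > 0" using K by simp
    have le': "measure M1 A \<le> (L - 1 / K) * measure M2 A" if A: "A \<in> sets borel" for A
    proof -
      have "measure M2 A \<le> K * (L * measure M2 A - measure M1 A)" using K(2)[OF A] D(2)[OF A] by simp
      then have "measure M2 A / K \<le> L * measure M2 A - measure M1 A" using K0 by (simp add: field_simps)
      then show ?thesis by (simp add: algebra_simps)
    qed
    have "L - 1 / K \<ge> 0" using le'[of UNIV] 1 by simp
    then have "L - 1 / K \<in> I" using le' by (simp add: I_def)
    then have "L \<le> L - 1 / K" unfolding L_def using bdd by (intro cInf_lower)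
    then show False using K0 by simp
  qed
  then have le1: "measure M1 A \<le> measure M2 A" if "A \<in> sets borel" for A using le[OF that] by simp
  show ?thesis
  proof (rule measure_eqI)
    show "sets M1 = sets M2" using s1 s2 by simp
    fix A assume "A \<in> sets M1"
    then have A: "A \<in> sets borel" using s1 by simp
    have sp: "space M1 = UNIV" "space M2 = UNIV" using conf_space M1 M2 by auto
    \<comment> \<open>The inequality between the measures also holds on the complement; with equal
      total masses both become equalities.\<close>
    have "measure M1 (UNIV - A) = 1 - measure M1 A" "measure M2 (UNIV - A) = 1 - measure M2 A"
      using M1.finite_measure_compl[of A] M2.finite_measure_compl[of A] A s1 s2 sp 1 by auto
    then have "measure M1 A = measure M2 A" using le1[OF A] le1[of "UNIV - A"] A by auto
    then show "emeasure M1 A = emeasure M2 A" by (simp add: M1.emeasure_eq_measure M2.emeasure_eq_measure)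
  qed
qed

text \<open>A set of positive mass dominates: the complement of \<open>G\<close> has mass at most
  \<open>L\<close> times that of the empty set.\<close>

lemma conf_ergodic:
  assumes M: "conf M" and 1: "measure M UNIV = 1" and j: "j \<ge> 1" and G: "G \<in> sets borel" "G \<subseteq> S"
    and inv: "\<And>w. w \<in> S \<Longrightarrow> (g ^^ j) w \<in> G \<longleftrightarrow> w \<in> G"
  shows "measure M G = 0 \<or> measure M G = 1"
proof (cases "measure M G = 0")
  case False
  interpret finite_measure M by (rule conf_finite[OF M])
  have "measure M G > 0" using False by (simp add: zero_less_measure_iff)
  then obtain L where L: "\<forall>A\<in>sets borel. measure M A \<le> L * measure M (A \<inter> G)"
    using domination[OF M j G inv _ M] by blast
  have sM: "sets M = sets borel" "space M = UNIV" using conf_sets[OF M] conf_space[OF M] by auto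
  have "measure M (UNIV - G) \<le> L * measure M ((UNIV - G) \<inter> G)" by (rule bspec[OF L]) (use G in auto)
  then have "measure M (UNIV - G) \<le> 0" by (simp add: Diff_Int_distrib2)
  moreover have "measure M (UNIV - G) = 1 - measure M G"
    using finite_measure_compl[of G] G sM 1 by simp
  moreover have "measure M G \<le> 1" using bounded_measure[of G] sM 1 by simp
  ultimately show ?thesis by simp
qed simp

end

section \<open>Transfer from the punctured plane to the cylinder\<close>

lift_definition cyl_exp :: "cyl \<Rightarrow> complex" is exp
  unfolding cyl_rel_def using exp_add_period by metis

lemma cyl_exp_proj: "cyl_exp (cyl_proj z) = exp z"
  by transfer simp

lemma cyl_proj_surj: "\<exists>z. x = cyl_proj z"
  by transfer (use equivp_reflp[OF equivp_cyl_rel] in blast)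

lemma cyl_exp_inj: "cyl_exp x = cyl_exp y \<Longrightarrow> x = y"
proof transfer
  fix z w :: complex assume "exp z = exp w"
  then have "exp w = exp z" by simp
  then show "cyl_rel z w" unfolding exp_eq_per cyl_rel_def per_def .
qed

lemma cyl_exp_nz: "cyl_exp x \<noteq> 0"
  using cyl_proj_surj[of x] by (auto simp: cyl_exp_proj)

lemma cyl_exp_Ln: "cyl_proj (Ln (cyl_exp x)) = x"
  using cyl_exp_nz[of x] by (intro cyl_exp_inj) (simp add: cyl_exp_proj)

lemma cyl_exp_measurable [measurable]: "cyl_exp \<in> borel_measurable borel"
proof (rule borel_measurable_continuous_onI)
  have "open (cyl_exp -` U)" if "open U" for U
  proof -
    have "cyl_proj -` (cyl_exp -` U) = exp -` U" by (auto simp: cyl_exp_proj)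
    then show ?thesis unfolding open_cyl_def using that by (auto intro!: open_vimage continuous_intros)
  qed
  then show "continuous_on UNIV cyl_exp" by (simp add: continuous_on_open_vimage)
qed

lemma cyl_proj_measurable [measurable]: "cyl_proj \<in> borel_measurable borel"
proof (rule borel_measurable_continuous_onI)
  show "continuous_on UNIV cyl_proj" by (simp add: continuous_on_open_vimage open_cyl_def)
qed

text \<open>The map sending \<open>w\<close> to \<open>cyl_proj (Ln w)\<close> is a Borel inverse of
  \<open>cyl_exp\<close> off 0, whatever the jump of \<open>Ln\<close>, so images are Borel as
  preimages.\<close>

lemma cyl_exp_image:
  assumes "A \<in> sets borel"
  shows "cyl_exp ` A \<in> sets borel" "cyl_exp -` (cyl_exp ` A) = A"
proof -
  have "(\<lambda>w. cyl_proj (Ln w)) \<in> borel_measurable borel"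
    using measurable_comp[OF borel_measurable_Ln cyl_proj_measurable] by (simp add: o_def)
  then have "(\<lambda>w. cyl_proj (Ln w)) -` A \<inter> space borel \<in> sets borel" using assms by (rule measurable_sets)
  moreover have "cyl_exp ` A = ((\<lambda>w. cyl_proj (Ln w)) -` A \<inter> space borel) - {0}"
  proof (intro set_eqI iffI)
    fix w assume "w \<in> ((\<lambda>w. cyl_proj (Ln w)) -` A \<inter> space borel) - {0}"
    then have "cyl_proj (Ln w) \<in> A" "w = cyl_exp (cyl_proj (Ln w))" by (auto simp: cyl_exp_proj)
    then show "w \<in> cyl_exp ` A" by blast
  qed (auto simp: cyl_exp_Ln cyl_exp_nz)
  ultimately show "cyl_exp ` A \<in> sets borel" by auto
  show "cyl_exp -` (cyl_exp ` A) = A" using cyl_exp_inj by blast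
qed

context lc_conf
begin

lemma mem_Julia_F: "x \<in> Julia_F l c \<longleftrightarrow> cyl_exp x \<in> S"
proof -
  obtain z where z: "x = cyl_proj z" using cyl_proj_surj by blast
  have "x \<in> Julia_F l c \<longleftrightarrow> (\<exists>z'\<in>X. cyl_proj z = cyl_proj z')"
    by (auto simp: Julia_F_def Julia_eq_X z)
  also have "\<dots> \<longleftrightarrow> exp z \<in> S"
    unfolding S_def by (metis (no_types, lifting) cyl_exp_inj cyl_exp_proj image_iff)
  finally show ?thesis by (simp add: z cyl_exp_proj)
qed

lemma Julia_F_vimage: "Julia_F l c = cyl_exp -` S"
  using mem_Julia_F by auto

lemma Julia_F_borel: "Julia_F l c \<in> sets borel"
  unfolding Julia_F_vimage using measurable_sets[OF cyl_exp_measurable S_borel] by simp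

lemma cyl_exp_F: "cyl_exp (F_lc l c x) = g (cyl_exp x)"
  using cyl_proj_surj[of x] by (auto simp: F_lc_proj cyl_exp_proj g_exp)

lemma cyl_exp_Fn: "cyl_exp ((F_lc l c ^^ n) x) = (g ^^ n) (cyl_exp x)"
  by (induction n) (auto simp: cyl_exp_F)

lemma F_abs_deriv_1: "F_abs_deriv l c 1 x = norm (of_nat l - cyl_exp x)"
  using cyl_proj_surj[of x] F_abs_deriv_1_proj by (auto simp: cyl_exp_proj)

context
  fixes \<nu> :: "cyl measure"
  assumes pr: "prob_space \<nu>" and cf: "conformal l c t \<alpha> \<nu>"
begin

lemma nu_space: "space \<nu> = Julia_F l c"
  using cf by (simp add: conformal_def)

lemma nu_sets: "A \<in> sets \<nu> \<longleftrightarrow> A \<in> sets borel \<and> A \<subseteq> Julia_F l c"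
  using cf Julia_F_borel by (auto simp: conformal_def sets_restrict_space_iff)

lemma nu_measurable: "cyl_exp \<in> measurable \<nu> borel"
proof -
  have "cyl_exp \<in> measurable (restrict_space borel (Julia_F l c)) borel"
    by (rule measurable_restrict_space1) measurable
  moreover have "sets \<nu> = sets (restrict_space borel (Julia_F l c))" using cf by (simp add: conformal_def)
  ultimately show ?thesis by (simp cong: measurable_cong_sets)
qed

definition push :: "complex measure" where "push = distr \<nu> borel cyl_exp"

lemma push_eq: "A \<in> sets \<nu> \<Longrightarrow> emeasure push (cyl_exp ` A) = emeasure \<nu> A"
  using cyl_exp_image nu_sets nu_space nu_measurable
  by (auto simp: push_def emeasure_distr Int_absorb2)

text \<open>\<open>cyl_exp\<close> conjugates \<open>F\<close> to \<open>g\<close>, maps the Julia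
  set onto \<open>S\<close> injectively and turns \<open>|F'|\<close> into
  \<open>norm (of_nat l - w)\<close>, so an injective piece for \<open>g\<close> pulls back to one
  for \<open>F\<close>.\<close>

lemma push_conf: "conf push"
  unfolding conf_def
proof (intro conjI ballI impI)
  interpret prob_space \<nu> by (rule pr)
  show "sets push = sets borel" by (simp add: push_def)
  interpret p: prob_space push unfolding push_def by (rule prob_space_distr[OF nu_measurable])
  show "finite_measure push" by (rule p.finite_measure_axioms)
  have "cyl_exp -` (- S) \<inter> space \<nu> = {}" by (auto simp: nu_space mem_Julia_F)
  then show "emeasure push (- S) = 0" by (simp add: push_def emeasure_distr[OF nu_measurable])
  fix A assume A: "A \<in> sets borel" "A \<subseteq> S" "inj_on g A"
  define A' where "A' = cyl_exp -` A"
  have A': "A' \<in> sets \<nu>"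
    unfolding A'_def nu_sets Julia_F_vimage using A measurable_sets[OF cyl_exp_measurable A(1)] by auto
  have inj: "inj_on (F_lc l c) A'"
  proof (rule inj_onI)
    fix x y assume "x \<in> A'" "y \<in> A'" "F_lc l c x = F_lc l c y"
    then have "cyl_exp x = cyl_exp y" using cyl_exp_F A(3) unfolding A'_def by (metis inj_onD vimageE)
    then show "x = y" by (rule cyl_exp_inj)
  qed
  have img: "cyl_exp -` (g ` A) = F_lc l c ` A'"
  proof (intro set_eqI iffI)
    fix y assume "y \<in> cyl_exp -` (g ` A)"
    then obtain w where w: "w \<in> A" "cyl_exp y = g w" by auto
    define x where "x = cyl_proj (Ln w)"
    have x: "cyl_exp x = w" using w A(2) S_nz by (auto simp: x_def cyl_exp_proj)
    then have "y = F_lc l c x" using w cyl_exp_F by (intro cyl_exp_inj) simp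
    then show "y \<in> F_lc l c ` A'" using x w by (auto simp: A'_def)
  qed (auto simp: A'_def cyl_exp_F)
  have gA: "g ` A \<in> sets borel" by (rule g_image_borel[OF A(1,2)])
  have gS: "g ` A \<subseteq> S" using A(2) S_g S_nz by blast
  have "emeasure push (g ` A) = emeasure \<nu> (cyl_exp -` (g ` A) \<inter> space \<nu>)"
    unfolding push_def by (rule emeasure_distr[OF nu_measurable gA])
  also have "cyl_exp -` (g ` A) \<inter> space \<nu> = F_lc l c ` A'"
    unfolding img[symmetric] nu_space Julia_F_vimage using gS by blast
  also have "emeasure \<nu> (F_lc l c ` A') = (\<integral>\<^sup>+x\<in>A'. ennreal (\<alpha> * F_abs_deriv l c 1 x powr t) \<partial>\<nu>)"
    using cf A' inj by (simp add: conformal_def)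
  also have "\<dots> = (\<integral>\<^sup>+x. wt (cyl_exp x) * indicator A (cyl_exp x) \<partial>\<nu>)"
    unfolding F_abs_deriv_1 wt_def A'_def by (intro nn_integral_cong) (simp add: indicator_def)
  also have "\<dots> = (\<integral>\<^sup>+w\<in>A. wt w \<partial>push)"
    unfolding push_def using A by (subst nn_integral_distr[OF nu_measurable]) auto
  finally show "emeasure push (g ` A) = (\<integral>\<^sup>+w\<in>A. wt w \<partial>push)" .
qed

lemma push_UNIV: "measure push UNIV = 1"
proof -
  interpret prob_space \<nu> by (rule pr)
  interpret p: prob_space push unfolding push_def by (rule prob_space_distr[OF nu_measurable])
  show ?thesis using p.prob_space by (simp add: push_def)
qed

end

lemma conformal_unique:
  assumes "prob_space \<nu>" "conformal l c t \<alpha> \<nu>" "prob_space m" "conformal l c t \<alpha> m"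
  shows "\<nu> = m"
proof (rule measure_eqI)
  have eq: "push \<nu> = push m"
    by (rule conf_unique[OF push_conf push_conf push_UNIV push_UNIV]) (fact assms)+
  show "sets \<nu> = sets m" using assms by (simp add: conformal_def)
  then show "emeasure \<nu> A = emeasure m A" if "A \<in> sets \<nu>" for A
    using push_eq[OF assms(1,2) that] push_eq[OF assms(3,4), of A] that eq by simp
qed

lemma conformal_ergodic:
  assumes m: "prob_space m" "conformal l c t \<alpha> m" and j: "j \<ge> 1"
  shows "ergodic_wrt m (F_lc l c ^^ j)"
  unfolding ergodic_wrt_def
proof (intro ballI impI)
  fix G assume G: "G \<in> sets m" and inv: "(F_lc l c ^^ j) -` G = G"
  have Gb: "G \<in> sets borel" "G \<subseteq> Julia_F l c" using G nu_sets[OF m] by auto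
  have memG: "cyl_exp x \<in> cyl_exp ` G \<longleftrightarrow> x \<in> G" for x using cyl_exp_inj by blast
  have "measure (push m) (cyl_exp ` G) = 0 \<or> measure (push m) (cyl_exp ` G) = 1"
  proof (rule conf_ergodic[OF push_conf[OF m] push_UNIV[OF m] j])
    show "cyl_exp ` G \<in> sets borel" by (rule cyl_exp_image[OF Gb(1)])
    show "cyl_exp ` G \<subseteq> S" using Gb(2) mem_Julia_F by blast
    fix w assume "w \<in> S"
    then have "w = cyl_exp (cyl_proj (Ln w))" using S_nz by (simp add: cyl_exp_proj)
    then obtain x where x: "w = cyl_exp x" by blast
    have "(g ^^ j) w \<in> cyl_exp ` G \<longleftrightarrow> (F_lc l c ^^ j) x \<in> G"
      unfolding x cyl_exp_Fn[symmetric] by (rule memG)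
    also have "\<dots> \<longleftrightarrow> x \<in> G" using inv by blast
    finally show "(g ^^ j) w \<in> cyl_exp ` G \<longleftrightarrow> w \<in> cyl_exp ` G" unfolding x memG .
  qed
  moreover interpret prob_space m by (rule m(1))
  have "measure (push m) (cyl_exp ` G) = measure m G" using push_eq[OF m G] by (simp add: measure_def)
  ultimately show "emeasure m G \<in> {0, 1}" by (auto simp: emeasure_eq_measure)
qed

end

theorem theorem4:
  fixes l :: nat and c :: complex and t :: real and m :: "cyl measure"
  assumes "l \<ge> 2" and "c \<in> ball (of_nat l) 1" and "t > 1"
    and "prob_space m" and "conformal l c t (exp (pressure l c t)) m"
  shows "(\<forall>\<nu>. prob_space \<nu> \<and> conformal l c t (exp (pressure l c t)) \<nu> \<longrightarrow> \<nu> = m) \<and>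
         (\<forall>j\<ge>1. ergodic_wrt m (F_lc l c ^^ j))"
proof -
  interpret lc_map l c using assms by unfold_locales
  obtain P d \<epsilon> \<mu> d0 where "basin \<epsilon> \<mu> d0" "trap d P" "d \<le> 1" "P0 \<epsilon> \<subseteq> P" "v \<in> P" "\<forall>z\<in>P. \<exists>n. (f ^^ n) z \<in> P0 \<epsilon>"
    using trap_exists by blast
  then interpret lc_conf l c P d \<epsilon> \<mu> d0 "exp (pressure l c t)" t
    using assms by unfold_locales auto
  show ?thesis using conformal_unique conformal_ergodic assms by blast
qed

end
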